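(* Suppose that $F$ satisfies the geometric structure conditions and $F\le F_\sigma$ for some $0<\sigma<1$, where $F_\sigma(r)=r^{-\sigma}$. Assume that $u$ is a weak subsolution to $\mathcal{L}u\equiv\operatorname{div}\mathcal{A}(x,u)\nabla u=\phi$ in a bounded domain $\Omega\subset\mathbb{R}^n$ with $n\ge2$, where $\mathcal{L}$ has degeneracy $F$ (that is, $\mathcal{A}(x,z)$ has bounded measurable components and $\mathcal{A}(x,z)\sim A(x)=\begin{bmatrix}I_{n-1}&0\\0&f(x_1)^2\end{bmatrix}$ with $f=e^{-F}$) and $\phi$ is $A$-admissible for $\Omega$. Moreover, suppose that $u$ is bounded in the weak sense on the boundary $\partial\Omega$. Then $u$ is globally bounded above in $\Omega$ and satisfies $$\sup_\Omega u\le\sup_{\partial\Omega}u+C\|\phi\|_{X(\Omega)},$$ with the constant $C$ depending only on $\Omega$ (for a fixed degeneracy $F$ and fixed comparability constants of $\mathcal{A}$ with $A$).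
   Context: $\mathcal{A}(x,z)\sim A(x)$ means there is $C\ge1$ with $\frac1C\xi^{T}A(x)\xi\le\xi^{T}\mathcal{A}(x,z)\xi\le C\xi^{T}A(x)\xi$ for a.e. $x\in\Omega$, all $z\in\mathbb{R}$, $\xi\in\mathbb{R}^n$. The degeneracy function $f$ is even, $f(0)=0$, $f(x)\ne0$ for $x\ne0$, and for some $R>0$, $f(x)=e^{-F(|x|)}$ for $0<|x|<R$; standing assumption: $B=\mathrm{diag}(1,\dots,1,f(x_1))$ is Lipschitz continuous. Geometric structure conditions on $F:(0,R)\to\mathbb{R}$ (for some $C\ge1$, $\varepsilon>0$): (1) $\lim_{x\to0^+}F(x)=+\infty$; (2) $F'(x)<0$ and $F''(x)>0$ on $(0,R)$; (3) $\frac1C|F'(r)|\le|F'(x)|\le C|F'(r)|$ for $\frac12r<x<2r<R$; (4) $\frac1{-xF'(x)}$ is increasing on $(0,R)$ and $\le\frac1\varepsilon$ there; (5) $\frac{F''(x)}{-F'(x)}\approx\frac1x$ on $(0,R)$ (comparable up to fixed positive constants). $\nabla_A=(\partial_{x_1},\dots,\partial_{x_{n-1}},f(x_1)\partial_{x_n})$. $W^{1,p}_A(\Omega)$ is the space of $v\in L^p(\Omega)$ with $\nabla_Av\in L^p(\Omega)$; $(W^{1,p}_A)_0(\Omega)$ is the closure in it of the Lipschitz functions with compact support in $\Omega$. $\phi$ is $A$-admissible for $\Omega$ if $\|\phi\|_{X(\Omega)}:=\sup_{v\in(W^{1,1}_A)_0(\Omega)}\frac{\int_\Omega|v\phi|}{\int_\Omega|\nabla_Av|}<\infty$.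 $u\in W^{1,2}_A(\Omega)$ is a weak subsolution if $-\int_\Omega\nabla w^{\mathrm{tr}}\mathcal{A}(x,u(x))\nabla u\ge\int_\Omega\phi w$ for all nonnegative $w\in(W^{1,2}_A)_0(\Omega)$. $u$ is bounded by $\ell\in\mathbb{R}$ on $\partial\Omega$ in the weak sense if $(u-\ell)^+\in(W^{1,2}_A)_0(\Omega)$, and $\sup_{\partial\Omega}u:=\inf\{\ell\in\mathbb{R}:(u-\ell)^+\in(W^{1,2}_A)_0(\Omega)\}$. $\sup_\Omega u$ is the essential supremum. *)

theory Defs
  imports "HOL-Analysis.Analysis" "HOL-Probability.Essential_Supremum"
begin

text \<open>
  Points of Euclidean space are vectors of type \<open>real ^ 'n\<close>.  Two distinct indices \<open>i1\<close> and \<open>iN\<close>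
  name the first coordinate \<open>x\<^sub>1\<close> and the last coordinate \<open>x\<^sub>n\<close>; their existence forces the dimension
  to be at least 2.  Functions on \<open>\<Omega>\<close> are total functions whose values outside \<open>\<Omega>\<close> are never
  inspected, because everything is taken with respect to \<^term>\<open>lebesgue_on \<Omega>\<close> or on subsets of \<open>\<Omega>\<close>.
\<close>

subsection \<open>The degeneracy\<close>

definition degeneracy_function :: "(real \<Rightarrow> real) \<Rightarrow> (real \<Rightarrow> real) \<Rightarrow> real \<Rightarrow> bool" where
  "degeneracy_function f F R \<longleftrightarrow>
     (\<forall>x. f (- x) = f x) \<and> f 0 = 0 \<and> (\<forall>x. x \<noteq> 0 \<longrightarrow> f x \<noteq> 0) \<and>
     (\<forall>x. 0 < \<bar>x\<bar> \<and> \<bar>x\<bar> < R \<longrightarrow> f x = exp (- F \<bar>x\<bar>))"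

text \<open>
  Twice differentiability of \<open>F\<close> on \<open>(0, R)\<close> is implicit in conditions (2)--(5); \<open>F1\<close> and \<open>F2\<close> are
  the first and second derivative.
\<close>

definition geometric_structure :: "(real \<Rightarrow> real) \<Rightarrow> real \<Rightarrow> bool" where
  "geometric_structure F R \<longleftrightarrow>
     (\<exists>F1 F2 C \<epsilon>.
        (\<forall>x\<in>{0<..<R}. (F has_real_derivative F1 x) (at x) \<and> (F1 has_real_derivative F2 x) (at x)) \<and>
        C \<ge> 1 \<and> \<epsilon> > 0 \<and>
        filterlim F at_top (at_right 0) \<and>
        (\<forall>x\<in>{0<..<R}. F1 x < 0 \<and> F2 x > 0) \<and>
        (\<forall>r x. r / 2 < x \<and> x < 2 * r \<and> 2 * r < R \<longrightarrow>
               \<bar>F1 r\<bar> / C \<le> \<bar>F1 x\<bar> \<and> \<bar>F1 x\<bar> \<le> C * \<bar>F1 r\<bar>) \<and>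
        mono_on {0<..<R} (\<lambda>x. 1 / (- x * F1 x)) \<and>
        (\<forall>x\<in>{0<..<R}. 1 / (- x * F1 x) \<le> 1 / \<epsilon>) \<and>
        (\<exists>c1>0. \<exists>c2>0. \<forall>x\<in>{0<..<R}. c1 / x \<le> F2 x / (- F1 x) \<and> F2 x / (- F1 x) \<le> c2 / x))"

text \<open>The diagonal matrix \<open>diag(1, \<dots>, 1, c)\<close>.\<close>

definition diag_last :: "'n \<Rightarrow> real \<Rightarrow> real ^ 'n::finite ^ 'n" where
  "diag_last iN c = (\<chi> i j. if i = j then (if i = iN then c else 1) else 0)"

definition degeneracy_B :: "'n \<Rightarrow> 'n \<Rightarrow> (real \<Rightarrow> real) \<Rightarrow> real ^ 'n::finite \<Rightarrow> real ^ 'n ^ 'n" where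
  "degeneracy_B i1 iN f x = diag_last iN (f (x $ i1))"

definition degeneracy_A :: "'n \<Rightarrow> 'n \<Rightarrow> (real \<Rightarrow> real) \<Rightarrow> real ^ 'n::finite \<Rightarrow> real ^ 'n ^ 'n" where
  "degeneracy_A i1 iN f x = diag_last iN ((f (x $ i1))\<^sup>2)"

subsection \<open>The degenerate gradient\<close>

definition partial_deriv :: "'n \<Rightarrow> (real ^ 'n::finite \<Rightarrow> real) \<Rightarrow> real ^ 'n \<Rightarrow> real" where
  "partial_deriv k g = (\<lambda>x. frechet_derivative g (at x) (axis k 1))"

text \<open>
  Smooth functions with compact support in \<open>\<Omega>\<close>.  Differentiability of all iterated partial derivatives
  makes all of them continuous, so this is the usual class of infinitely differentiable functions.
\<close>

definition test_functions :: "(real ^ 'n::finite) set \<Rightarrow> (real ^ 'n \<Rightarrow> real) set" where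
  "test_functions \<Omega> =
     {\<psi>. (\<forall>ks x. fold partial_deriv ks \<psi> differentiable at x) \<and>
         compact (closure {x. \<psi> x \<noteq> 0}) \<and> closure {x. \<psi> x \<noteq> 0} \<subseteq> \<Omega>}"

text \<open>
  \<open>g = \<nabla>\<^sub>A v = B \<nabla>v\<close> in the sense of distributions.  The weights \<open>B\<^sub>k\<^sub>k\<close> are \<open>1\<close> and, for the last
  coordinate, \<open>f(x\<^sub>1)\<close>; as \<open>f(x\<^sub>1)\<close> does not depend on \<open>x\<^sub>n\<close>, the formal adjoint of
  \<open>B\<^sub>k\<^sub>k \<partial>\<^sub>k\<close> is \<open>- B\<^sub>k\<^sub>k \<partial>\<^sub>k\<close>.
\<close>

definition has_weak_A_gradient ::
  "'n \<Rightarrow> 'n \<Rightarrow> (real \<Rightarrow> real) \<Rightarrow> (real ^ 'n::finite) set \<Rightarrow> (real ^ 'n \<Rightarrow> real) \<Rightarrow> (real ^ 'n \<Rightarrow> real ^ 'n) \<Rightarrow> bool" where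
  "has_weak_A_gradient i1 iN f \<Omega> v g \<longleftrightarrow>
     (\<forall>K. compact K \<and> K \<subseteq> \<Omega> \<longrightarrow> set_integrable lebesgue K v \<and> set_integrable lebesgue K g) \<and>
     (\<forall>\<psi>\<in>test_functions \<Omega>. \<forall>k.
        (LINT x|lebesgue_on \<Omega>. g x $ k * \<psi> x) =
        - (LINT x|lebesgue_on \<Omega>. v x * (degeneracy_B i1 iN f x $ k $ k * partial_deriv k \<psi> x)))"

text \<open>The weak gradient is unique up to null sets, so the choice of a representative is immaterial.\<close>

definition A_gradient ::
  "'n \<Rightarrow> 'n \<Rightarrow> (real \<Rightarrow> real) \<Rightarrow> (real ^ 'n::finite) set \<Rightarrow> (real ^ 'n \<Rightarrow> real) \<Rightarrow> real ^ 'n \<Rightarrow> real ^ 'n" where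
  "A_gradient i1 iN f \<Omega> v = (SOME g. has_weak_A_gradient i1 iN f \<Omega> v g)"

text \<open>
  \<open>\<nabla>v = B\<^sup>-\<^sup>1 \<nabla>\<^sub>A v\<close>, defined off the null set \<open>x\<^sub>1 = 0\<close> on which \<open>f(x\<^sub>1)\<close> vanishes (there the last
  component is set to 0 by the convention for division).
\<close>

definition weak_gradient ::
  "'n \<Rightarrow> 'n \<Rightarrow> (real \<Rightarrow> real) \<Rightarrow> (real ^ 'n::finite) set \<Rightarrow> (real ^ 'n \<Rightarrow> real) \<Rightarrow> real ^ 'n \<Rightarrow> real ^ 'n" where
  "weak_gradient i1 iN f \<Omega> v x = (\<chi> k. A_gradient i1 iN f \<Omega> v x $ k / degeneracy_B i1 iN f x $ k $ k)"

subsection \<open>Degenerate Sobolev spaces\<close>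

definition in_Lp :: "(real ^ 'n::finite) set \<Rightarrow> real \<Rightarrow> (real ^ 'n \<Rightarrow> 'b::real_normed_vector) \<Rightarrow> bool" where
  "in_Lp \<Omega> p v \<longleftrightarrow>
     v \<in> borel_measurable (lebesgue_on \<Omega>) \<and> integrable (lebesgue_on \<Omega>) (\<lambda>x. norm (v x) powr p)"

definition Lp_norm :: "(real ^ 'n::finite) set \<Rightarrow> real \<Rightarrow> (real ^ 'n \<Rightarrow> 'b::real_normed_vector) \<Rightarrow> real" where
  "Lp_norm \<Omega> p v = (LINT x|lebesgue_on \<Omega>. norm (v x) powr p) powr (1 / p)"

definition W1p ::
  "'n \<Rightarrow> 'n \<Rightarrow> (real \<Rightarrow> real) \<Rightarrow> (real ^ 'n::finite) set \<Rightarrow> real \<Rightarrow> (real ^ 'n \<Rightarrow> real) set" where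
  "W1p i1 iN f \<Omega> p = {v. in_Lp \<Omega> p v \<and> (\<exists>g. has_weak_A_gradient i1 iN f \<Omega> v g \<and> in_Lp \<Omega> p g)}"

definition W1p_norm ::
  "'n \<Rightarrow> 'n \<Rightarrow> (real \<Rightarrow> real) \<Rightarrow> (real ^ 'n::finite) set \<Rightarrow> real \<Rightarrow> (real ^ 'n \<Rightarrow> real) \<Rightarrow> real" where
  "W1p_norm i1 iN f \<Omega> p v = Lp_norm \<Omega> p v + Lp_norm \<Omega> p (A_gradient i1 iN f \<Omega> v)"

definition lipschitz_compact_support :: "(real ^ 'n::finite) set \<Rightarrow> (real ^ 'n \<Rightarrow> real) set" where
  "lipschitz_compact_support \<Omega> =
     {\<psi>. (\<exists>L. L-lipschitz_on UNIV \<psi>) \<and>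
         compact (closure {x. \<psi> x \<noteq> 0}) \<and> closure {x. \<psi> x \<noteq> 0} \<subseteq> \<Omega>}"

definition W1p_0 ::
  "'n \<Rightarrow> 'n \<Rightarrow> (real \<Rightarrow> real) \<Rightarrow> (real ^ 'n::finite) set \<Rightarrow> real \<Rightarrow> (real ^ 'n \<Rightarrow> real) set" where
  "W1p_0 i1 iN f \<Omega> p =
     {v \<in> W1p i1 iN f \<Omega> p.
        \<forall>e>0. \<exists>\<psi>\<in>lipschitz_compact_support \<Omega>. W1p_norm i1 iN f \<Omega> p (\<lambda>x. v x - \<psi> x) < e}"

subsection \<open>Admissible right-hand sides\<close>

text \<open>
  In \<^typ>\<open>ennreal\<close> we have \<open>0 / 0 = 0\<close>, so functions \<open>v\<close> vanishing almost everywhere do not contribute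
  to the supremum, while \<open>a / 0 = \<infinity>\<close> for \<open>a > 0\<close>.
\<close>

definition X_norm ::
  "'n \<Rightarrow> 'n \<Rightarrow> (real \<Rightarrow> real) \<Rightarrow> (real ^ 'n::finite) set \<Rightarrow> (real ^ 'n \<Rightarrow> real) \<Rightarrow> ennreal" where
  "X_norm i1 iN f \<Omega> \<phi> =
     (SUP v\<in>W1p_0 i1 iN f \<Omega> 1.
        (\<integral>\<^sup>+x. ennreal \<bar>v x * \<phi> x\<bar> \<partial>lebesgue_on \<Omega>) /
        (\<integral>\<^sup>+x. ennreal (norm (A_gradient i1 iN f \<Omega> v x)) \<partial>lebesgue_on \<Omega>))"

definition A_admissible ::
  "'n \<Rightarrow> 'n \<Rightarrow> (real \<Rightarrow> real) \<Rightarrow> (real ^ 'n::finite) set \<Rightarrow> (real ^ 'n \<Rightarrow> real) \<Rightarrow> bool" where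
  "A_admissible i1 iN f \<Omega> \<phi> \<longleftrightarrow>
     \<phi> \<in> borel_measurable (lebesgue_on \<Omega>) \<and> X_norm i1 iN f \<Omega> \<phi> < \<infinity>"

subsection \<open>The quasilinear operator and its weak subsolutions\<close>

text \<open>
  Measurability in \<open>(x, z)\<close> is Lebesgue in \<open>x\<close> and Borel in \<open>z\<close>, so that \<open>x \<mapsto> \<A>(x, u(x))\<close> is measurable
  for every measurable \<open>u\<close>.
\<close>

definition bounded_measurable_components ::
  "(real ^ 'n::finite) set \<Rightarrow> (real ^ 'n \<Rightarrow> real \<Rightarrow> real ^ 'n ^ 'n) \<Rightarrow> bool" where
  "bounded_measurable_components \<Omega> \<A> \<longleftrightarrow>
     (\<forall>i j. (\<lambda>(x, z). \<A> x z $ i $ j) \<in> borel_measurable (lebesgue_on \<Omega> \<Otimes>\<^sub>M borel)) \<and>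
     (\<exists>M. \<forall>x\<in>\<Omega>. \<forall>z i j. \<bar>\<A> x z $ i $ j\<bar> \<le> M)"

definition comparable_with ::
  "real \<Rightarrow> (real ^ 'n::finite) set \<Rightarrow> (real ^ 'n \<Rightarrow> real \<Rightarrow> real ^ 'n ^ 'n) \<Rightarrow> (real ^ 'n \<Rightarrow> real ^ 'n ^ 'n) \<Rightarrow> bool" where
  "comparable_with K \<Omega> \<A> A \<longleftrightarrow>
     (AE x in lebesgue_on \<Omega>. \<forall>z \<xi>.
        (\<xi> \<bullet> (A x *v \<xi>)) / K \<le> \<xi> \<bullet> (\<A> x z *v \<xi>) \<and>
        \<xi> \<bullet> (\<A> x z *v \<xi>) \<le> K * (\<xi> \<bullet> (A x *v \<xi>)))"

text \<open>
  Since the Bochner integral of a non-integrable function is 0, the existence of both integrals is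
  made explicit.
\<close>

definition weak_subsolution ::
  "'n \<Rightarrow> 'n \<Rightarrow> (real \<Rightarrow> real) \<Rightarrow> (real ^ 'n::finite) set \<Rightarrow> (real ^ 'n \<Rightarrow> real \<Rightarrow> real ^ 'n ^ 'n) \<Rightarrow>
   (real ^ 'n \<Rightarrow> real) \<Rightarrow> (real ^ 'n \<Rightarrow> real) \<Rightarrow> bool" where
  "weak_subsolution i1 iN f \<Omega> \<A> \<phi> u \<longleftrightarrow>
     u \<in> W1p i1 iN f \<Omega> 2 \<and>
     (\<forall>w\<in>W1p_0 i1 iN f \<Omega> 2. (AE x in lebesgue_on \<Omega>. 0 \<le> w x) \<longrightarrow>
        integrable (lebesgue_on \<Omega>)
          (\<lambda>x. weak_gradient i1 iN f \<Omega> w x \<bullet> (\<A> x (u x) *v weak_gradient i1 iN f \<Omega> u x)) \<and>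
        integrable (lebesgue_on \<Omega>) (\<lambda>x. \<phi> x * w x) \<and>
        - (LINT x|lebesgue_on \<Omega>.
             weak_gradient i1 iN f \<Omega> w x \<bullet> (\<A> x (u x) *v weak_gradient i1 iN f \<Omega> u x))
        \<ge> (LINT x|lebesgue_on \<Omega>. \<phi> x * w x))"

subsection \<open>Weak boundary values\<close>

definition weakly_bounded_on_boundary_by ::
  "'n \<Rightarrow> 'n \<Rightarrow> (real \<Rightarrow> real) \<Rightarrow> (real ^ 'n::finite) set \<Rightarrow> (real ^ 'n \<Rightarrow> real) \<Rightarrow> real \<Rightarrow> bool" where
  "weakly_bounded_on_boundary_by i1 iN f \<Omega> u l \<longleftrightarrow> (\<lambda>x. max (u x - l) 0) \<in> W1p_0 i1 iN f \<Omega> 2"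

definition boundary_sup ::
  "'n \<Rightarrow> 'n \<Rightarrow> (real \<Rightarrow> real) \<Rightarrow> (real ^ 'n::finite) set \<Rightarrow> (real ^ 'n \<Rightarrow> real) \<Rightarrow> ereal" where
  "boundary_sup i1 iN f \<Omega> u = Inf (ereal ` {l. weakly_bounded_on_boundary_by i1 iN f \<Omega> u l})"

end

theory Submission
  imports Defs "HOL-Real_Asymp.Real_Asymp"
begin

text \<open>
  Test the equation with \<open>w = (u - k)\<^sup>+\<close>, \<open>k \<ge> sup\<^bsub>\<partial>\<Omega>\<^esub> u\<close>.  Admissibility bounds the right-hand side by
  \<open>\<parallel>\<phi>\<parallel> \<integral> \<bar>\<nabla>\<^sub>A w\<bar>\<close>, and the Cauchy-Schwarz inequality on \<open>{u > k}\<close> then gives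
  \<open>\<integral> \<bar>\<nabla>\<^sub>A w\<bar> \<le> K \<parallel>\<phi>\<parallel> \<bar>{u > k}\<bar>\<close>.  The role of the Orlicz-Sobolev inequality is played by an \<open>L\<^sup>1\<close>
  Faber-Krahn inequality: \<open>\<integral> \<bar>w\<bar> \<le> C \<delta> \<integral> \<bar>\<nabla>\<^sub>A w\<bar>\<close> as soon as \<open>2 \<bar>{w \<noteq> 0}\<bar> \<le> \<delta>\<^sup>n min\<^bsub>\<bar>s\<bar> \<ge> \<delta>\<^esub> f(s)\<close>.
  It follows by comparing \<open>w\<close> with its translates by vectors of a box of sides \<open>\<delta>, \<dots>, \<delta>, \<delta> min f\<close> that move
  away from the hyperplane \<open>x\<^sub>1 = 0\<close>: at least half of these translates have left the support.  For
  \<open>f \<ge> c exp(- r\<^sup>-\<^sup>\<sigma>)\<close> the De Giorgi iteration over the levels of \<open>u\<close> can use \<open>\<delta>\<^sub>j = (j + 1)\<^sup>-\<^sup>1\<^sup>/\<^sup>\<sigma>\<close>, so the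
  levels stay bounded precisely because \<open>\<sigma> < 1\<close>.
\<close>

section \<open>Smooth bump functions\<close>

text \<open>The key estimates are linear in the level measure: the gradient bound is proportional to
  the measure of the superlevel set, and Faber-Krahn adds only a factor \<delta>. One step from
  \<open>k\<close> to \<open>h\<close> thus multiplies the measure by about \<delta> / (h - k), so
  an increment proportional to \<delta> shrinks it by a fixed factor \<kappa>. The scales are chosen
  so that the admissible measures shrink by no more than \<kappa> from one scale to the next; each
  step therefore restores the smallness required by the next one, and the total rise is a multiple
  of the sum of the scales and of the norm of \<phi>.

  A second obstacle is the function spaces: gradients are distributional, selected by Hilbert
  choice, and weighted by \<open>f(x1)\<close>, which vanishes on a hyperplane and does not commute
  with mollification. Everything is derived instead from one fact: weak derivatives integrate along
  coordinate lines, on which the weight is constant. Chain rule, truncation and translation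
  estimates follow from it. Lipschitz functions must be treated as well because \<open>W1p_0\<close>
  is their closure; their weak derivatives are obtained as weak limits of difference
  quotients.\<close>

primrec times_differentiable :: "nat \<Rightarrow> (real \<Rightarrow> real) \<Rightarrow> bool" where
  "times_differentiable 0 p \<longleftrightarrow> True"
| "times_differentiable (Suc m) p \<longleftrightarrow>
     (\<exists>p'. (\<forall>x. (p has_real_derivative p' x) (at x)) \<and> times_differentiable m p')"

lemma times_differentiable_SucI:
  "(\<And>x. (p has_real_derivative p' x) (at x)) \<Longrightarrow> times_differentiable m p' \<Longrightarrow>
   times_differentiable (Suc m) p"
  by auto

lemma times_differentiable_Suc_D: "times_differentiable (Suc m) p \<Longrightarrow> times_differentiable m p"
  by (induction m arbitrary: p) auto

lemma times_differentiable_const: "times_differentiable m (\<lambda>x. c)"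
proof (induction m arbitrary: c)
  case (Suc m)
  then show ?case by (auto intro!: exI[of _ "\<lambda>x. 0"])
qed auto

lemma times_differentiable_add:
  "times_differentiable m p \<Longrightarrow> times_differentiable m q \<Longrightarrow> times_differentiable m (\<lambda>x. p x + q x)"
proof (induction m arbitrary: p q)
  case (Suc m)
  then obtain p' q' where "\<forall>x. (p has_real_derivative p' x) (at x)" "times_differentiable m p'"
     "\<forall>x. (q has_real_derivative q' x) (at x)" "times_differentiable m q'" by auto
  with Suc.IH[of p' q'] show ?case
    by (auto intro!: exI[of _ "\<lambda>x. p' x + q' x"] derivative_intros)
qed auto

lemma times_differentiable_mult:
  "times_differentiable m p \<Longrightarrow> times_differentiable m q \<Longrightarrow> times_differentiable m (\<lambda>x. p x * q x)"
proof (induction m arbitrary: p q)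
  case (Suc m)
  then obtain p' q' where *: "\<And>x. (p has_real_derivative p' x) (at x)" "times_differentiable m p'"
     "\<And>x. (q has_real_derivative q' x) (at x)" "times_differentiable m q'" by auto
  \<comment> \<open>The product rule also contains the functions themselves, so they are weakened
    from \<open>Suc m\<close> to \<open>m\<close> before the induction hypothesis is
    applied.\<close>
  have "times_differentiable m p" "times_differentiable m q"
    using Suc.prems times_differentiable_Suc_D by blast+
  then have "times_differentiable m (\<lambda>x. p' x * q x + q' x * p x)"
    using * by (intro times_differentiable_add Suc.IH) auto
  moreover have "((\<lambda>x. p x * q x) has_real_derivative p' x * q x + q' x * p x) (at x)" for x
    using * by (auto intro!: derivative_eq_intros)
  ultimately show ?case by (intro times_differentiable_SucI)
qed auto

lemma times_differentiable_affine:
  "times_differentiable m p \<Longrightarrow> times_differentiable m (\<lambda>x. p (a * x + c))"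
proof (induction m arbitrary: p)
  case (Suc m)
  then obtain p' where *: "\<And>x. (p has_real_derivative p' x) (at x)" "times_differentiable m p'"
    by auto
  have "((\<lambda>x. p (a * x + c)) has_real_derivative p' (a * x + c) * a) (at x)" for x
    by (rule DERIV_chain2[OF *(1)]) (auto intro!: derivative_eq_intros)
  then show ?case
    using Suc.IH[OF *(2)] times_differentiable_const times_differentiable_mult
    by (auto intro!: exI[of _ "\<lambda>x. p' (a * x + c) * a"] times_differentiable_mult)
qed auto

text \<open>The power \<open>inverse t ^ j\<close> is carried along because differentiating
  exp(-1/t) produces such powers: up to linear combinations the family is closed under
  differentiation, which makes smoothness an induction.\<close>

definition exp_cutoff :: "nat \<Rightarrow> real \<Rightarrow> real" where
  "exp_cutoff j t = (if t > 0 then inverse t ^ j * exp (- inverse t) else 0)"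

lemma exp_cutoff_tendsto_0: "(exp_cutoff j \<longlongrightarrow> 0) (at 0)"
proof -
  have "((\<lambda>t::real. inverse t ^ j / exp (inverse t)) \<longlongrightarrow> 0) (at_right 0)"
    by (rule filterlim_compose[OF tendsto_power_div_exp_0 filterlim_inverse_at_top_right])
  then have r: "(exp_cutoff j \<longlongrightarrow> 0) (at_right 0)"
    by (rule Lim_transform_eventually)
       (auto simp: exp_cutoff_def eventually_at_right_less exp_minus field_simps
         intro!: eventually_mono[OF eventually_at_right_less])
  have "eventually (\<lambda>x. exp_cutoff j x = 0) (at_left (0::real))"
    by (auto simp: eventually_at exp_cutoff_def intro!: exI[of _ 1])
  then have "(exp_cutoff j \<longlongrightarrow> 0) (at_left 0)"
    by (simp add: tendsto_eventually)
  with r show ?thesis by (simp add: filterlim_split_at)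
qed

lemma exp_cutoff_has_derivative:
  "(exp_cutoff j has_real_derivative (exp_cutoff (j + 2) t - real j * exp_cutoff (Suc j) t)) (at t)"
proof (cases t "0::real" rule: linorder_cases)
  case less
  have "((\<lambda>_. 0) has_real_derivative 0) (at t)" by simp
  then have "(exp_cutoff j has_real_derivative 0) (at t)"
    by (rule has_field_derivative_transform_within_open[where S="{..<0}"])
       (use less in \<open>auto simp: exp_cutoff_def\<close>)
  then show ?thesis using less by (simp add: exp_cutoff_def)
next
  case equal
  have "((\<lambda>h. (exp_cutoff j (0 + h) - exp_cutoff j 0) / h) \<longlongrightarrow> 0) (at 0)"
    \<comment> \<open>Near 0 the difference quotient of \<open>exp_cutoff j\<close> at 0 is
      \<open>exp_cutoff (Suc j)\<close> itself.\<close>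
    using exp_cutoff_tendsto_0[of "Suc j"]
    by (rule Lim_transform_eventually)
       (auto simp: eventually_at exp_cutoff_def field_simps intro!: exI[of _ 1])
  then show ?thesis unfolding equal DERIV_def by (simp add: exp_cutoff_def)
next
  case greater
  have "((\<lambda>t. inverse t ^ j * exp (- inverse t)) has_real_derivative
     (exp_cutoff (j + 2) t - real j * exp_cutoff (Suc j) t)) (at t)"
  proof (cases j)
    case (Suc i)
    \<comment> \<open>The power rule leaves the truncated exponent \<open>i - Suc 0\<close>; at
      \<open>i = 0\<close> the factor \<open>real i\<close> vanishes.\<close>
    have "t * (t * t ^ (i - Suc 0)) * real i = t * t ^ i * real i"
      by (cases i) auto
    with Suc greater show ?thesis
      by (auto intro!: derivative_eq_intros simp: exp_cutoff_def power_inverse divide_simps)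
        (simp add: algebra_simps)
  qed (use greater in \<open>auto intro!: derivative_eq_intros simp: exp_cutoff_def field_simps power2_eq_square\<close>)
  then show ?thesis
    by (rule has_field_derivative_transform_within_open[where S="{0<..}"])
       (use greater in \<open>auto simp: exp_cutoff_def\<close>)
qed

lemma times_differentiable_exp_cutoff: "times_differentiable m (exp_cutoff j)"
proof (induction m arbitrary: j)
  case (Suc m)
  have "times_differentiable m (\<lambda>t. exp_cutoff (j + 2) t + (- real j) * exp_cutoff (Suc j) t)"
    by (intro times_differentiable_add times_differentiable_mult times_differentiable_const Suc)
  then have "times_differentiable m (\<lambda>t. exp_cutoff (j + 2) t - real j * exp_cutoff (Suc j) t)"
    by simp
  with exp_cutoff_has_derivative show ?case by (rule times_differentiable_SucI)
qed auto

lemma partial_deriv_prod: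
  fixes P :: "'n::finite \<Rightarrow> real \<Rightarrow> real"
  assumes P: "\<And>i x. (P i has_real_derivative P' i x) (at x)"
  shows "((\<lambda>x::real^'n. \<Prod>i\<in>UNIV. P i (x $ i)) has_derivative
          (\<lambda>h. \<Sum>i\<in>UNIV. P' i (x $ i) * h $ i * (\<Prod>j\<in>UNIV - {i}. P j (x $ j)))) (at x)"
    and "partial_deriv k (\<lambda>x. \<Prod>i\<in>UNIV. P i (x $ i)) =
          (\<lambda>x. \<Prod>i\<in>UNIV. (P(k := P' k)) i (x $ i))"
proof -
  have 1: "((\<lambda>x::real^'n. P i (x $ i)) has_derivative (\<lambda>h. P' i (x $ i) * h $ i)) (at x)" for i x
  proof -
    have "((\<lambda>x::real^'n. x $ i) has_derivative (\<lambda>h. h $ i)) (at x)"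
      by (rule bounded_linear.has_derivative[OF bounded_linear_vec_nth has_derivative_ident])
    from has_derivative_compose[OF this P[unfolded has_field_derivative_def]]
    show ?thesis .
  qed
  show 2: "((\<lambda>x::real^'n. \<Prod>i\<in>UNIV. P i (x $ i)) has_derivative
          (\<lambda>h. \<Sum>i\<in>UNIV. P' i (x $ i) * h $ i * (\<Prod>j\<in>UNIV - {i}. P j (x $ j)))) (at x)" for x
    by (rule has_derivative_prod) (rule 1)
  show "partial_deriv k (\<lambda>x. \<Prod>i\<in>UNIV. P i (x $ i)) =
          (\<lambda>x. \<Prod>i\<in>UNIV. (P(k := P' k)) i (x $ i))"
  proof
    fix x
    have "partial_deriv k (\<lambda>x. \<Prod>i\<in>UNIV. P i (x $ i)) x =
       (\<Sum>i\<in>UNIV. P' i (x $ i) * axis k 1 $ i * (\<Prod>j\<in>UNIV - {i}. P j (x $ j)))"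
      unfolding partial_deriv_def using frechet_derivative_at[OF 2[of x], symmetric] by simp
    also have "\<dots> = (\<Sum>i\<in>{k}. P' i (x $ i) * (\<Prod>j\<in>UNIV - {i}. P j (x $ j)))"
      by (rule sum.mono_neutral_cong_right) (auto simp: axis_def)
    also have "\<dots> = (\<Prod>i\<in>UNIV. (P(k := P' k)) i (x $ i))"
      by (subst (2) prod.remove[of _ k]) (auto intro!: prod.cong)
    finally show "partial_deriv k (\<lambda>x. \<Prod>i\<in>UNIV. P i (x $ i)) x =
      (\<Prod>i\<in>UNIV. (P(k := P' k)) i (x $ i))" .
  qed
qed

text \<open>A partial derivative of a product of one-variable factors only changes one factor, so
  iterated partial derivatives stay in this class and smoothness in several variables reduces to
  \<open>times_differentiable\<close>.\<close>

lemma fold_partial_deriv_prod: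
  fixes P :: "'n::finite \<Rightarrow> real \<Rightarrow> real"
  assumes "\<And>i m. times_differentiable m (P i)"
  shows "\<exists>Q. (\<forall>i m. times_differentiable m (Q i)) \<and>
           fold partial_deriv ks (\<lambda>x::real^'n. \<Prod>i\<in>UNIV. P i (x $ i)) = (\<lambda>x. \<Prod>i\<in>UNIV. Q i (x $ i))"
  using assms
proof (induction ks arbitrary: P)
  case (Cons k ks)
  have "\<forall>i. \<exists>p'. \<forall>x. (P i has_real_derivative p' x) (at x)"
    using Cons.prems[of "Suc 0"] by auto
  then obtain P' where P': "\<And>i x. (P i has_real_derivative P' i x) (at x)" by metis
  have "times_differentiable m (P' i)" for i m
  proof -
    obtain p' where "\<forall>x. (P i has_real_derivative p' x) (at x)" "times_differentiable m p'"
      using Cons.prems[of "Suc m" i] by auto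
    moreover have "p' = P' i" using calculation P' DERIV_unique by blast
    ultimately show ?thesis by simp
  qed
  then have "\<And>i m. times_differentiable m ((P(k := P' k)) i)" using Cons.prems by auto
  from Cons.IH[OF this] show ?case by (simp add: partial_deriv_prod(2)[OF P'])
next
  case Nil
  then show ?case by (intro exI[of _ P]) simp
qed

text \<open>The parameter \<open>m\<close> is a steepness: exp(-1/(m t)) tends to 1 for each t > 0,
  so the bumps approach the indicator of the open box while staying between 0 and 1.\<close>

definition box_bump :: "real \<Rightarrow> real^'n::finite \<Rightarrow> real^'n \<Rightarrow> real^'n \<Rightarrow> real" where
  "box_bump m a c x = (\<Prod>i\<in>UNIV. exp_cutoff 0 (m * (x $ i - a $ i)) * exp_cutoff 0 (m * (c $ i - x $ i)))"

lemma exp_cutoff_0_bounds: "0 \<le> exp_cutoff 0 t" "exp_cutoff 0 t \<le> 1"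
  by (auto simp: exp_cutoff_def)

lemma box_bump_bounds: "0 \<le> box_bump m a c x" "box_bump m a c x \<le> 1"
  unfolding box_bump_def
  by (auto intro!: prod_nonneg prod_le_1 mult_le_one mult_nonneg_nonneg exp_cutoff_0_bounds)

lemma box_bump_eq_0: "m > 0 \<Longrightarrow> x \<notin> box a c \<Longrightarrow> box_bump m a c x = 0"
proof -
  assume "m > 0" "x \<notin> box a c"
  then obtain i where "x $ i \<le> a $ i \<or> c $ i \<le> x $ i" by (auto simp: mem_box_cart not_less)
  with \<open>m > 0\<close> have "exp_cutoff 0 (m * (x $ i - a $ i)) * exp_cutoff 0 (m * (c $ i - x $ i)) = 0"
    by (auto simp: exp_cutoff_def zero_less_mult_iff)
  then show ?thesis unfolding box_bump_def by (intro prod_zero) auto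
qed

lemma box_bump_test:
  assumes "m > 0" "cbox a c \<subseteq> \<Omega>"
  shows "box_bump m a c \<in> test_functions \<Omega>"
proof -
  define P where "P i t = exp_cutoff 0 (m * t + (- m * a $ i)) * exp_cutoff 0 ((- m) * t + m * c $ i)" for i t
  have bb: "box_bump m a c = (\<lambda>x. \<Prod>i\<in>UNIV. P i (x $ i))"
    by (auto simp: box_bump_def P_def fun_eq_iff algebra_simps)
  have P: "times_differentiable j (P i)" for i j
    unfolding P_def
    by (intro times_differentiable_mult times_differentiable_affine times_differentiable_exp_cutoff)
  have "fold partial_deriv ks (box_bump m a c) differentiable at x" for ks x
  proof -
    obtain Q where Q: "\<forall>i m. times_differentiable m (Q i)"
      "fold partial_deriv ks (box_bump m a c) = (\<lambda>x. \<Prod>i\<in>UNIV. Q i (x $ i))"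
      using fold_partial_deriv_prod[of P ks, OF P] unfolding bb by auto
    have "\<forall>i. \<exists>p'. \<forall>x. (Q i has_real_derivative p' x) (at x)"
      using Q(1)[rule_format, of "Suc 0"] by auto
    then obtain Q' where "\<And>i x. (Q i has_real_derivative Q' i x) (at x)" by metis
    from partial_deriv_prod(1)[of Q Q' x, OF this] show ?thesis
      unfolding Q(2) by (rule differentiableI)
  qed
  moreover have cl: "closure {x. box_bump m a c x \<noteq> 0} \<subseteq> cbox a c"
    using box_bump_eq_0[OF assms(1)] box_subset_cbox
    by (intro closure_minimal closed_cbox) blast
  moreover have "compact (closure {x. box_bump m a c x \<noteq> 0})"
    using bounded_subset[OF bounded_cbox cl] by (simp add: compact_eq_bounded_closed)
  ultimately show ?thesis using assms(2) by (auto simp: test_functions_def)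
qed

lemma exp_cutoff_0_scaled_tendsto:
  assumes "t > 0" shows "(\<lambda>m. exp_cutoff 0 (real (Suc m) * t)) \<longlonglongrightarrow> 1"
proof -
  have "(\<lambda>m. inverse (real (Suc m)) * inverse t) \<longlonglongrightarrow> 0"
    using LIMSEQ_inverse_real_of_nat tendsto_mult_left_zero by blast
  then have "(\<lambda>m. exp (- (inverse (real (Suc m)) * inverse t))) \<longlonglongrightarrow> exp (- 0)"
    by (intro tendsto_intros)
  then show ?thesis
    using assms by (simp add: exp_cutoff_def inverse_mult_distrib mult.commute zero_less_mult_iff)
qed

lemma box_bump_tendsto:
  "(\<lambda>m. box_bump (real (Suc m)) a c x) \<longlonglongrightarrow> indicator (box a c) x"
proof (cases "x \<in> box a c")
  case True
  have "(\<lambda>m. box_bump (real (Suc m)) a c x) \<longlonglongrightarrow> (\<Prod>i\<in>(UNIV::'a set). 1 * 1)"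
    unfolding box_bump_def
    by (intro tendsto_prod tendsto_mult exp_cutoff_0_scaled_tendsto)
       (use True in \<open>auto simp: mem_box_cart\<close>)
  then show ?thesis using True by simp
next
  case False
  then show ?thesis by (simp add: box_bump_eq_0)
qed

section \<open>Test functions\<close>

text \<open>The measures whose densities are the positive and the negative part of \<open>h\<close>
  (\<open>ennreal\<close> cuts negative values off) agree on open boxes, an intersection-stable
  generator, and hence coincide. So both parts agree almost everywhere, and one of them is always
  0.\<close>

lemma AE_zero_if_box_integrals_zero:
  fixes h :: "'a::euclidean_space \<Rightarrow> real"
  assumes h: "integrable lborel h"
    and 0: "\<And>a c. (LINT x|lborel. indicator (box a c) x * h x) = 0"
  shows "AE x in lborel. h x = 0"
proof -
  have [measurable]: "h \<in> borel_measurable borel" using h by (simp add: integrable_iff_bounded)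
  define P where "P = density lborel (\<lambda>x. ennreal (h x))"
  define N where "N = density lborel (\<lambda>x. ennreal (- h x))"
  have eqbox: "emeasure P (box a c) = emeasure N (box a c)" for a c
  proof -
    let ?i = "\<lambda>x. indicator (box a c) x * h x"
    have i: "integrable lborel ?i"
      using integrable_mult_indicator[OF _ h, of "box a c"] by simp
    have fin: "(\<integral>\<^sup>+x. ennreal (?i x) \<partial>lborel) < \<infinity>" "(\<integral>\<^sup>+x. ennreal (- ?i x) \<partial>lborel) < \<infinity>"
      using integrableD(2)[OF i] integrableD(3)[OF i] by (auto simp: less_top)
    have "enn2real (\<integral>\<^sup>+x. ennreal (?i x) \<partial>lborel) = enn2real (\<integral>\<^sup>+x. ennreal (- ?i x) \<partial>lborel)"
      using 0[of a c] real_lebesgue_integral_def[OF i] by simp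
    then have "(\<integral>\<^sup>+x. ennreal (?i x) \<partial>lborel) = (\<integral>\<^sup>+x. ennreal (- ?i x) \<partial>lborel)"
      using fin by (metis ennreal_enn2real less_top infinity_ennreal_def)
    moreover have "emeasure P (box a c) = (\<integral>\<^sup>+x. ennreal (?i x) \<partial>lborel)"
      unfolding P_def by (subst emeasure_density) (auto intro!: nn_integral_cong simp: indicator_def)
    moreover have "emeasure N (box a c) = (\<integral>\<^sup>+x. ennreal (- ?i x) \<partial>lborel)"
      unfolding N_def by (subst emeasure_density) (auto intro!: nn_integral_cong simp: indicator_def)
    ultimately show ?thesis by simp
  qed
  have "P = N"
  proof (rule measure_eqI_generator_eq)
    let ?E = "range (\<lambda>(a, b). box a b::'a set)"
    show "Int_stable ?E"
      by (auto simp: Int_stable_def box_Int_box)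
    show "?E \<subseteq> Pow UNIV" "sets P = sigma_sets UNIV ?E" "sets N = sigma_sets UNIV ?E"
      by (simp_all add: borel_eq_box P_def N_def)
    let ?A = "\<lambda>n::nat. box (- (real n *\<^sub>R One)) (real n *\<^sub>R One) :: 'a set"
    show "range ?A \<subseteq> ?E" "(\<Union>i. ?A i) = UNIV"
      unfolding UN_box_eq_UNIV by auto
    show "emeasure P (?A i) \<noteq> \<infinity>" for i
    proof -
      have "emeasure P (?A i) \<le> (\<integral>\<^sup>+x. ennreal (h x) \<partial>lborel)"
        unfolding P_def by (subst emeasure_density) (auto intro!: nn_integral_mono simp: indicator_def)
      then show ?thesis using integrableD(2)[OF h] by (auto simp: top_unique)
    qed
    show "emeasure P X = emeasure N X" if "X \<in> ?E" for X
      using that eqbox by auto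
  qed
  then have "AE x in lborel. ennreal (h x) = ennreal (- h x)"
    unfolding P_def N_def
    by (intro iffD1[OF sigma_finite_measure.density_unique_iff[OF sigma_finite_lborel]]) auto
  then show ?thesis
  proof eventually_elim
    case (elim x)
    then show ?case
      using ennreal_eq_0_iff[of "h x"] ennreal_eq_0_iff[of "- h x"] ennreal_neg[of "h x"] ennreal_neg[of "- h x"]
      by (cases "h x \<ge> 0") auto
  qed
qed

text \<open>The fundamental lemma of the calculus of variations: bumps converge to indicators of
  boxes under dominated convergence, and countably many closed boxes cover \<open>U\<close>.\<close>

lemma AE_zero_if_test_integrals_zero:
  fixes h :: "real^'n::finite \<Rightarrow> real"
  assumes [measurable]: "h \<in> borel_measurable borel" and U: "open U"
    and int: "\<And>a c. cbox a c \<subseteq> U \<Longrightarrow> integrable lborel (\<lambda>x. indicator (cbox a c) x * h x)"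
    and 0: "\<And>\<psi>. \<psi> \<in> test_functions U \<Longrightarrow> (LINT x|lborel. h x * \<psi> x) = 0"
  shows "AE x in lborel. x \<in> U \<longrightarrow> h x = 0"
proof -
  have one: "AE x in lborel. x \<in> cbox a0 c0 \<longrightarrow> h x = 0" if sub: "cbox a0 c0 \<subseteq> U" for a0 c0
  proof -
    let ?H = "\<lambda>x. indicator (box a0 c0) x * h x"
    have "integrable lborel (\<lambda>x. indicator (box a0 c0) x *\<^sub>R (indicator (cbox a0 c0) x * h x))"
      by (rule integrable_mult_indicator[OF _ int[OF sub]]) auto
    also have "(\<lambda>x. indicator (box a0 c0) x *\<^sub>R (indicator (cbox a0 c0) x * h x)) = ?H"
      using box_subset_cbox[of a0 c0] by (auto simp: fun_eq_iff indicator_def)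
    finally have H: "integrable lborel ?H" .
    have "(LINT x|lborel. indicator (box a c) x * ?H x) = 0" for a c
    proof -
      \<comment> \<open>An arbitrary box is cut down to \<open>box a0 c0\<close>, because
        integrability of \<open>h\<close> is only available on closed boxes inside \<open>U\<close>;
        the intersection is again a box.\<close>
      obtain p q where pq: "box a c \<inter> box a0 c0 = box p q" "cbox p q \<subseteq> cbox a0 c0"
      proof
        show "box a c \<inter> box a0 c0 =
            box (\<chi> i. max (a $ i) (a0 $ i)) (\<chi> i. min (c $ i) (c0 $ i))"
          by (auto simp: mem_box_cart)
        show "cbox (\<chi> i. max (a $ i) (a0 $ i)) (\<chi> i. min (c $ i) (c0 $ i)) \<subseteq> cbox a0 c0"
          by (auto simp: mem_box_cart)
      qed
      let ?s = "\<lambda>m x. h x * box_bump (real (Suc m)) p q x"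
      have [measurable]: "box_bump (real (Suc m)) p q \<in> borel_measurable borel" for m
      proof -
        have "box_bump (real (Suc m)) p q \<in> test_functions UNIV" by (rule box_bump_test) auto
        then have "box_bump (real (Suc m)) p q differentiable at x" for x
          unfolding test_functions_def by (auto dest!: spec[of _ "[]"])
        then show ?thesis
          by (intro borel_measurable_continuous_onI continuous_at_imp_continuous_on)
             (auto intro: differentiable_imp_continuous_within)
      qed
      have "(\<lambda>m. LINT x|lborel. ?s m x) \<longlonglongrightarrow> (LINT x|lborel. indicator (box p q) x * h x)"
      proof (rule integral_dominated_convergence)
        show "integrable lborel (\<lambda>x. \<bar>indicator (cbox a0 c0) x * h x\<bar>)"
          using int[OF sub] by auto
        show "AE x in lborel. (\<lambda>m. ?s m x) \<longlonglongrightarrow> indicator (box p q) x * h x"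
          using box_bump_tendsto[of p q] by (auto intro!: AE_I2 simp: mult.commute intro: tendsto_mult)
        show "AE x in lborel. norm (?s m x) \<le> \<bar>indicator (cbox a0 c0) x * h x\<bar>" for m
        proof (rule AE_I2)
          fix x
          show "norm (?s m x) \<le> \<bar>indicator (cbox a0 c0) x * h x\<bar>"
          proof (cases "x \<in> box p q")
            case True
            then have "x \<in> cbox a0 c0" using pq(2) box_subset_cbox by blast
            then show ?thesis using box_bump_bounds[of "real (Suc m)" p q x]
              by (auto simp: abs_mult intro!: mult_left_le)
          qed (simp add: box_bump_eq_0)
        qed
      qed (simp_all del: of_nat_Suc)
      moreover have "(LINT x|lborel. ?s m x) = 0" for m
        using pq(2) sub by (intro 0 box_bump_test) auto
      ultimately have "(LINT x|lborel. indicator (box p q) x * h x) = 0"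
        by (simp add: LIMSEQ_const_iff)
      then show ?thesis
        unfolding pq(1)[symmetric] by (simp add: indicator_inter_arith mult.assoc)
    qed
    from AE_zero_if_box_integrals_zero[OF H this]
    have 1: "AE x in lborel. x \<in> box a0 c0 \<longrightarrow> h x = 0" by eventually_elim (auto simp: indicator_def)
    \<comment> \<open>The bumps only see the open box, but its faces are negligible.\<close>
    have "cbox a0 c0 - box a0 c0 \<in> null_sets lborel"
      by (simp add: null_sets_def emeasure_Diff[OF _ _ _ box_subset_cbox] emeasure_lborel_box_eq emeasure_lborel_cbox_eq)
    from AE_not_in[OF this] 1 show ?thesis by eventually_elim auto
  qed
  obtain D where D: "countable D" "D \<subseteq> Pow U" "\<And>X. X \<in> D \<Longrightarrow> \<exists>a b. X = cbox a b" "\<Union>D = U"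
    using open_countable_Union_open_cbox[OF U] by metis
  have "AE x in lborel. \<forall>X\<in>D. x \<in> X \<longrightarrow> h x = 0"
    unfolding AE_ball_countable[OF D(1)] using D(2,3) one by blast
  then show ?thesis using D(4) by (auto elim!: eventually_mono)
qed

lemma test_functions_mono: "U \<subseteq> V \<Longrightarrow> test_functions U \<subseteq> test_functions V"
  by (auto simp: test_functions_def)

lemma test_differentiable: "\<psi> \<in> test_functions U \<Longrightarrow> \<psi> differentiable at x"
  unfolding test_functions_def by (auto dest!: spec[of _ "[]"])

lemma test_continuous: "\<psi> \<in> test_functions U \<Longrightarrow> continuous_on UNIV \<psi>"
  by (intro continuous_at_imp_continuous_on)
     (auto intro: differentiable_imp_continuous_within test_differentiable)

lemma test_measurable: "\<psi> \<in> test_functions U \<Longrightarrow> \<psi> \<in> borel_measurable borel"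
  by (intro borel_measurable_continuous_onI test_continuous)

lemma test_support:
  assumes "\<psi> \<in> test_functions U"
  obtains S where "compact S" "S \<subseteq> U" "\<And>x. x \<notin> S \<Longrightarrow> \<psi> x = 0"
    "\<And>x k. x \<notin> S \<Longrightarrow> partial_deriv k \<psi> x = 0" "S = closure {x. \<psi> x \<noteq> 0}"
proof -
  define S where "S = closure {x. \<psi> x \<noteq> 0}"
  have S: "compact S" "S \<subseteq> U" using assms by (auto simp: S_def test_functions_def)
  have 1: "\<psi> x = 0" if "x \<notin> S" for x
    using that closure_subset[of "{x. \<psi> x \<noteq> 0}"] by (auto simp: S_def)
  have 2: "partial_deriv k \<psi> x = 0" if "x \<notin> S" for x k
  proof -
    have "(\<psi> has_derivative (\<lambda>h. 0)) (at x)"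
      by (rule has_derivative_transform_within_open[where f="\<lambda>x. 0" and s="- S"])
         (use that 1 S(1) in \<open>auto simp: compact_imp_closed\<close>)
    from frechet_derivative_at[OF this, symmetric] show ?thesis
      by (simp add: partial_deriv_def)
  qed
  show thesis using that[OF S 1 2 S_def] by blast
qed

lemma test_partial:
  assumes "\<psi> \<in> test_functions U"
  shows "partial_deriv k \<psi> \<in> test_functions U"
proof -
  from test_support[OF assms] obtain S where S: "compact S" "S \<subseteq> U"
    "\<And>x. x \<notin> S \<Longrightarrow> partial_deriv k \<psi> x = 0" by metis
  then have cl: "closure {x. partial_deriv k \<psi> x \<noteq> 0} \<subseteq> S"
    by (intro closure_minimal) (auto simp: compact_imp_closed)
  have "fold partial_deriv ks (partial_deriv k \<psi>) differentiable at x" for ks x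
  proof -
    have "fold partial_deriv (k # ks) \<psi> differentiable at x"
      using assms unfolding test_functions_def by blast
    then show ?thesis by simp
  qed
  moreover have "compact (closure {x. partial_deriv k \<psi> x \<noteq> 0})"
    using bounded_subset[OF compact_imp_bounded[OF S(1)] cl] by (simp add: compact_eq_bounded_closed)
  moreover have "closure {x. partial_deriv k \<psi> x \<noteq> 0} \<subseteq> U"
    using cl S(2) by (rule subset_trans)
  ultimately show ?thesis unfolding test_functions_def by (intro CollectI conjI allI)
qed

lemma test_bounded:
  assumes "\<psi> \<in> test_functions U"
  obtains M where "M > 0" "\<And>x. \<bar>\<psi> x\<bar> \<le> M"
proof -
  obtain S where S: "compact S" "\<And>x. x \<notin> S \<Longrightarrow> \<psi> x = 0"
    by (rule test_support[OF assms]) blast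
  have "compact (\<psi> ` S)"
    using S(1) test_continuous[OF assms] by (intro compact_continuous_image) (auto intro: continuous_on_subset)
  then obtain B where B: "\<And>y. y \<in> \<psi> ` S \<Longrightarrow> norm y \<le> B"
    by (meson compact_imp_bounded bounded_iff)
  have "\<bar>\<psi> x\<bar> \<le> max B 1" for x using S(2)[of x] B[of "\<psi> x"] by (cases "x \<in> S") auto
  then show ?thesis using that[of "max B 1"] by auto
qed

text \<open>Needs no differentiability: \<open>frechet_derivative\<close> is a choice from the
  predicate \<open>has_derivative\<close>, and the predicates at the two points are the
  same.\<close>

lemma partial_deriv_shift: "partial_deriv k (\<lambda>x. \<psi> (x + c)) = (\<lambda>x. partial_deriv k \<psi> (x + c))"
proof
  fix x
  have t: "((\<lambda>x. x + a) has_derivative (\<lambda>h. h)) (at y)" for a y :: "real^'a"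
    by (auto intro!: derivative_eq_intros)
  have *: "((\<lambda>x. \<psi> (x + c)) has_derivative D) (at x) \<longleftrightarrow> (\<psi> has_derivative D) (at (x + c))" for D
  proof
    assume "((\<lambda>x. \<psi> (x + c)) has_derivative D) (at x)"
    with has_derivative_compose[OF t[of "- c" "x + c"], of "\<lambda>x. \<psi> (x + c)" D]
    show "(\<psi> has_derivative D) (at (x + c))" by simp
  next
    assume "(\<psi> has_derivative D) (at (x + c))"
    from has_derivative_compose[OF t this]
    show "((\<lambda>x. \<psi> (x + c)) has_derivative D) (at x)" .
  qed
  show "partial_deriv k (\<lambda>x. \<psi> (x + c)) x = partial_deriv k \<psi> (x + c)"
    unfolding partial_deriv_def frechet_derivative_def * ..
qed

lemma fold_partial_deriv_shift:
  "fold partial_deriv ks (\<lambda>x. \<psi> (x + c)) = (\<lambda>x. fold partial_deriv ks \<psi> (x + c))"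
  by (induction ks arbitrary: \<psi>) (auto simp: partial_deriv_shift)

lemma test_shift:
  assumes \<psi>: "\<psi> \<in> test_functions U" and V: "\<And>x. x \<in> U \<Longrightarrow> x - c \<in> V"
  shows "(\<lambda>x. \<psi> (x + c)) \<in> test_functions V"
proof -
  have "fold partial_deriv ks (\<lambda>x. \<psi> (x + c)) differentiable at x" for ks x
  proof -
    have "fold partial_deriv ks \<psi> differentiable at (x + c)"
      using \<psi> unfolding test_functions_def by blast
    then have "(fold partial_deriv ks \<psi> \<circ> (\<lambda>x. x + c)) differentiable at x"
      by (intro differentiable_chain_at) (auto intro!: derivative_intros)
    then show ?thesis by (simp add: fold_partial_deriv_shift o_def)
  qed
  have "{x. \<psi> (x + c) \<noteq> 0} = (+) (- c) ` {x. \<psi> x \<noteq> 0}"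
    by (auto intro!: image_eqI[of _ _ "_ + c"])
  then have cl: "closure {x. \<psi> (x + c) \<noteq> 0} = (+) (- c) ` closure {x. \<psi> x \<noteq> 0}"
    using closure_translation by metis
  have "compact (closure {x. \<psi> (x + c) \<noteq> 0})"
    unfolding cl using \<psi> by (intro compact_translation) (auto simp: test_functions_def)
  moreover have "closure {x. \<psi> (x + c) \<noteq> 0} \<subseteq> V"
  proof
    fix x assume "x \<in> closure {x. \<psi> (x + c) \<noteq> 0}"
    then obtain y where "y \<in> closure {x. \<psi> x \<noteq> 0}" "x = - c + y" unfolding cl by auto
    then have "y \<in> U" "x = y - c" using \<psi> by (auto simp: test_functions_def)
    with V show "x \<in> V" by auto
  qed
  ultimately show ?thesis using \<open>\<And>x ks. fold partial_deriv ks (\<lambda>x. \<psi> (x + c)) differentiable at x\<close>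
    by (auto simp: test_functions_def)
qed

lemma test_line_derivative:
  assumes "\<psi> \<in> test_functions U"
  shows "((\<lambda>s. \<psi> (x + s *\<^sub>R axis k 1)) has_real_derivative partial_deriv k \<psi> (x + s *\<^sub>R axis k 1)) (at s)"
proof -
  let ?D = "frechet_derivative \<psi> (at (x + s *\<^sub>R axis k 1))"
  have D: "(\<psi> has_derivative ?D) (at (x + s *\<^sub>R axis k 1))"
    using test_differentiable[OF assms] frechet_derivative_works by blast
  have l: "((\<lambda>s. x + s *\<^sub>R axis k 1) has_derivative (\<lambda>h. h *\<^sub>R axis k 1)) (at s)"
    by (auto intro!: derivative_eq_intros)
  from has_derivative_compose[OF l D]
  have "((\<lambda>s. \<psi> (x + s *\<^sub>R axis k 1)) has_derivative (\<lambda>h. ?D (h *\<^sub>R axis k 1))) (at s)" .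
  moreover have "?D (h *\<^sub>R axis k 1) = ?D (axis k 1) * h" for h
    using linear_cmul[OF has_derivative_linear[OF D]] by simp
  ultimately show ?thesis by (simp add: has_field_derivative_def partial_deriv_def)
qed

section \<open>Translation invariance of integrals\<close>

lemma
  fixes g :: "'a::euclidean_space \<Rightarrow> 'b::{banach,second_countable_topology}"
  assumes [measurable]: "g \<in> borel_measurable borel"
  shows lborel_integral_shift: "integral\<^sup>L lborel (\<lambda>x. g (x + c)) = integral\<^sup>L lborel g"
    and lborel_integrable_shift: "integrable lborel (\<lambda>x. g (x + c)) \<longleftrightarrow> integrable lborel g"
proof -
  have "integral\<^sup>L lborel g = integral\<^sup>L (distr lborel borel ((+) c)) g"
    by (simp add: lborel_distr_plus)
  also have "\<dots> = integral\<^sup>L lborel (\<lambda>x. g (x + c))"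
    by (subst integral_distr) (auto simp: add.commute)
  finally show "integral\<^sup>L lborel (\<lambda>x. g (x + c)) = integral\<^sup>L lborel g" by simp
  have "integrable lborel g \<longleftrightarrow> integrable (distr lborel borel ((+) c)) g"
    by (simp add: lborel_distr_plus)
  also have "\<dots> \<longleftrightarrow> integrable lborel (\<lambda>x. g (x + c))"
    by (subst integrable_distr_eq) (auto simp: add.commute)
  finally show "integrable lborel (\<lambda>x. g (x + c)) \<longleftrightarrow> integrable lborel g" by simp
qed

lemma nn_integral_lborel_shift:
  fixes g :: "'a::euclidean_space \<Rightarrow> ennreal"
  assumes [measurable]: "g \<in> borel_measurable borel"
  shows "(\<integral>\<^sup>+x. g (x + c) \<partial>lborel) = (\<integral>\<^sup>+x. g x \<partial>lborel)"
proof -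
  have "(\<integral>\<^sup>+x. g x \<partial>lborel) = (\<integral>\<^sup>+x. g x \<partial>distr lborel borel ((+) c))"
    by (simp add: lborel_distr_plus)
  also have "\<dots> = (\<integral>\<^sup>+x. g (x + c) \<partial>lborel)"
    by (subst nn_integral_distr) (auto simp: add.commute)
  finally show ?thesis by simp
qed

lemma integrable_lborel_shift:
  fixes g :: "'a::euclidean_space \<Rightarrow> 'b::{banach,second_countable_topology}"
  assumes "integrable lborel g" shows "integrable lborel (\<lambda>x. g (x + c))"
proof -
  have "g \<in> borel_measurable borel" using borel_measurable_integrable[OF assms] by simp
  then show ?thesis using lborel_integrable_shift[of g c] assms by simp
qed

section \<open>Translations in \<open>L\<^sup>1\<close> and averages along lines\<close>

text \<open>The approximation error counts twice, at \<open>x\<close> and at \<open>x + y\<close>,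
  and translation invariance makes both contributions equal.\<close>

lemma L1_shift_diff_le:
  fixes g g' :: "'a::euclidean_space \<Rightarrow> real"
  assumes g: "integrable lborel g" and g': "integrable lborel g'"
  shows "(LINT x|lborel. \<bar>g (x + y) - g x\<bar>) \<le>
    2 * (LINT x|lborel. \<bar>g x - g' x\<bar>) + (LINT x|lborel. \<bar>g' (x + y) - g' x\<bar>)"
proof -
  note s = integrable_lborel_shift[OF g] integrable_lborel_shift[OF g']
  have d: "integrable lborel (\<lambda>x. \<bar>g x - g' x\<bar>)" using g g' by auto
  have "(LINT x|lborel. \<bar>g (x + y) - g x\<bar>) \<le>
    (LINT x|lborel. \<bar>g (x + y) - g' (x + y)\<bar> + \<bar>g x - g' x\<bar> + \<bar>g' (x + y) - g' x\<bar>)"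
    using g g' s by (intro integral_mono) (auto intro!: integrable_abs integrable_diff integrable_add)
  also have "\<dots> = (LINT x|lborel. \<bar>g (x + y) - g' (x + y)\<bar>) + (LINT x|lborel. \<bar>g x - g' x\<bar>) +
     (LINT x|lborel. \<bar>g' (x + y) - g' x\<bar>)"
    using g g' s by (simp add: integrable_abs)
  also have "(LINT x|lborel. \<bar>g (x + y) - g' (x + y)\<bar>) = (LINT x|lborel. \<bar>g x - g' x\<bar>)"
    using borel_measurable_integrable[OF d]
    by (intro lborel_integral_shift[where g="\<lambda>x. \<bar>g x - g' x\<bar>"]) simp
  finally show ?thesis by simp
qed

lemma L1_shift_approx:
  fixes g :: "'a::euclidean_space \<Rightarrow> real"
  assumes g: "integrable lborel g" 
    and ap: "\<And>e. e > 0 \<Longrightarrow> \<exists>g'. integrable lborel g' \<and> (LINT x|lborel. \<bar>g x - g' x\<bar>) \<le> e \<and>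
       (\<lambda>j. LINT x|lborel. \<bar>g' (x + y j) - g' x\<bar>) \<longlonglongrightarrow> 0"
  shows "(\<lambda>j. LINT x|lborel. \<bar>g (x + y j) - g x\<bar>) \<longlonglongrightarrow> (0::real)"
proof (rule LIMSEQ_I)
  fix e :: real assume "e > 0"
  then obtain g' where g': "integrable lborel g'" "(LINT x|lborel. \<bar>g x - g' x\<bar>) \<le> e / 4"
       "(\<lambda>j. LINT x|lborel. \<bar>g' (x + y j) - g' x\<bar>) \<longlonglongrightarrow> 0"
    using ap[of "e / 4"] by auto
  from LIMSEQ_D[OF g'(3), of "e / 2"] \<open>e > 0\<close> obtain N where
    N: "\<And>j. j \<ge> N \<Longrightarrow> (LINT x|lborel. \<bar>g' (x + y j) - g' x\<bar>) < e / 2" by fastforce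
  show "\<exists>N. \<forall>j\<ge>N. norm ((LINT x|lborel. \<bar>g (x + y j) - g x\<bar>) - 0) < e"
  proof (intro exI allI impI)
    fix j assume "j \<ge> N"
    from N[OF this] L1_shift_diff_le[OF g g'(1), of "y j"] g'(2)
    show "norm ((LINT x|lborel. \<bar>g (x + y j) - g x\<bar>) - 0) < e" by (simp add: integral_nonneg)
  qed
qed

text \<open>Openness controls only the points of \<open>U\<close> that leave \<open>U\<close> under
  the shift. Translation invariance gives the points entering \<open>U\<close> the same total
  measure, whence the factor 2.\<close>

lemma L1_shift_open:
  fixes U :: "'a::euclidean_space set"
  assumes U: "open U" "emeasure lborel U < \<infinity>" and y: "y \<longlonglongrightarrow> 0"
  shows "(\<lambda>j. LINT x|lborel. \<bar>indicator U (x + y j) - indicator U x\<bar>) \<longlonglongrightarrow> (0::real)"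
proof -
  have [measurable]: "U \<in> sets borel" using U by simp
  let ?u = "indicator U :: 'a \<Rightarrow> real"
  have i: "integrable lborel ?u" using U by simp
  note s = integrable_lborel_shift[OF i]
  let ?p = "\<lambda>j x. max 0 (?u x - ?u (x + y j))"
  have "(\<lambda>j. LINT x|lborel. ?p j x) \<longlonglongrightarrow> (LINT x::'a|lborel. 0)"
  proof (rule integral_dominated_convergence)
    show "integrable lborel ?u" by fact
    show "AE x in lborel. (\<lambda>j. ?p j x) \<longlonglongrightarrow> 0"
    proof (rule AE_I2)
      fix x show "(\<lambda>j. ?p j x) \<longlonglongrightarrow> 0"
      proof (cases "x \<in> U")
        case True
        have "(\<lambda>j. x + y j) \<longlonglongrightarrow> x + 0" by (intro tendsto_intros y)
        then have "eventually (\<lambda>j. x + y j \<in> U) sequentially"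
          using U(1) True by (intro topological_tendstoD) auto
        then have "eventually (\<lambda>j. ?p j x = 0) sequentially" by eventually_elim (auto simp: True)
        then show ?thesis by (rule tendsto_eventually)
      next
        case False
        then have "?p j x = 0" for j by (auto simp: indicator_def)
        then show ?thesis by simp
      qed
    qed
    show "AE x in lborel. norm (?p j x) \<le> ?u x" for j by (auto simp: indicator_def)
  qed auto
  then have "(\<lambda>j. 2 * (LINT x|lborel. ?p j x) - 0) \<longlonglongrightarrow> 2 * 0 - 0" by (intro tendsto_intros) simp
  moreover have "(LINT x|lborel. \<bar>?u (x + y j) - ?u x\<bar>) = 2 * (LINT x|lborel. ?p j x) - 0" for j
  proof -
    have "(LINT x|lborel. \<bar>?u (x + y j) - ?u x\<bar>) = (LINT x|lborel. 2 * ?p j x - (?u x - ?u (x + y j)))"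
      by (intro Bochner_Integration.integral_cong) (auto simp: indicator_def)
    also have "\<dots> = 2 * (LINT x|lborel. ?p j x) - ((LINT x|lborel. ?u x) - (LINT x|lborel. ?u (x + y j)))"
      using i s by simp
    also have "(LINT x|lborel. ?u (x + y j)) = (LINT x|lborel. ?u x)"
      by (rule lborel_integral_shift) simp
    finally show ?thesis by simp
  qed
  ultimately show ?thesis by simp
qed

text \<open>The property survives sums and approximation in the mean, and outer regularity reduces
  indicators of Borel sets of finite measure to those of open sets.\<close>

lemma L1_shift_continuous:
  fixes g :: "'a::euclidean_space \<Rightarrow> real"
  assumes g: "integrable lborel g" and y: "y \<longlonglongrightarrow> 0"
  shows "(\<lambda>j. LINT x|lborel. \<bar>g (x + y j) - g x\<bar>) \<longlonglongrightarrow> (0::real)"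
  using g
proof (induction rule: integrable_induct)
  case (base A c)
  have A[measurable]: "A \<in> sets borel" using base by simp
  have "(\<lambda>j. LINT x|lborel. \<bar>indicator A (x + y j) - indicator A x\<bar>) \<longlonglongrightarrow> (0::real)"
  proof (rule L1_shift_approx)
    show iA: "integrable lborel (indicat_real A)" using base by simp
    fix e :: real assume "e > 0"
    then obtain U where U: "open U" "A \<subseteq> U" "emeasure lborel (U - A) < e"
      using outer_regular_lborel[OF A] by auto
    then have [measurable]: "U \<in> sets borel" by simp
    have "emeasure lborel U = emeasure lborel A + emeasure lborel (U - A)"
      using U(2) by (subst plus_emeasure) (auto simp: Un_absorb1 Un_Diff_cancel)
    also have "\<dots> < \<infinity>" using base U(3) by (auto simp: less_top[symmetric] top_unique)
    finally have fU: "emeasure lborel U < \<infinity>" .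
    have iU: "integrable lborel (indicat_real U)" using fU by simp
    have "(LINT x|lborel. \<bar>indicator A x - indicator U x\<bar>) = (LINT x|lborel. indicat_real (U - A) x)"
      using U(2) by (intro Bochner_Integration.integral_cong) (auto simp: indicator_def)
    also have "\<dots> \<le> e"
      using U(3) \<open>e > 0\<close> by (auto simp: measure_def intro!: enn2real_leI)
    finally show "\<exists>g'. integrable lborel g' \<and> (LINT x|lborel. \<bar>indicator A x - g' x\<bar>) \<le> e \<and>
       (\<lambda>j. LINT x|lborel. \<bar>g' (x + y j) - g' x\<bar>) \<longlonglongrightarrow> 0"
      using iU L1_shift_open[OF U(1) fU y] by blast
  qed
  then have "(\<lambda>j. (LINT x|lborel. \<bar>indicator A (x + y j) - indicator A x\<bar>) * \<bar>c\<bar>) \<longlonglongrightarrow> 0 * \<bar>c\<bar>"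
    by (intro tendsto_intros)
  moreover have "\<bar>indicator A (x + y j) *\<^sub>R c - indicator A x *\<^sub>R c\<bar> =
     \<bar>indicator A (x + y j) - indicator A x\<bar> * \<bar>c\<bar>" for x j
    by (auto simp: indicator_def)
  ultimately show ?case by simp
next
  case (add f g)
  note s = integrable_lborel_shift[OF add.hyps(1)] integrable_lborel_shift[OF add.hyps(2)]
  show ?case
  proof (rule tendsto_sandwich[OF _ _ tendsto_const])
    show "(\<lambda>j. (LINT x|lborel. \<bar>f (x + y j) - f x\<bar>) + (LINT x|lborel. \<bar>g (x + y j) - g x\<bar>)) \<longlonglongrightarrow> 0"
      using tendsto_add[OF add.IH] by simp
    have "(LINT x|lborel. \<bar>f (x + y j) + g (x + y j) - (f x + g x)\<bar>) \<le>
        (LINT x|lborel. \<bar>f (x + y j) - f x\<bar>) + (LINT x|lborel. \<bar>g (x + y j) - g x\<bar>)" for j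
    proof -
      have i: "integrable lborel (\<lambda>x. \<bar>f (x + y j) - f x\<bar>)" "integrable lborel (\<lambda>x. \<bar>g (x + y j) - g x\<bar>)"
        "integrable lborel (\<lambda>x. \<bar>f (x + y j) + g (x + y j) - (f x + g x)\<bar>)"
        using add.hyps s by auto
      have "(LINT x|lborel. \<bar>f (x + y j) + g (x + y j) - (f x + g x)\<bar>) \<le>
        (LINT x|lborel. \<bar>f (x + y j) - f x\<bar> + \<bar>g (x + y j) - g x\<bar>)"
        using i by (intro integral_mono) auto
      also have "\<dots> = (LINT x|lborel. \<bar>f (x + y j) - f x\<bar>) + (LINT x|lborel. \<bar>g (x + y j) - g x\<bar>)"
        using i by simp
      finally show ?thesis .
    qed
    then show "\<forall>\<^sub>F j in sequentially. (LINT x|lborel. \<bar>f (x + y j) + g (x + y j) - (f x + g x)\<bar>) \<le>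
        (LINT x|lborel. \<bar>f (x + y j) - f x\<bar>) + (LINT x|lborel. \<bar>g (x + y j) - g x\<bar>)" by simp
  qed (simp add: integral_nonneg)
next
  case (lim f s)
  show ?case
  proof (rule L1_shift_approx[OF lim.hyps(4)])
    have [measurable]: "f \<in> borel_measurable borel" "s i \<in> borel_measurable borel" for i
      using borel_measurable_integrable[OF lim.hyps(4)] borel_measurable_integrable[OF lim.hyps(1)] by simp_all
    have "(\<lambda>i. LINT x|lborel. \<bar>f x - s i x\<bar>) \<longlonglongrightarrow> (LINT x::'a|lborel. 0)"
    proof (rule integral_dominated_convergence)
      \<comment> \<open>The induction rule supplies approximants bounded by 2|f|; with |f| itself
        this makes 3.\<close>
      show "integrable lborel (\<lambda>x. 3 * \<bar>f x\<bar>)" using lim.hyps(4) by simp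
      show "AE x in lborel. (\<lambda>i. \<bar>f x - s i x\<bar>) \<longlonglongrightarrow> 0"
      proof (rule AE_I2)
        fix x
        have "(\<lambda>i. \<bar>f x - s i x\<bar>) \<longlonglongrightarrow> \<bar>f x - f x\<bar>" using lim.hyps(2)[of x] by (intro tendsto_intros) simp
        then show "(\<lambda>i. \<bar>f x - s i x\<bar>) \<longlonglongrightarrow> 0" by simp
      qed
      show "AE x in lborel. norm \<bar>f x - s i x\<bar> \<le> 3 * \<bar>f x\<bar>" for i
      proof (rule AE_I2)
        fix x show "norm \<bar>f x - s i x\<bar> \<le> 3 * \<bar>f x\<bar>" using lim.hyps(3)[of x i] by simp
      qed
    qed auto
    then have l: "(\<lambda>i. LINT x|lborel. \<bar>f x - s i x\<bar>) \<longlonglongrightarrow> 0" by simp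
    fix e :: real assume "e > 0"
    from order_tendstoD(2)[OF l this] obtain i where "(LINT x|lborel. \<bar>f x - s i x\<bar>) < e"
      by (auto simp: eventually_sequentially)
    then show "\<exists>g'. integrable lborel g' \<and> (LINT x|lborel. \<bar>f x - g' x\<bar>) \<le> e \<and>
       (\<lambda>j. LINT x|lborel. \<bar>g' (x + y j) - g' x\<bar>) \<longlonglongrightarrow> 0"
      using lim.hyps(1) lim.IH by (intro exI[of _ "s i"]) auto
  qed
qed

section \<open>Integrals and averages along segments\<close>

definition line_integral :: "'a \<Rightarrow> real \<Rightarrow> ('a \<Rightarrow> real) \<Rightarrow> 'a::euclidean_space \<Rightarrow> real" where
  "line_integral e t g x = (LINT s|lborel. indicator {0..t} s * g (x + s *\<^sub>R e))"

lemma integrable_line_product: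
  fixes g :: "'a::euclidean_space \<Rightarrow> real"
  assumes g: "integrable lborel g"
  shows "integrable (lborel \<Otimes>\<^sub>M lborel) (\<lambda>(s, x). indicator {0..t} s * g (x + s *\<^sub>R e))"
    and "integrable (lborel \<Otimes>\<^sub>M lborel) (\<lambda>(x, s). indicator {0..t} s * g (x + s *\<^sub>R e))"
proof -
  have [measurable]: "g \<in> borel_measurable borel" using borel_measurable_integrable[OF g] by simp
  show 1: "integrable (lborel \<Otimes>\<^sub>M lborel) (\<lambda>(s, x). indicator {0..t} s * g (x + s *\<^sub>R e))"
  proof (rule lborel_pair.Fubini_integrable)
    have "(LINT x|lborel. norm (indicator {0..t} s * g (x + s *\<^sub>R e))) =
       indicator {0..t} s *\<^sub>R (LINT x|lborel. \<bar>g x\<bar>)" for s :: real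
      using lborel_integral_shift[of "\<lambda>x. \<bar>g x\<bar>" "s *\<^sub>R e"] by (simp add: abs_mult)
    then show "integrable lborel (\<lambda>s. LINT x|lborel. norm (case (s, x) of (s, x) \<Rightarrow> indicator {0..t} s * g (x + s *\<^sub>R e)))"
      using integrable_mult_left[of "LINT x|lborel. \<bar>g x\<bar>" lborel "indicator {0..t::real}"]
      by (simp add: integrable_real_indicator emeasure_lborel_Icc_eq)
    show "AE s in lborel. integrable lborel (\<lambda>x. case (s, x) of (s, x) \<Rightarrow> indicator {0..t} s * g (x + s *\<^sub>R e))"
      using integrable_lborel_shift[OF g] by auto
  qed simp
  from lborel_pair.integrable_product_swap[OF this]
  show "integrable (lborel \<Otimes>\<^sub>M lborel) (\<lambda>(x, s). indicator {0..t} s * g (x + s *\<^sub>R e))"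
    by (simp add: case_prod_unfold)
qed

lemma line_integral_measurable[measurable]:
  fixes g :: "'a::euclidean_space \<Rightarrow> real"
  assumes [measurable]: "g \<in> borel_measurable borel"
  shows "line_integral e t g \<in> borel_measurable borel"
proof -
  have "(\<lambda>x. LINT s|lborel. indicator {0..t} s * g (x + s *\<^sub>R e)) \<in> borel_measurable lborel"
    by (rule lborel.borel_measurable_lebesgue_integral) measurable
  then show ?thesis by (simp add: line_integral_def[abs_def])
qed

lemma integrable_line_integral:
  fixes g :: "'a::euclidean_space \<Rightarrow> real"
  assumes g: "integrable lborel g"
  shows "integrable lborel (line_integral e t g)"
  using lborel_pair.integrable_fst'[OF integrable_line_product(2)[OF g, of t e]]
  by (simp add: line_integral_def[abs_def])

lemma line_integral_L1_le:
  fixes g :: "'a::euclidean_space \<Rightarrow> real"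
  assumes g: "integrable lborel g" and t: "t \<ge> 0"
  shows "(LINT x|lborel. \<bar>line_integral e t g x\<bar>) \<le> t * (LINT x|lborel. \<bar>g x\<bar>)"
proof -
  have [measurable]: "g \<in> borel_measurable borel" using borel_measurable_integrable[OF g] by simp
  have ia: "integrable lborel (\<lambda>x. \<bar>g x\<bar>)" using g by simp
  have "(LINT x|lborel. \<bar>line_integral e t g x\<bar>) \<le> (LINT x|lborel. line_integral e t (\<lambda>x. \<bar>g x\<bar>) x)"
  proof (rule integral_mono)
    show "integrable lborel (\<lambda>x. \<bar>line_integral e t g x\<bar>)" using integrable_line_integral[OF g] by simp
    show "integrable lborel (line_integral e t (\<lambda>x. \<bar>g x\<bar>))" using integrable_line_integral[OF ia] by simp
    show "\<bar>line_integral e t g x\<bar> \<le> line_integral e t (\<lambda>x. \<bar>g x\<bar>) x" for x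
      using integral_norm_bound[of lborel "\<lambda>s. indicator {0..t} s * g (x + s *\<^sub>R e)"]
      by (simp add: line_integral_def abs_mult)
  qed
  also have "\<dots> = (LINT s|lborel. LINT x|lborel. indicator {0..t} s * \<bar>g (x + s *\<^sub>R e)\<bar>)"
    unfolding line_integral_def
    by (rule lborel_pair.Fubini_integral[symmetric]) (rule integrable_line_product(2)[OF ia])
  also have "\<dots> = (LINT s|lborel. indicator {0..t} s * (LINT x|lborel. \<bar>g x\<bar>))"
    using lborel_integral_shift[of "\<lambda>x. \<bar>g x\<bar>"] by simp
  also have "\<dots> = t * (LINT x|lborel. \<bar>g x\<bar>)" using t by simp
  finally show ?thesis .
qed

lemma line_integral_L1_approx:
  fixes g :: "'a::euclidean_space \<Rightarrow> real"
  assumes g: "integrable lborel g" and t: "t \<ge> 0"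
    and eps: "\<And>s. 0 \<le> s \<Longrightarrow> s \<le> t \<Longrightarrow> (LINT x|lborel. \<bar>g (x + s *\<^sub>R e) - g x\<bar>) \<le> \<epsilon>"
  shows "(LINT x|lborel. \<bar>line_integral e t g x - t * g x\<bar>) \<le> t * \<epsilon>"
proof -
  have [measurable]: "g \<in> borel_measurable borel" using borel_measurable_integrable[OF g] by simp
  have p: "integrable (lborel \<Otimes>\<^sub>M lborel) (\<lambda>(x, s). indicator {0..t} s * (g (x + s *\<^sub>R e) - g x))"
    \<comment> \<open>Direction 0 turns the second product into
      \<open>indicator {0..t} s * g x\<close>.\<close>
    using Bochner_Integration.integrable_diff[OF integrable_line_product(2)[OF g, of t e] integrable_line_product(2)[OF g, of t 0]]
    by (simp add: case_prod_unfold algebra_simps)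
  let ?J = "\<lambda>x. LINT s|lborel. indicator {0..t} s * \<bar>g (x + s *\<^sub>R e) - g x\<bar>"
  have pa: "integrable (lborel \<Otimes>\<^sub>M lborel) (\<lambda>(x, s). indicator {0..t} s * \<bar>g (x + s *\<^sub>R e) - g x\<bar>)"
    using integrable_abs[OF p] by (simp add: case_prod_unfold abs_mult)
  have "(LINT x|lborel. \<bar>line_integral e t g x - t * g x\<bar>) \<le> (LINT x|lborel. ?J x)"
  proof (rule integral_mono_AE)
    show "integrable lborel (\<lambda>x. \<bar>line_integral e t g x - t * g x\<bar>)"
      using integrable_line_integral[OF g] g by simp
    show "integrable lborel ?J" using lborel_pair.integrable_fst'[OF pa] by simp
    show "AE x in lborel. \<bar>line_integral e t g x - t * g x\<bar> \<le> ?J x"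
      using lborel_pair.AE_integrable_fst'[OF integrable_line_product(2)[OF g, of t e]]
    proof eventually_elim
      case (elim x)
      then have i: "integrable lborel (\<lambda>s. indicator {0..t} s * g (x + s *\<^sub>R e))" by simp
      have "line_integral e t g x - t * g x = line_integral e t g x - (LINT s|lborel. indicator {0..t} s * g x)"
        using t by simp
      also have "\<dots> = (LINT s|lborel. indicator {0..t} s * g (x + s *\<^sub>R e) - indicator {0..t} s * g x)"
        unfolding line_integral_def
        using i integrable_mult_left[of "g x" lborel "indicator {0..t}"]
        by (subst Bochner_Integration.integral_diff)
           (auto simp: integrable_real_indicator emeasure_lborel_Icc_eq)
      also have "\<dots> = (LINT s|lborel. indicator {0..t} s * (g (x + s *\<^sub>R e) - g x))"
        by (simp add: algebra_simps)
      finally show ?case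
        using integral_norm_bound[of lborel "\<lambda>s. indicator {0..t} s * (g (x + s *\<^sub>R e) - g x)"]
        by (simp add: abs_mult)
    qed
  qed
  also have "\<dots> = (LINT s|lborel. LINT x|lborel. indicator {0..t} s * \<bar>g (x + s *\<^sub>R e) - g x\<bar>)"
    by (rule lborel_pair.Fubini_integral[symmetric]) (rule pa)
  also have "\<dots> \<le> (LINT s|lborel. indicator {0..t} s * \<epsilon>)"
  proof (rule integral_mono)
    show "integrable lborel (\<lambda>s. LINT x|lborel. indicator {0..t} s * \<bar>g (x + s *\<^sub>R e) - g x\<bar>)"
      using lborel_pair.integrable_fst'[OF lborel_pair.integrable_product_swap[OF pa]] by simp
    show "integrable lborel (\<lambda>s::real. indicator {0..t} s * \<epsilon>)"
      using integrable_mult_left[of "\<epsilon>" lborel "indicator {0..t}"]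
      by (auto simp: integrable_real_indicator emeasure_lborel_Icc_eq)
    show "(LINT x|lborel. indicator {0..t} s * \<bar>g (x + s *\<^sub>R e) - g x\<bar>) \<le> indicator {0..t} s * \<epsilon>" for s
      using eps[of s] by (auto simp: indicator_def)
  qed
  also have "\<dots> = t * \<epsilon>" using t by simp
  finally show ?thesis .
qed

text \<open>An average of translates over [0, t] deviates from \<open>g\<close> by at most the
  largest translation error there. Continuity along sequences is first upgraded, by contradiction,
  to a bound uniform over all small \<open>s\<close>.\<close>

lemma line_average_tendsto_L1:
  fixes g :: "'a::euclidean_space \<Rightarrow> real"
  assumes g: "integrable lborel g" and t: "\<And>j. t j > 0" "t \<longlonglongrightarrow> 0"
  shows "(\<lambda>j. LINT x|lborel. \<bar>line_integral e (t j) g x / t j - g x\<bar>) \<longlonglongrightarrow> 0"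
proof (rule LIMSEQ_I)
  fix \<epsilon> :: real assume "\<epsilon> > 0"
  have "\<exists>d>0. \<forall>s. 0 \<le> s \<longrightarrow> s \<le> d \<longrightarrow> (LINT x|lborel. \<bar>g (x + s *\<^sub>R e) - g x\<bar>) \<le> \<epsilon> / 2"
  proof (rule ccontr)
    assume "\<not> ?thesis"
    then have "\<forall>j. \<exists>s. 0 \<le> s \<and> s \<le> inverse (real (Suc j)) \<and> (LINT x|lborel. \<bar>g (x + s *\<^sub>R e) - g x\<bar>) > \<epsilon> / 2"
      by (auto simp: not_le dest!: spec[of _ "inverse (real (Suc _))"])
    then obtain s where s: "\<And>j. 0 \<le> s j" "\<And>j. s j \<le> inverse (real (Suc j))"
      "\<And>j. (LINT x|lborel. \<bar>g (x + s j *\<^sub>R e) - g x\<bar>) > \<epsilon> / 2" by metis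
    have "s \<longlonglongrightarrow> 0"
      by (rule tendsto_sandwich[OF _ _ tendsto_const LIMSEQ_inverse_real_of_nat]) (use s in auto)
    then have "(\<lambda>j. s j *\<^sub>R e) \<longlonglongrightarrow> 0 *\<^sub>R e" by (intro tendsto_intros)
    then have "(\<lambda>j. LINT x|lborel. \<bar>g (x + s j *\<^sub>R e) - g x\<bar>) \<longlonglongrightarrow> 0"
      by (intro L1_shift_continuous[OF g]) simp
    from order_tendstoD(2)[OF this, of "\<epsilon> / 2"] \<open>\<epsilon> > 0\<close> s(3) show False
      by (auto simp: eventually_sequentially) (meson less_asym order_refl)
  qed
  then obtain d where d: "d > 0"
    "\<And>s. 0 \<le> s \<Longrightarrow> s \<le> d \<Longrightarrow> (LINT x|lborel. \<bar>g (x + s *\<^sub>R e) - g x\<bar>) \<le> \<epsilon> / 2" by auto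
  from order_tendstoD(2)[OF t(2) d(1)] obtain N where N: "\<And>j. j \<ge> N \<Longrightarrow> t j < d"
    by (auto simp: eventually_sequentially)
  show "\<exists>N. \<forall>j\<ge>N. norm ((LINT x|lborel. \<bar>line_integral e (t j) g x / t j - g x\<bar>) - 0) < \<epsilon>"
  proof (intro exI allI impI)
    fix j assume "j \<ge> N"
    have "\<bar>line_integral e (t j) g x / t j - g x\<bar> = inverse (t j) * \<bar>line_integral e (t j) g x - t j * g x\<bar>" for x
      using t(1)[of j] by (simp add: abs_if field_simps)
    then have "(LINT x|lborel. \<bar>line_integral e (t j) g x / t j - g x\<bar>) =
      inverse (t j) * (LINT x|lborel. \<bar>line_integral e (t j) g x - t j * g x\<bar>)" by simp
    also have "\<dots> \<le> inverse (t j) * (t j * (\<epsilon> / 2))"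
      using t(1)[of j] N[OF \<open>j \<ge> N\<close>] d(2)
      by (intro mult_left_mono line_integral_L1_approx[OF g]) auto
    also have "\<dots> < \<epsilon>" using t(1)[of j] \<open>\<epsilon> > 0\<close> by simp
    finally show "norm ((LINT x|lborel. \<bar>line_integral e (t j) g x / t j - g x\<bar>) - 0) < \<epsilon>"
      by (simp add: integral_nonneg)
  qed
qed

section \<open>Weighted weak derivatives\<close>

text \<open>The functions are Borel and integrable on the whole space, even though only their values in \<open>\<Omega>\<close>
  are tested: this makes translations and Fubini's theorem available.  The weight \<open>b\<close> stands for a
  diagonal entry of the matrix \<open>B\<close>.\<close>

definition borel_weak_partial ::
  "(real^'n) set \<Rightarrow> 'n::finite \<Rightarrow> (real^'n \<Rightarrow> real) \<Rightarrow> (real^'n \<Rightarrow> real) \<Rightarrow> (real^'n \<Rightarrow> real) \<Rightarrow> bool" where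
  "borel_weak_partial \<Omega> k b v g \<longleftrightarrow>
     integrable lborel v \<and> integrable lborel g \<and>
     (\<forall>\<psi>\<in>test_functions \<Omega>. (LINT x|lborel. g x * \<psi> x) = - (LINT x|lborel. v x * (b x * partial_deriv k \<psi> x)))"

text \<open>Invariance along \<open>k\<close> lets the weight commute with translations and with the
  derivative in this direction. That it is nonzero almost everywhere allows differences of
  \<open>v\<close> to be recovered from weighted ones.\<close>

locale direction_weight =
  fixes k :: "'n::finite" and b :: "real^'n \<Rightarrow> real"
  assumes cont: "continuous_on UNIV b"
    and inv: "b (x + s *\<^sub>R axis k 1) = b x"
    and nz: "AE x in lborel. b x \<noteq> 0"
begin

lemma measurable_weight[measurable]: "b \<in> borel_measurable borel"
  by (intro borel_measurable_continuous_onI cont)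

lemma inv_minus: "b (x - s *\<^sub>R axis k 1) = b x"
  using inv[of x "- s"] by simp

lemma bounded_on_compact:
  assumes "compact S"
  obtains M where "M > 0" "\<And>x. x \<in> S \<Longrightarrow> \<bar>b x\<bar> \<le> M"
proof -
  have "bounded (b ` S)"
    using assms cont by (intro compact_imp_bounded compact_continuous_image) (auto intro: continuous_on_subset)
  then obtain B where "\<And>y. y \<in> b ` S \<Longrightarrow> norm y \<le> B" by (meson bounded_iff)
  then show ?thesis using that[of "max B 1"] by force
qed

lemma weight_test_bounded:
  assumes "\<psi> \<in> test_functions U"
  obtains M where "M > 0" "\<And>x. \<bar>b x * \<psi> x\<bar> \<le> M"
proof -
  obtain S where S: "compact S" "\<And>x. x \<notin> S \<Longrightarrow> \<psi> x = 0" by (rule test_support[OF assms]) blast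
  obtain B where B: "B > 0" "\<And>x. x \<in> S \<Longrightarrow> \<bar>b x\<bar> \<le> B" by (rule bounded_on_compact[OF S(1)]) blast
  obtain M where M: "M > 0" "\<And>x. \<bar>\<psi> x\<bar> \<le> M" by (rule test_bounded[OF assms]) blast
  have "\<bar>b x * \<psi> x\<bar> \<le> B * M" for x
  proof (cases "x \<in> S")
    case True
    then show ?thesis using mult_mono[OF B(2)[OF True] M(2)[of x]] B(1) by (simp add: abs_mult)
  next
    case False
    then show ?thesis using S(2) B(1) M(1) by simp
  qed
  then show ?thesis using that[of "B * M"] B M by auto
qed

end

lemma integrable_mult_bounded:
  fixes v w :: "'a \<Rightarrow> real"
  assumes v: "integrable M v" and [measurable]: "w \<in> borel_measurable M" and w: "\<And>x. \<bar>w x\<bar> \<le> C"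
  shows "integrable M (\<lambda>x. v x * w x)"
proof (rule Bochner_Integration.integrable_bound[of M "\<lambda>x. C * v x"])
  have [measurable]: "v \<in> borel_measurable M" using v by simp
  show "(\<lambda>x. v x * w x) \<in> borel_measurable M" by simp
  show "AE x in M. norm (v x * w x) \<le> norm (C * v x)"
  proof (rule AE_I2)
    fix x
    have "\<bar>w x\<bar> \<le> \<bar>C\<bar>" using w[of x] by simp
    then show "norm (v x * w x) \<le> norm (C * v x)"
      by (simp add: abs_mult mult.commute[of "\<bar>v x\<bar>"] mult_right_mono)
  qed
qed (use v in auto)

context direction_weight
begin

lemma integrable_mult_test:
  assumes "\<psi> \<in> test_functions U" "integrable lborel v"
  shows "integrable lborel (\<lambda>x. v x * \<psi> x)" "integrable lborel (\<lambda>x. v x * (b x * \<psi> x))"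
proof -
  have [measurable]: "\<psi> \<in> borel_measurable borel" using test_measurable[OF assms(1)] .
  obtain C where "\<And>x. \<bar>\<psi> x\<bar> \<le> C" using test_bounded[OF assms(1)] by metis
  then show "integrable lborel (\<lambda>x. v x * \<psi> x)" by (intro integrable_mult_bounded assms) auto
  obtain C where "\<And>x. \<bar>b x * \<psi> x\<bar> \<le> C" using weight_test_bounded[OF assms(1)] by metis
  then show "integrable lborel (\<lambda>x. v x * (b x * \<psi> x))" by (intro integrable_mult_bounded assms) auto
qed

lemma borel_weak_partial_unique:
  assumes "open \<Omega>" "borel_weak_partial \<Omega> k b v g" "borel_weak_partial \<Omega> k b v g'"
  shows "AE x in lborel. x \<in> \<Omega> \<longrightarrow> g x = g' x"
proof -
  have i: "integrable lborel g" "integrable lborel g'" using assms by (auto simp: borel_weak_partial_def)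
  have "AE x in lborel. x \<in> \<Omega> \<longrightarrow> g x - g' x = 0"
  proof (rule AE_zero_if_test_integrals_zero)
    show "(\<lambda>x. g x - g' x) \<in> borel_measurable borel"
      using borel_measurable_integrable[OF i(1)] borel_measurable_integrable[OF i(2)] by simp
    show "integrable lborel (\<lambda>x. indicator (cbox a c) x * (g x - g' x))" for a c
      using integrable_mult_indicator[of "cbox a c" lborel "\<lambda>x. g x - g' x"] i by simp
    fix \<psi> :: "real^'n \<Rightarrow> real" assume \<psi>: "\<psi> \<in> test_functions \<Omega>"
    have "(LINT x|lborel. (g x - g' x) * \<psi> x) = (LINT x|lborel. g x * \<psi> x) - (LINT x|lborel. g' x * \<psi> x)"
      using integrable_mult_test(1)[OF \<psi>] i by (simp add: left_diff_distrib)
    also have "\<dots> = 0" using assms \<psi> by (auto simp: borel_weak_partial_def)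
    finally show "(LINT x|lborel. (g x - g' x) * \<psi> x) = 0" .
  qed fact
  then show ?thesis by simp
qed

text \<open>The weak derivative is an honest derivative along lines in direction \<open>k\<close>; the weight comes out of the
  integral because it is constant on these lines.\<close>

lemma line_identity:
  assumes wp: "borel_weak_partial \<Omega> k b v g" and U: "open U" and t: "t \<ge> 0"
    and sub: "\<And>x s. x \<in> U \<Longrightarrow> 0 \<le> s \<Longrightarrow> s \<le> t \<Longrightarrow> x + s *\<^sub>R axis k 1 \<in> \<Omega>"
  shows "AE x in lborel. x \<in> U \<longrightarrow> b x * (v (x + t *\<^sub>R axis k 1) - v x) = line_integral (axis k 1) t g x"
proof -
  let ?e = "axis k 1 :: real^'n"
  have i: "integrable lborel v" "integrable lborel g" using wp by (auto simp: borel_weak_partial_def)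
  have [measurable]: "v \<in> borel_measurable borel" "g \<in> borel_measurable borel"
    using i[THEN borel_measurable_integrable] by simp_all
  have il: "integrable lborel (line_integral ?e t g)" using i by (intro integrable_line_integral)
  have ish: "integrable lborel (\<lambda>x. v (x + t *\<^sub>R ?e))" using i by (intro integrable_lborel_shift)
  let ?h = "\<lambda>x. line_integral ?e t g x - b x * (v (x + t *\<^sub>R ?e) - v x)"
  have "AE x in lborel. x \<in> U \<longrightarrow> ?h x = 0"
  proof (rule AE_zero_if_test_integrals_zero[OF _ U])
    show "?h \<in> borel_measurable borel" by measurable
    show "integrable lborel (\<lambda>x. indicator (cbox a c) x * ?h x)" for a c
    proof -
      obtain B where B: "B > 0" "\<And>x. x \<in> cbox a c \<Longrightarrow> \<bar>b x\<bar> \<le> B"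
        by (rule bounded_on_compact[OF compact_cbox]) blast
      have "integrable lborel (\<lambda>x. (v (x + t *\<^sub>R ?e) - v x) * (indicator (cbox a c) x * b x))"
        using B by (intro integrable_mult_bounded[where C=B]) (auto simp: ish i indicator_def)
      moreover have "integrable lborel (\<lambda>x. line_integral ?e t g x * indicator (cbox a c) x)"
        by (rule integrable_mult_bounded[OF il, where C=1]) auto
      ultimately have "integrable lborel (\<lambda>x. line_integral ?e t g x * indicator (cbox a c) x -
         (v (x + t *\<^sub>R ?e) - v x) * (indicator (cbox a c) x * b x))" by simp
      then show ?thesis by (simp add: algebra_simps)
    qed
    fix \<psi> :: "real^'n \<Rightarrow> real" assume \<psi>: "\<psi> \<in> test_functions U"
    note \<psi>' = test_partial[OF \<psi>, of k]
    have [measurable]: "\<psi> \<in> borel_measurable borel" "partial_deriv k \<psi> \<in> borel_measurable borel"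
      using test_measurable \<psi> \<psi>' by auto
    obtain M where M: "\<And>x. \<bar>\<psi> x\<bar> \<le> M" using test_bounded[OF \<psi>] by metis
    obtain M' where M': "\<And>x. \<bar>b x * partial_deriv k \<psi> x\<bar> \<le> M'" using weight_test_bounded[OF \<psi>'] by metis
    \<comment> \<open>The translated test function is still supported in \<open>\<Omega>\<close>,
      since segments of length at most \<open>t\<close> starting in \<open>U\<close> stay in
      \<open>\<Omega>\<close>.\<close>
    have slice: "(LINT x|lborel. g (x + s *\<^sub>R ?e) * \<psi> x) =
        - (LINT x|lborel. v x * (b x * partial_deriv k \<psi> (x - s *\<^sub>R ?e)))" if s: "0 \<le> s" "s \<le> t" for s
    proof -
      have ts: "(\<lambda>x. \<psi> (x + (- s *\<^sub>R ?e))) \<in> test_functions \<Omega>"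
        by (rule test_shift[OF \<psi>]) (use sub s in auto)
      have "(LINT x|lborel. g (x + s *\<^sub>R ?e) * \<psi> x) = (LINT x|lborel. g x * \<psi> (x + (- s *\<^sub>R ?e)))"
        using lborel_integral_shift[of "\<lambda>x. g x * \<psi> (x + (- s *\<^sub>R ?e))" "s *\<^sub>R ?e"] by simp
      also have "\<dots> = - (LINT x|lborel. v x * (b x * partial_deriv k (\<lambda>x. \<psi> (x + (- s *\<^sub>R ?e))) x))"
        using wp ts by (auto simp: borel_weak_partial_def)
      finally show ?thesis unfolding partial_deriv_shift by simp
    qed
    have pg: "integrable (lborel \<Otimes>\<^sub>M lborel) (\<lambda>(x, s). (indicator {0..t} s * g (x + s *\<^sub>R ?e)) * \<psi> x)"
      using integrable_mult_bounded[OF integrable_line_product(2)[OF i(2), of t ?e], of "\<lambda>(x,s). \<psi> x" M] M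
      by (simp add: case_prod_unfold)
    have pv: "integrable (lborel \<Otimes>\<^sub>M lborel)
        (\<lambda>(x, s). (indicator {0..t} s * v x) * (b x * partial_deriv k \<psi> (x - s *\<^sub>R ?e)))"
    proof -
      have bd: "\<bar>b x * partial_deriv k \<psi> (x - s *\<^sub>R ?e)\<bar> \<le> M'" for x s
        using M'[of "x - s *\<^sub>R ?e"] by (simp add: inv_minus)
      show ?thesis
      using integrable_mult_bounded[OF integrable_line_product(2)[OF i(1), of t 0],
          of "\<lambda>(x,s). b x * partial_deriv k \<psi> (x - s *\<^sub>R ?e)" M'] bd
      by (simp add: case_prod_unfold)
    qed
    have ftc: "(LINT s|lborel. indicator {0..t} s * partial_deriv k \<psi> (x - s *\<^sub>R ?e)) = \<psi> x - \<psi> (x - t *\<^sub>R ?e)" for x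
    proof -
      have "(LINT s|lborel. indicator {0..t} s *\<^sub>R partial_deriv k \<psi> (x - s *\<^sub>R ?e)) =
         (- \<psi> (x - t *\<^sub>R ?e)) - (- \<psi> (x - 0 *\<^sub>R ?e))"
      proof (rule integral_FTC_atLeastAtMost[OF t])
        fix s :: real
        have "((\<lambda>s. \<psi> (x + s *\<^sub>R ?e)) has_real_derivative partial_deriv k \<psi> (x + (- s) *\<^sub>R ?e)) (at (- s))"
          by (rule test_line_derivative[OF \<psi>])
        from DERIV_chain2[where g=uminus and x=s and s=UNIV and Db="-1", OF this]
        have "((\<lambda>s. \<psi> (x + (- s) *\<^sub>R ?e)) has_real_derivative - partial_deriv k \<psi> (x + (- s) *\<^sub>R ?e)) (at s)"
          using DERIV_minus[OF DERIV_ident, of s UNIV] by simp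
        from DERIV_minus[OF this]
        show "((\<lambda>s. - \<psi> (x - s *\<^sub>R ?e)) has_vector_derivative partial_deriv k \<psi> (x - s *\<^sub>R ?e)) (at s within {0..t})"
          unfolding has_real_derivative_iff_has_vector_derivative[symmetric]
          by (auto intro: has_field_derivative_at_within)
      next
        show "continuous_on {0..t} (\<lambda>s. partial_deriv k \<psi> (x - s *\<^sub>R ?e))"
          by (rule continuous_on_compose2[OF test_continuous[OF \<psi>']]) (auto intro!: continuous_intros)
      qed
      then show ?thesis by simp
    qed
    \<comment> \<open>The slices are integrated over \<open>s\<close>: Fubini collects the
      derivatives of the translated test functions into a difference of test functions, and a
      translation moves this difference over to \<open>v\<close>.\<close>
    have "(LINT x|lborel. line_integral ?e t g x * \<psi> x) =
        (LINT x|lborel. LINT s|lborel. indicator {0..t} s * g (x + s *\<^sub>R ?e) * \<psi> x)"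
      by (simp add: line_integral_def)
    also have "\<dots> = (LINT s|lborel. LINT x|lborel. indicator {0..t} s * g (x + s *\<^sub>R ?e) * \<psi> x)"
      by (rule lborel_pair.Fubini_integral[symmetric]) (rule pg)
    also have "\<dots> = (LINT s|lborel. - (LINT x|lborel. indicator {0..t} s * v x * (b x * partial_deriv k \<psi> (x - s *\<^sub>R ?e))))"
      using slice by (intro Bochner_Integration.integral_cong) (auto simp: indicator_def)
    also have "\<dots> = - (LINT s|lborel. LINT x|lborel. indicator {0..t} s * v x * (b x * partial_deriv k \<psi> (x - s *\<^sub>R ?e)))"
      by simp
    also have "(LINT s|lborel. LINT x|lborel. indicator {0..t} s * v x * (b x * partial_deriv k \<psi> (x - s *\<^sub>R ?e))) =
       (LINT x|lborel. LINT s|lborel. indicator {0..t} s * v x * (b x * partial_deriv k \<psi> (x - s *\<^sub>R ?e)))"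
      by (rule lborel_pair.Fubini_integral) (rule pv)
    also have "\<dots> = (LINT x|lborel. v x * (b x * (\<psi> x - \<psi> (x - t *\<^sub>R ?e))))"
    proof (rule Bochner_Integration.integral_cong[OF refl])
      fix x
      have "(LINT s|lborel. indicator {0..t} s * v x * (b x * partial_deriv k \<psi> (x - s *\<^sub>R ?e))) =
        (LINT s|lborel. (v x * b x) * (indicator {0..t} s * partial_deriv k \<psi> (x - s *\<^sub>R ?e)))"
        by (intro Bochner_Integration.integral_cong) auto
      then show "(LINT s|lborel. indicator {0..t} s * v x * (b x * partial_deriv k \<psi> (x - s *\<^sub>R ?e))) =
         v x * (b x * (\<psi> x - \<psi> (x - t *\<^sub>R ?e)))" by (simp add: ftc)
    qed
    also have "\<dots> = (LINT x|lborel. v x * (b x * \<psi> x)) - (LINT x|lborel. v x * (b x * \<psi> (x - t *\<^sub>R ?e)))"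
    proof -
      have bd: "\<exists>M. \<forall>x. \<bar>b x * \<psi> (x - t *\<^sub>R ?e)\<bar> \<le> M"
        using weight_test_bounded[OF \<psi>] inv_minus by metis
      then have "integrable lborel (\<lambda>x. v x * (b x * \<psi> (x - t *\<^sub>R ?e)))"
        using i(1) by (auto intro!: integrable_mult_bounded)
      with integrable_mult_test(2)[OF \<psi> i(1)] show ?thesis
        by (subst Bochner_Integration.integral_diff[symmetric]) (auto simp: algebra_simps)
    qed
    also have "(LINT x|lborel. v x * (b x * \<psi> (x - t *\<^sub>R ?e))) = (LINT x|lborel. v (x + t *\<^sub>R ?e) * (b x * \<psi> x))"
      using lborel_integral_shift[of "\<lambda>x. v x * (b x * \<psi> (x - t *\<^sub>R ?e))" "t *\<^sub>R ?e"] by (simp add: inv)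
    finally have 1: "(LINT x|lborel. line_integral ?e t g x * \<psi> x) =
      (LINT x|lborel. v (x + t *\<^sub>R ?e) * (b x * \<psi> x)) - (LINT x|lborel. v x * (b x * \<psi> x))" by simp
    have "(LINT x|lborel. ?h x * \<psi> x) = (LINT x|lborel. line_integral ?e t g x * \<psi> x -
       (v (x + t *\<^sub>R ?e) * (b x * \<psi> x) - v x * (b x * \<psi> x)))"
      by (simp add: algebra_simps)
    also have "\<dots> = 0"
      using integrable_mult_test[OF \<psi> il] integrable_mult_test[OF \<psi> ish] integrable_mult_test[OF \<psi> i(1)] 1
      by simp
    finally show "(LINT x|lborel. ?h x * \<psi> x) = 0" .
  qed
  then show ?thesis by eventually_elim auto
qed

lemma borel_weak_partial_limit:
  assumes wp: "\<And>m. borel_weak_partial \<Omega> k b (v m) (g m)"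
    and v: "integrable lborel v'" "(\<lambda>m. LINT x|lborel. \<bar>v m x - v' x\<bar>) \<longlonglongrightarrow> 0"
    and g: "integrable lborel g'" "(\<lambda>m. LINT x|lborel. \<bar>g m x - g' x\<bar>) \<longlonglongrightarrow> 0"
  shows "borel_weak_partial \<Omega> k b v' g'"
  unfolding borel_weak_partial_def
proof (intro conjI ballI v(1) g(1))
  have i: "integrable lborel (v m)" "integrable lborel (g m)" for m
    using wp by (auto simp: borel_weak_partial_def)
  have lim: "(\<lambda>m. LINT x|lborel. w m x * q x) \<longlonglongrightarrow> (LINT x|lborel. w' x * q x)"
    if w: "\<And>m. integrable lborel (w m)" "integrable lborel w'" "(\<lambda>m. LINT x|lborel. \<bar>w m x - w' x\<bar>) \<longlonglongrightarrow> 0"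
      and q: "q \<in> borel_measurable borel" "\<And>x. \<bar>q x\<bar> \<le> C" for w w' and q :: "real^'n \<Rightarrow> real" and C
  proof -
    have "C \<ge> 0" using q(2)[of undefined] by linarith
    note j = integrable_mult_bounded[OF w(1), of q C] integrable_mult_bounded[OF w(2), of q C]
    have "(\<lambda>m. (LINT x|lborel. w m x * q x) - (LINT x|lborel. w' x * q x)) \<longlonglongrightarrow> 0"
    proof (rule Lim_null_comparison)
      show "(\<lambda>m. C * (LINT x|lborel. \<bar>w m x - w' x\<bar>)) \<longlonglongrightarrow> 0"
        using tendsto_mult[OF tendsto_const w(3), of C] by simp
      show "\<forall>\<^sub>F m in sequentially. norm ((LINT x|lborel. w m x * q x) - (LINT x|lborel. w' x * q x))
         \<le> C * (LINT x|lborel. \<bar>w m x - w' x\<bar>)"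
      proof (rule always_eventually, rule allI)
        fix m
        have "(LINT x|lborel. w m x * q x) - (LINT x|lborel. w' x * q x) = (LINT x|lborel. (w m x - w' x) * q x)"
          using j q by (simp add: left_diff_distrib)
        also have "norm \<dots> \<le> (LINT x|lborel. norm ((w m x - w' x) * q x))"
          by (rule integral_norm_bound)
        also have "\<dots> \<le> (LINT x|lborel. C * \<bar>w m x - w' x\<bar>)"
        proof (rule integral_mono)
          have "integrable lborel (\<lambda>x. (w m x - w' x) * q x)"
            by (rule integrable_mult_bounded[where C=C]) (use w q in auto)
          then show "integrable lborel (\<lambda>x. norm ((w m x - w' x) * q x))" by simp
          show "norm ((w m x - w' x) * q x) \<le> C * \<bar>w m x - w' x\<bar>" for x
            using q(2)[of x] by (simp add: abs_mult mult.commute[of _ "\<bar>q x\<bar>"] mult_right_mono)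
        qed (use w in auto)
        finally show "norm ((LINT x|lborel. w m x * q x) - (LINT x|lborel. w' x * q x))
         \<le> C * (LINT x|lborel. \<bar>w m x - w' x\<bar>)" by simp
      qed
    qed
    then show ?thesis by (rule LIM_zero_cancel)
  qed
  fix \<psi> :: "real^'n \<Rightarrow> real" assume \<psi>: "\<psi> \<in> test_functions \<Omega>"
  note \<psi>' = test_partial[OF \<psi>, of k]
  have [measurable]: "\<psi> \<in> borel_measurable borel" "partial_deriv k \<psi> \<in> borel_measurable borel"
    using test_measurable \<psi> \<psi>' by auto
  obtain M where M: "\<And>x. \<bar>\<psi> x\<bar> \<le> M" using test_bounded[OF \<psi>] by metis
  obtain M' where M': "\<And>x. \<bar>b x * partial_deriv k \<psi> x\<bar> \<le> M'" using weight_test_bounded[OF \<psi>'] by metis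
  have L1: "(\<lambda>m. LINT x|lborel. g m x * \<psi> x) \<longlonglongrightarrow> (LINT x|lborel. g' x * \<psi> x)"
    by (rule lim[OF i(2) g _ M]) simp
  have L2: "(\<lambda>m. - (LINT x|lborel. v m x * (b x * partial_deriv k \<psi> x))) \<longlonglongrightarrow>
      - (LINT x|lborel. v' x * (b x * partial_deriv k \<psi> x))"
    by (intro tendsto_minus lim[OF i(1) v _ M']) simp
  have eq: "(LINT x|lborel. g m x * \<psi> x) = - (LINT x|lborel. v m x * (b x * partial_deriv k \<psi> x))" for m
    using wp[of m] \<psi> by (auto simp: borel_weak_partial_def)
  from L1 L2 show "(LINT x|lborel. g' x * \<psi> x) = - (LINT x|lborel. v' x * (b x * partial_deriv k \<psi> x))"
    unfolding eq by (rule LIMSEQ_unique)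
qed

end

lemma borel_weak_partial_cong:
  assumes wp: "borel_weak_partial \<Omega> k b v g" and \<Omega>: "open \<Omega>"
    and v': "integrable lborel v'" "AE x in lborel. x \<in> \<Omega> \<longrightarrow> v x = v' x"
    and g': "integrable lborel g'" "AE x in lborel. x \<in> \<Omega> \<longrightarrow> g x = g' x"
    and [measurable]: "b \<in> borel_measurable borel"
  shows "borel_weak_partial \<Omega> k b v' g'"
  unfolding borel_weak_partial_def
proof (intro conjI ballI v'(1) g'(1))
  have i: "integrable lborel v" "integrable lborel g" using wp by (auto simp: borel_weak_partial_def)
  have [measurable]: "v \<in> borel_measurable borel" "g \<in> borel_measurable borel"
     "v' \<in> borel_measurable borel" "g' \<in> borel_measurable borel"
    using i[THEN borel_measurable_integrable] v'(1)[THEN borel_measurable_integrable]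
      g'(1)[THEN borel_measurable_integrable] by simp_all
  fix \<psi> :: "real^'a \<Rightarrow> real" assume \<psi>: "\<psi> \<in> test_functions \<Omega>"
  obtain S where S: "S \<subseteq> \<Omega>" "\<And>x. x \<notin> S \<Longrightarrow> \<psi> x = 0" "\<And>x. x \<notin> S \<Longrightarrow> partial_deriv k \<psi> x = 0"
    by (rule test_support[OF \<psi>]) blast
  have [measurable]: "\<psi> \<in> borel_measurable borel" "partial_deriv k \<psi> \<in> borel_measurable borel"
    using test_measurable \<psi> test_partial[OF \<psi>] by blast+
  have "(LINT x|lborel. g' x * \<psi> x) = (LINT x|lborel. g x * \<psi> x)"
    by (rule integral_cong_AE) (use g'(2) S in \<open>auto elim!: eventually_mono\<close>)
  moreover have "(LINT x|lborel. v' x * (b x * partial_deriv k \<psi> x)) = (LINT x|lborel. v x * (b x * partial_deriv k \<psi> x))"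
    by (rule integral_cong_AE) (use v'(2) S in \<open>auto elim!: eventually_mono\<close>)
  ultimately show "(LINT x|lborel. g' x * \<psi> x) = - (LINT x|lborel. v' x * (b x * partial_deriv k \<psi> x))"
    using wp \<psi> by (auto simp: borel_weak_partial_def)
qed

section \<open>Chain rule, absolute value and positive part of weakly differentiable
  functions\<close>

context direction_weight
begin

lemma borel_weak_partial_add:
  assumes "borel_weak_partial \<Omega> k b v g" "borel_weak_partial \<Omega> k b v' g'"
  shows "borel_weak_partial \<Omega> k b (\<lambda>x. v x + v' x) (\<lambda>x. g x + g' x)"
proof -
  have i: "integrable lborel v" "integrable lborel v'" "integrable lborel g" "integrable lborel g'"
    using assms by (auto simp: borel_weak_partial_def)
  have "(LINT x|lborel. (g x + g' x) * \<psi> x) = - (LINT x|lborel. (v x + v' x) * (b x * partial_deriv k \<psi> x))"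
    if \<psi>: "\<psi> \<in> test_functions \<Omega>" for \<psi>
    using assms \<psi> integrable_mult_test(1)[OF \<psi> i(3)] integrable_mult_test(1)[OF \<psi> i(4)]
      integrable_mult_test(2)[OF test_partial[OF \<psi>] i(1)] integrable_mult_test(2)[OF test_partial[OF \<psi>] i(2)]
    by (simp add: borel_weak_partial_def distrib_right)
  with i show ?thesis by (auto simp: borel_weak_partial_def)
qed

lemma borel_weak_partial_cmult:
  assumes "borel_weak_partial \<Omega> k b v g"
  shows "borel_weak_partial \<Omega> k b (\<lambda>x. c * v x) (\<lambda>x. c * g x)"
  using assms by (auto simp: borel_weak_partial_def mult.assoc)

lemma borel_weak_partial_diff:
  assumes "borel_weak_partial \<Omega> k b v g" "borel_weak_partial \<Omega> k b v' g'"
  shows "borel_weak_partial \<Omega> k b (\<lambda>x. v x - v' x) (\<lambda>x. g x - g' x)"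
  using borel_weak_partial_add[OF assms(1) borel_weak_partial_cmult[OF assms(2), of "-1"]] by simp

text \<open>The weight may be unbounded on the whole space, but its product with a derivative of a
  test function is not; as \<open>b\<close> is constant on the segment, the mean value inequality
  applies to the product.\<close>

lemma weight_difference_bound:
  assumes \<psi>: "\<psi> \<in> test_functions U" and M: "\<And>x. \<bar>b x * partial_deriv k \<psi> x\<bar> \<le> M"
  shows "\<bar>b x * (\<psi> (x + t *\<^sub>R axis k 1) - \<psi> x)\<bar> \<le> M * \<bar>t\<bar>"
proof -
  let ?f = "\<lambda>s. b x * \<psi> (x + s *\<^sub>R axis k 1)"
  have "norm (?f t - ?f 0) \<le> M * norm (t - 0)"
  proof (rule field_differentiable_bound[of UNIV])
    fix s :: real
    show "(?f has_field_derivative b x * partial_deriv k \<psi> (x + s *\<^sub>R axis k 1)) (at s within UNIV)"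
      by (rule DERIV_cmult[OF test_line_derivative[OF \<psi>]])
    show "norm (b x * partial_deriv k \<psi> (x + s *\<^sub>R axis k 1)) \<le> M"
      using M[of "x + s *\<^sub>R axis k 1"] by (simp add: inv)
  qed auto
  then show ?thesis by (simp add: right_diff_distrib)
qed

lemma difference_quotient_limit:
  assumes \<psi>: "\<psi> \<in> test_functions U" and w: "integrable lborel w"
    and t: "\<And>j. t j \<noteq> 0" "t \<longlonglongrightarrow> 0"
  shows "(\<lambda>j. LINT x|lborel. w x * (b x * ((\<psi> (x + t j *\<^sub>R axis k 1) - \<psi> x) / t j)))
     \<longlonglongrightarrow> (LINT x|lborel. w x * (b x * partial_deriv k \<psi> x))"
proof -
  note \<psi>' = test_partial[OF \<psi>, of k]
  have [measurable]: "\<psi> \<in> borel_measurable borel" "partial_deriv k \<psi> \<in> borel_measurable borel"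
     "w \<in> borel_measurable borel"
    using test_measurable \<psi> \<psi>' w[THEN borel_measurable_integrable] by auto
  obtain M where M: "M > 0" "\<And>x. \<bar>b x * partial_deriv k \<psi> x\<bar> \<le> M" using weight_test_bounded[OF \<psi>'] by metis
  show ?thesis
  proof (rule integral_dominated_convergence)
    show "integrable lborel (\<lambda>x. M * \<bar>w x\<bar>)" using w by simp
    show "AE x in lborel. (\<lambda>j. w x * (b x * ((\<psi> (x + t j *\<^sub>R axis k 1) - \<psi> x) / t j)))
            \<longlonglongrightarrow> w x * (b x * partial_deriv k \<psi> x)"
    proof (intro AE_I2 tendsto_intros)
      fix x
      have "((\<lambda>h. (\<psi> (x + h *\<^sub>R axis k 1) - \<psi> x) / h) \<longlongrightarrow> partial_deriv k \<psi> x) (at 0)"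
        using test_line_derivative[OF \<psi>, of x k 0] by (simp add: DERIV_def)
      then show "(\<lambda>j. (\<psi> (x + t j *\<^sub>R axis k 1) - \<psi> x) / t j) \<longlonglongrightarrow> partial_deriv k \<psi> x"
        by (rule filterlim_compose) (use t in \<open>auto simp: filterlim_at\<close>)
    qed
    show "AE x in lborel. norm (w x * (b x * ((\<psi> (x + t j *\<^sub>R axis k 1) - \<psi> x) / t j))) \<le> M * \<bar>w x\<bar>" for j
    proof (rule AE_I2)
      fix x
      have "\<bar>b x * (\<psi> (x + t j *\<^sub>R axis k 1) - \<psi> x)\<bar> / \<bar>t j\<bar> \<le> M"
        using weight_difference_bound[OF \<psi> M(2), of x "t j"] t(1)[of j] by (simp add: divide_le_eq)
      then have "\<bar>w x\<bar> * (\<bar>b x * (\<psi> (x + t j *\<^sub>R axis k 1) - \<psi> x)\<bar> / \<bar>t j\<bar>) \<le> \<bar>w x\<bar> * M"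
        by (intro mult_left_mono) auto
      then show "norm (w x * (b x * ((\<psi> (x + t j *\<^sub>R axis k 1) - \<psi> x) / t j))) \<le> M * \<bar>w x\<bar>"
        by (simp add: abs_mult mult.commute)
    qed
  qed auto
qed

text \<open>Discrete integration by parts: a translation moves the difference from \<open>w\<close>
  to \<open>\<psi>\<close> and passes through the weight.\<close>

lemma shifted_difference_integral:
  assumes \<psi>: "\<psi> \<in> test_functions U" and w: "integrable lborel w"
  shows "(LINT x|lborel. b x * (w (x + t *\<^sub>R axis k 1) - w x) * \<psi> x) =
     (LINT x|lborel. w x * (b x * (\<psi> (x - t *\<^sub>R axis k 1) - \<psi> x)))"
    and "integrable lborel (\<lambda>x. b x * (w (x + t *\<^sub>R axis k 1) - w x) * \<psi> x)"
proof -
  let ?e = "axis k 1 :: real^'n"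
  have [measurable]: "\<psi> \<in> borel_measurable borel" "w \<in> borel_measurable borel"
    using test_measurable \<psi> w[THEN borel_measurable_integrable] by auto
  have ws: "integrable lborel (\<lambda>x. w (x + t *\<^sub>R ?e))" by (rule integrable_lborel_shift[OF w])
  note i1 = integrable_mult_test(2)[OF \<psi> w] and i2 = integrable_mult_test(2)[OF \<psi> ws]
  have i3: "integrable lborel (\<lambda>x. w x * (b x * \<psi> (x - t *\<^sub>R ?e)))"
    using integrable_lborel_shift[OF i2, of "- t *\<^sub>R ?e"] by (simp add: inv_minus)
  have eq: "b x * (w (x + t *\<^sub>R ?e) - w x) * \<psi> x = w (x + t *\<^sub>R ?e) * (b x * \<psi> x) - w x * (b x * \<psi> x)" for x
    by (simp add: algebra_simps)
  show "integrable lborel (\<lambda>x. b x * (w (x + t *\<^sub>R axis k 1) - w x) * \<psi> x)"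
    unfolding eq using i1 i2 by simp
  have "(LINT x|lborel. w (x + t *\<^sub>R ?e) * (b x * \<psi> x)) = (LINT x|lborel. w x * (b x * \<psi> (x - t *\<^sub>R ?e)))"
    using lborel_integral_shift[of "\<lambda>x. w x * (b x * \<psi> (x - t *\<^sub>R ?e))" "t *\<^sub>R ?e"] by (simp add: inv)
  moreover have "(LINT x|lborel. w x * (b x * (\<psi> (x - t *\<^sub>R ?e) - \<psi> x))) =
     (LINT x|lborel. w x * (b x * \<psi> (x - t *\<^sub>R ?e))) - (LINT x|lborel. w x * (b x * \<psi> x))"
    using i1 i3 by (simp add: right_diff_distrib)
  ultimately show "(LINT x|lborel. b x * (w (x + t *\<^sub>R axis k 1) - w x) * \<psi> x) =
     (LINT x|lborel. w x * (b x * (\<psi> (x - t *\<^sub>R axis k 1) - \<psi> x)))"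
    unfolding eq using i1 i2 by simp
qed

text \<open>By \<open>line_identity\<close> the weighted difference quotients of \<open>v\<close> are averages of \<open>g\<close>, hence converge to \<open>g\<close>
  in \<open>L\<^sup>1\<close>, and the classical chain rule applies to the difference quotients of \<open>G \<circ> v\<close>.\<close>

lemma borel_weak_partial_chain:
  fixes G G' :: "real \<Rightarrow> real"
  assumes wp: "borel_weak_partial \<Omega> k b v g" and \<Omega>: "open \<Omega>"
    and G: "\<And>s. (G has_real_derivative G' s) (at s)" "G 0 = 0" "\<And>s. \<bar>G' s\<bar> \<le> M"
    and [measurable]: "G' \<in> borel_measurable borel"
  shows "borel_weak_partial \<Omega> k b (\<lambda>x. G (v x)) (\<lambda>x. G' (v x) * g x)"
  unfolding borel_weak_partial_def
proof (intro conjI ballI)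
  let ?e = "axis k 1 :: real^'n"
  have M0: "0 \<le> M" using G(3)[of 0] by linarith
  have iv: "integrable lborel v" and ig: "integrable lborel g" using wp by (auto simp: borel_weak_partial_def)
  have [measurable]: "v \<in> borel_measurable borel" "g \<in> borel_measurable borel"
    using iv[THEN borel_measurable_integrable] ig[THEN borel_measurable_integrable] by simp_all
  have [measurable]: "G \<in> borel_measurable borel"
    by (intro borel_measurable_continuous_onI continuous_at_imp_continuous_on) (use G(1) DERIV_isCont in blast)
  have lip: "\<bar>G s - G t\<bar> \<le> M * \<bar>s - t\<bar>" for s t
    using field_differentiable_bound[of UNIV G G' M s t] G(1,3) by simp
  show iG: "integrable lborel (\<lambda>x. G (v x))"
    by (rule Bochner_Integration.integrable_bound[of _ "\<lambda>x. M * v x"])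
       (use iv lip[of _ 0] G(2) M0 in \<open>auto simp: abs_mult\<close>)
  show iG': "integrable lborel (\<lambda>x. G' (v x) * g x)"
    using integrable_mult_bounded[OF ig, of "\<lambda>x. G' (v x)" M] G(3) by (simp add: mult.commute)
  fix \<psi> :: "real^'n \<Rightarrow> real" assume \<psi>: "\<psi> \<in> test_functions \<Omega>"
  have [measurable]: "\<psi> \<in> borel_measurable borel" using test_measurable[OF \<psi>] .
  obtain S where S: "compact S" "S \<subseteq> \<Omega>" "\<And>x. x \<notin> S \<Longrightarrow> \<psi> x = 0"
    by (rule test_support[OF \<psi>]) blast
  obtain C where C: "C > 0" "\<And>x. \<bar>\<psi> x\<bar> \<le> C" using test_bounded[OF \<psi>] by metis
  obtain r where r: "r > 0" "(\<Union>x\<in>S. ball x r) \<subseteq> \<Omega>"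
    using compact_subset_open_imp_ball_epsilon_subset[OF S(1) \<Omega> S(2)] by metis
  \<comment> \<open>Radius \<open>r / 2\<close> leaves room for steps of length at most
    \<open>r / 2\<close> inside \<open>\<Omega>\<close>.\<close>
  define U where "U = (\<Union>x\<in>S. ball x (r / 2))"
  have U: "open U" "S \<subseteq> U" using r(1) by (auto simp: U_def)
  have [measurable]: "U \<in> sets borel" using U by simp
  define t where "t j = (r / 2) * inverse (real (Suc j))" for j
  have t: "t j > 0" "t j \<le> r / 2" for j
    using r(1) by (auto simp: t_def divide_simps)
  have t0: "t \<longlonglongrightarrow> 0"
    unfolding t_def using tendsto_mult_right_zero[OF LIMSEQ_inverse_real_of_nat, of "r / 2"] by simp
  have "AE x in lborel. x \<in> U \<longrightarrow> b x * (v (x + t j *\<^sub>R ?e) - v x) = line_integral ?e (t j) g x" for j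
  proof (rule line_identity[OF wp U(1)])
    show "0 \<le> t j" using t[of j] by simp
    fix x s assume x: "x \<in> U" and s: "0 \<le> s" "s \<le> t j"
    then obtain y where y: "y \<in> S" "dist y x < r / 2" by (auto simp: U_def)
    have "dist y (x + s *\<^sub>R ?e) \<le> dist y x + dist x (x + s *\<^sub>R ?e)" by (rule dist_triangle)
    also have "dist x (x + s *\<^sub>R ?e) = s" using s by (simp add: dist_norm)
    finally have "dist y (x + s *\<^sub>R ?e) < r" using y s t[of j] by simp
    then show "x + s *\<^sub>R ?e \<in> \<Omega>" using r(2) y(1) by (meson UN_I mem_ball subsetD)
  qed
  then have id: "AE x in lborel. \<forall>j. x \<in> U \<longrightarrow> b x * (v (x + t j *\<^sub>R ?e) - v x) = line_integral ?e (t j) g x"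
    by (subst AE_all_countable) (rule allI)
  have il: "integrable lborel (\<lambda>x. line_integral ?e (t j) g x / t j - g x)" for j
    using integrable_line_integral[OF ig] ig by simp
  have L1: "(\<lambda>j. LINT x|lborel. norm (line_integral ?e (t j) g x / t j - g x)) \<longlonglongrightarrow> 0"
    using line_average_tendsto_L1[OF ig t(1) t0] by simp
  \<comment> \<open>Convergence in the mean gives convergence almost everywhere only along a
    subsequence; the pointwise statement is needed to see that the values of \<open>v\<close>
    converge along the steps.\<close>
  obtain \<rho> where \<rho>: "strict_mono \<rho>"
    "AE x in lborel. (\<lambda>j. line_integral ?e (t (\<rho> j)) g x / t (\<rho> j) - g x) \<longlonglongrightarrow> 0"
    using tendsto_L1_AE_subseq[OF il L1] by (elim exE conjE)
  define \<tau> where "\<tau> j = t (\<rho> j)" for j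
  define q where "q j x = line_integral ?e (\<tau> j) g x / \<tau> j" for j x
  \<comment> \<open>Inserting the derivative where the two values of \<open>v\<close> coincide makes
    the factorisation of the difference of \<open>G\<close> through the difference of
    \<open>v\<close> unconditional.\<close>
  define R where "R j x = (if v (x + \<tau> j *\<^sub>R ?e) = v x then G' (v x)
      else (G (v (x + \<tau> j *\<^sub>R ?e)) - G (v x)) / (v (x + \<tau> j *\<^sub>R ?e) - v x))" for j x
  have [measurable]: "q j \<in> borel_measurable borel" "R j \<in> borel_measurable borel" for j
    unfolding q_def[abs_def] R_def[abs_def] by measurable
  have \<tau>: "\<tau> j > 0" for j using t by (simp add: \<tau>_def)
  have \<tau>0: "\<tau> \<longlonglongrightarrow> 0" using LIMSEQ_subseq_LIMSEQ[OF t0 \<rho>(1)] by (simp add: \<tau>_def[abs_def] o_def)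
  have q: "AE x in lborel. (\<lambda>j. q j x) \<longlonglongrightarrow> g x"
    using \<rho>(2) by eventually_elim (auto simp: q_def \<tau>_def intro: LIM_zero_cancel)
  have qL1: "(\<lambda>j. LINT x|lborel. \<bar>q j x - g x\<bar>) \<longlonglongrightarrow> 0"
    using LIMSEQ_subseq_LIMSEQ[OF L1 \<rho>(1)] by (simp add: q_def \<tau>_def o_def)
  have iq: "integrable lborel (q j)" for j
    using integrable_line_integral[OF ig] by (simp add: q_def[abs_def])
  have R: "\<bar>R j x\<bar> \<le> M" for j x
  proof (cases "v (x + \<tau> j *\<^sub>R ?e) = v x")
    case False
    then show ?thesis using lip[of "v (x + \<tau> j *\<^sub>R ?e)" "v x"]
      by (simp add: R_def abs_divide divide_le_eq)
  qed (simp add: R_def G)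
  \<comment> \<open>Dividing the line identity by \<open>b x\<close> shows that \<open>v\<close> at
    the shifted points tends to \<open>v x\<close>; differentiability of \<open>G\<close> at this
    single value then suffices.\<close>
  have Rlim: "AE x in lborel. x \<in> U \<longrightarrow> (\<lambda>j. R j x) \<longlonglongrightarrow> G' (v x)"
    using q id nz
  proof eventually_elim
    case (elim x)
    show ?case
    proof
      assume "x \<in> U"
      have "b x * (v (x + \<tau> j *\<^sub>R ?e) - v x) = \<tau> j * q j x" for j
        using elim \<open>x \<in> U\<close> \<tau>[of j] by (auto simp: q_def \<tau>_def)
      then have e: "v (x + \<tau> j *\<^sub>R ?e) = v x + \<tau> j * q j x / b x" for j
        using elim(3) by (simp add: field_simps)
      have "(\<lambda>j. v x + \<tau> j * q j x / b x) \<longlonglongrightarrow> v x + 0 * g x / b x"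
        using elim by (intro tendsto_intros \<tau>0) auto
      then have lim: "(\<lambda>j. v (x + \<tau> j *\<^sub>R ?e)) \<longlonglongrightarrow> v x" unfolding e by simp
      define Q where "Q y = (if y = v x then G' (v x) else (G y - G (v x)) / (y - v x))" for y
      have "((\<lambda>y. (G y - G (v x)) / (y - v x)) \<longlongrightarrow> G' (v x)) (at (v x))"
        using G(1)[of "v x"] by (simp add: has_field_derivative_iff)
      then have "(Q \<longlongrightarrow> G' (v x)) (at (v x))"
        by (rule Lim_transform_eventually) (auto simp: Q_def eventually_at intro!: exI[of _ 1])
      moreover have "Q (v x) = G' (v x)" by (simp add: Q_def)
      ultimately have "isCont Q (v x)" by (simp only: isCont_def)
      from isCont_tendsto_compose[OF this lim]
      show "(\<lambda>j. R j x) \<longlonglongrightarrow> G' (v x)" by (simp add: Q_def R_def)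
    qed
  qed
  let ?D = "\<lambda>j. LINT x|lborel. b x * (G (v (x + \<tau> j *\<^sub>R ?e)) - G (v x)) * \<psi> x"
  have DRq: "?D j / \<tau> j = (LINT x|lborel. R j x * q j x * \<psi> x)" for j
  proof -
    have "?D j / \<tau> j = (LINT x|lborel. b x * (G (v (x + \<tau> j *\<^sub>R ?e)) - G (v x)) * \<psi> x / \<tau> j)"
      by simp
    also have "\<dots> = (LINT x|lborel. R j x * q j x * \<psi> x)"
    proof (rule integral_cong_AE)
      show "AE x in lborel. b x * (G (v (x + \<tau> j *\<^sub>R ?e)) - G (v x)) * \<psi> x / \<tau> j = R j x * q j x * \<psi> x"
        using id
      proof eventually_elim
        case (elim x)
        show ?case
        proof (cases "x \<in> S")
          case True
          then have "x \<in> U" using U(2) by auto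
          then have "b x * (v (x + \<tau> j *\<^sub>R ?e) - v x) = \<tau> j * q j x"
            using elim \<tau>[of j] by (auto simp: q_def \<tau>_def)
          moreover have "G (v (x + \<tau> j *\<^sub>R ?e)) - G (v x) = R j x * (v (x + \<tau> j *\<^sub>R ?e) - v x)"
            by (simp add: R_def)
          ultimately have "b x * (G (v (x + \<tau> j *\<^sub>R ?e)) - G (v x)) = R j x * (\<tau> j * q j x)"
            by (metis mult.left_commute)
          then show ?thesis using \<tau>[of j] by simp
        qed (simp add: S(3))
      qed
    qed measurable
    finally show ?thesis .
  qed
  \<comment> \<open>Splitting \<open>R q - G'(v) g = R (q - g) + (R - G'(v)) g\<close>: the first
    term is small in the mean because \<open>R\<close> is bounded, the second by dominated
    convergence with a multiple of |g|.\<close>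
  have "(\<lambda>j. (LINT x|lborel. R j x * q j x * \<psi> x) - (LINT x|lborel. G' (v x) * g x * \<psi> x)) \<longlonglongrightarrow> 0"
  proof (rule Lim_null_comparison)
    let ?E = "\<lambda>j x. indicator U x * (\<bar>R j x - G' (v x)\<bar> * \<bar>g x\<bar>)"
    have iE: "integrable lborel (?E j)" for j
    proof (rule Bochner_Integration.integrable_bound[of _ "\<lambda>x. 2 * M * g x"])
      show "AE x in lborel. norm (?E j x) \<le> norm (2 * M * g x)"
      proof (rule AE_I2)
        fix x
        have "\<bar>R j x - G' (v x)\<bar> \<le> 2 * M" using R[of j x] G(3)[of "v x"] by linarith
        from mult_right_mono[OF this, of "\<bar>g x\<bar>"]
        show "norm (?E j x) \<le> norm (2 * M * g x)" using M0 by (auto simp: indicator_def abs_mult)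
      qed
    qed (use ig in auto)
    have "(\<lambda>j. LINT x|lborel. ?E j x) \<longlonglongrightarrow> (LINT x::real^'n|lborel. 0)"
    proof (rule integral_dominated_convergence[where w="\<lambda>x. norm (2 * M * g x)"])
      show "AE x in lborel. (\<lambda>j. ?E j x) \<longlonglongrightarrow> 0"
        using Rlim
      proof eventually_elim
        case (elim x)
        show ?case
        proof (cases "x \<in> U")
          case True
          have "(\<lambda>j. \<bar>R j x - G' (v x)\<bar> * \<bar>g x\<bar>) \<longlonglongrightarrow> \<bar>G' (v x) - G' (v x)\<bar> * \<bar>g x\<bar>"
            using elim True by (intro tendsto_intros) auto
          then show ?thesis using True by simp
        qed simp
      qed
      show "AE x in lborel. norm (?E j x) \<le> norm (2 * M * g x)" for j
      proof (rule AE_I2)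
        fix x
        have "\<bar>R j x - G' (v x)\<bar> \<le> 2 * M" using R[of j x] G(3)[of "v x"] by linarith
        from mult_right_mono[OF this, of "\<bar>g x\<bar>"]
        show "norm (?E j x) \<le> norm (2 * M * g x)" using M0 by (auto simp: indicator_def abs_mult)
      qed
    qed (use ig in auto)
    then have E: "(\<lambda>j. LINT x|lborel. ?E j x) \<longlonglongrightarrow> 0" by simp
    show "(\<lambda>j. M * C * (LINT x|lborel. \<bar>q j x - g x\<bar>) + C * (LINT x|lborel. ?E j x)) \<longlonglongrightarrow> 0"
      using tendsto_add[OF tendsto_mult_right_zero[OF qL1, of "M * C"] tendsto_mult_right_zero[OF E, of C]] by simp
    show "\<forall>\<^sub>F j in sequentially. norm ((LINT x|lborel. R j x * q j x * \<psi> x) - (LINT x|lborel. G' (v x) * g x * \<psi> x))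
      \<le> M * C * (LINT x|lborel. \<bar>q j x - g x\<bar>) + C * (LINT x|lborel. ?E j x)"
    proof (rule always_eventually, rule allI)
      fix j
      have "integrable lborel (\<lambda>x. q j x * (R j x * \<psi> x))"
      proof (rule integrable_mult_bounded[OF iq, where C="M * C"])
        show "\<bar>R j x * \<psi> x\<bar> \<le> M * C" for x
          using mult_mono[OF R[of j x] C(2)[of x]] M0 by (simp add: abs_mult)
      qed measurable
      then have i1: "integrable lborel (\<lambda>x. R j x * q j x * \<psi> x)" by (simp add: ac_simps)
      have i2: "integrable lborel (\<lambda>x. G' (v x) * g x * \<psi> x)" by (rule integrable_mult_test(1)[OF \<psi> iG'])
      have "norm ((LINT x|lborel. R j x * q j x * \<psi> x) - (LINT x|lborel. G' (v x) * g x * \<psi> x)) =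
         norm (LINT x|lborel. R j x * q j x * \<psi> x - G' (v x) * g x * \<psi> x)" using i1 i2 by simp
      also have "\<dots> \<le> (LINT x|lborel. norm (R j x * q j x * \<psi> x - G' (v x) * g x * \<psi> x))"
        by (rule integral_norm_bound)
      also have "\<dots> \<le> (LINT x|lborel. M * C * \<bar>q j x - g x\<bar> + C * ?E j x)"
      proof (rule integral_mono)
        show "integrable lborel (\<lambda>x. norm (R j x * q j x * \<psi> x - G' (v x) * g x * \<psi> x))" using i1 i2 by simp
        show "integrable lborel (\<lambda>x. M * C * \<bar>q j x - g x\<bar> + C * ?E j x)" using iq ig iE by simp
        fix x
        show "norm (R j x * q j x * \<psi> x - G' (v x) * g x * \<psi> x) \<le> M * C * \<bar>q j x - g x\<bar> + C * ?E j x"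
        proof (cases "x \<in> S")
          case True
          then have xU: "x \<in> U" using U(2) by auto
          have "\<bar>R j x * q j x * \<psi> x - G' (v x) * g x * \<psi> x\<bar> =
             \<bar>R j x * \<psi> x * (q j x - g x) + \<psi> x * ((R j x - G' (v x)) * g x)\<bar>"
            by (simp add: algebra_simps)
          also have "\<dots> \<le> \<bar>R j x\<bar> * \<bar>\<psi> x\<bar> * \<bar>q j x - g x\<bar> + \<bar>\<psi> x\<bar> * (\<bar>R j x - G' (v x)\<bar> * \<bar>g x\<bar>)"
            by (rule order_trans[OF abs_triangle_ineq]) (simp add: abs_mult)
          also have "\<dots> \<le> M * C * \<bar>q j x - g x\<bar> + C * (\<bar>R j x - G' (v x)\<bar> * \<bar>g x\<bar>)"
            by (intro add_mono mult_mono R C(2)) (use M0 C(1) in auto)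
          finally show ?thesis using xU by simp
        next
          case False
          then show ?thesis using S(3)[of x] M0 C(1) by auto
        qed
      qed
      also have "\<dots> = M * C * (LINT x|lborel. \<bar>q j x - g x\<bar>) + C * (LINT x|lborel. ?E j x)"
        using iq ig iE by simp
      finally show "norm ((LINT x|lborel. R j x * q j x * \<psi> x) - (LINT x|lborel. G' (v x) * g x * \<psi> x))
        \<le> M * C * (LINT x|lborel. \<bar>q j x - g x\<bar>) + C * (LINT x|lborel. ?E j x)" .
    qed
  qed
  then have A: "(\<lambda>j. ?D j / \<tau> j) \<longlonglongrightarrow> (LINT x|lborel. G' (v x) * g x * \<psi> x)"
    unfolding DRq by (rule LIM_zero_cancel)
  \<comment> \<open>The same quotients are now viewed from the test function: discrete integration
    by parts turns the step \<open>\<tau> j\<close> on \<open>G (v x)\<close> into the step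
    \<open>- \<tau> j\<close> on \<open>\<psi>\<close>.\<close>
  have "(\<lambda>j. LINT x|lborel. G (v x) * (b x * ((\<psi> (x + (- \<tau> j) *\<^sub>R ?e) - \<psi> x) / (- \<tau> j))))
     \<longlonglongrightarrow> (LINT x|lborel. G (v x) * (b x * partial_deriv k \<psi> x))"
  proof (rule difference_quotient_limit[OF \<psi> iG])
    show "- \<tau> j \<noteq> 0" for j using \<tau>[of j] by simp
    show "(\<lambda>j. - \<tau> j) \<longlonglongrightarrow> 0" using tendsto_minus[OF \<tau>0] by simp
  qed
  then have "(\<lambda>j. - (LINT x|lborel. G (v x) * (b x * ((\<psi> (x + (- \<tau> j) *\<^sub>R ?e) - \<psi> x) / (- \<tau> j)))))
     \<longlonglongrightarrow> - (LINT x|lborel. G (v x) * (b x * partial_deriv k \<psi> x))" by (rule tendsto_minus)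
  moreover have "- (LINT x|lborel. G (v x) * (b x * ((\<psi> (x + (- \<tau> j) *\<^sub>R ?e) - \<psi> x) / (- \<tau> j)))) = ?D j / \<tau> j" for j
  proof -
    have e: "?D j = (LINT x|lborel. G (v x) * (b x * (\<psi> (x - \<tau> j *\<^sub>R ?e) - \<psi> x)))"
      by (rule shifted_difference_integral(1)[OF \<psi> iG])
    show ?thesis unfolding e by simp
  qed
  ultimately have B: "(\<lambda>j. ?D j / \<tau> j) \<longlonglongrightarrow> - (LINT x|lborel. G (v x) * (b x * partial_deriv k \<psi> x))"
    by (simp only:)
  show "(LINT x|lborel. G' (v x) * g x * \<psi> x) = - (LINT x|lborel. G (v x) * (b x * partial_deriv k \<psi> x))"
    by (rule LIMSEQ_unique[OF A B])
qed

text \<open>Extends the chain rule to outer functions with kinks: \<open>H'\<close> need not be a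
  derivative of \<open>H\<close>, its value at a kink is whatever the approximating derivatives
  converge to.\<close>

lemma borel_weak_partial_chain_limit:
  fixes G G' :: "nat \<Rightarrow> real \<Rightarrow> real"
  assumes wp: "borel_weak_partial \<Omega> k b v g" and \<Omega>: "open \<Omega>"
    and G: "\<And>m s. (G m has_real_derivative G' m s) (at s)" "\<And>m. G m 0 = 0" "\<And>m s. \<bar>G' m s\<bar> \<le> 1"
    and G'[measurable]: "\<And>m. G' m \<in> borel_measurable borel"
    and lim: "\<And>s. (\<lambda>m. G m s) \<longlonglongrightarrow> H s" "\<And>s. (\<lambda>m. G' m s) \<longlonglongrightarrow> H' s"
  shows "borel_weak_partial \<Omega> k b (\<lambda>x. H (v x)) (\<lambda>x. H' (v x) * g x)"
proof -
  have i: "integrable lborel v" "integrable lborel g" using wp by (auto simp: borel_weak_partial_def)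
  have [measurable]: "v \<in> borel_measurable borel" "g \<in> borel_measurable borel"
    using i[THEN borel_measurable_integrable] by simp_all
  have [measurable]: "G m \<in> borel_measurable borel" for m
    by (intro borel_measurable_continuous_onI continuous_at_imp_continuous_on) (use G(1) DERIV_isCont in blast)
  have [measurable]: "H \<in> borel_measurable borel" "H' \<in> borel_measurable borel"
    using borel_measurable_LIMSEQ_real[of borel G H] borel_measurable_LIMSEQ_real[of borel G' H'] lim by simp_all
  have Gb: "\<bar>G m s\<bar> \<le> \<bar>s\<bar>" for m s
    using field_differentiable_bound[of UNIV "G m" "G' m" 1 s 0] G by simp
  have Hb: "\<bar>H s\<bar> \<le> \<bar>s\<bar>" for s
    by (rule LIMSEQ_le_const2[OF tendsto_rabs[OF lim(1)]]) (use Gb in auto)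
  have H'b: "\<bar>H' s\<bar> \<le> 1" for s
    by (rule LIMSEQ_le_const2[OF tendsto_rabs[OF lim(2)]]) (use G(3) in auto)
  have iH: "integrable lborel (\<lambda>x. H (v x))"
    by (rule Bochner_Integration.integrable_bound[OF i(1)]) (use Hb in auto)
  have iH': "integrable lborel (\<lambda>x. H' (v x) * g x)"
    using integrable_mult_bounded[OF i(2), of "\<lambda>x. H' (v x)" 1] H'b by (simp add: mult.commute)
  show ?thesis
  proof (rule borel_weak_partial_limit[OF borel_weak_partial_chain[OF wp \<Omega> G G']])
    have "(\<lambda>m. LINT x|lborel. \<bar>G m (v x) - H (v x)\<bar>) \<longlonglongrightarrow> (LINT x::real^'n|lborel. 0)"
    proof (rule integral_dominated_convergence)
      show "integrable lborel (\<lambda>x. 2 * \<bar>v x\<bar>)" using i by simp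
      show "AE x in lborel. (\<lambda>m. \<bar>G m (v x) - H (v x)\<bar>) \<longlonglongrightarrow> 0"
        using lim(1) by (intro AE_I2 tendsto_rabs_zero LIM_zero)
      show "AE x in lborel. norm \<bar>G m (v x) - H (v x)\<bar> \<le> 2 * \<bar>v x\<bar>" for m
      proof (rule AE_I2)
        fix x show "norm \<bar>G m (v x) - H (v x)\<bar> \<le> 2 * \<bar>v x\<bar>"
          using Gb[of m "v x"] Hb[of "v x"] by simp
      qed
    qed measurable
    then show "(\<lambda>m. LINT x|lborel. \<bar>G m (v x) - H (v x)\<bar>) \<longlonglongrightarrow> 0" by simp
    have "(\<lambda>m. LINT x|lborel. \<bar>G' m (v x) * g x - H' (v x) * g x\<bar>) \<longlonglongrightarrow> (LINT x::real^'n|lborel. 0)"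
    proof (rule integral_dominated_convergence)
      show "integrable lborel (\<lambda>x. 2 * \<bar>g x\<bar>)" using i by simp
      show "AE x in lborel. (\<lambda>m. \<bar>G' m (v x) * g x - H' (v x) * g x\<bar>) \<longlonglongrightarrow> 0"
        using lim(2) by (intro AE_I2 tendsto_rabs_zero LIM_zero tendsto_intros)
      show "AE x in lborel. norm \<bar>G' m (v x) * g x - H' (v x) * g x\<bar> \<le> 2 * \<bar>g x\<bar>" for m
      proof (rule AE_I2)
        fix x
        have "\<bar>G' m (v x) - H' (v x)\<bar> \<le> 2" using G(3)[of m "v x"] H'b[of "v x"] by linarith
        from mult_right_mono[OF this, of "\<bar>g x\<bar>"]
        show "norm \<bar>G' m (v x) * g x - H' (v x) * g x\<bar> \<le> 2 * \<bar>g x\<bar>"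
          by (simp add: abs_mult[symmetric] left_diff_distrib)
      qed
    qed measurable
    then show "(\<lambda>m. LINT x|lborel. \<bar>G' m (v x) * g x - H' (v x) * g x\<bar>) \<longlonglongrightarrow> 0" by simp
  qed (fact iH iH')+
qed

lemma borel_weak_partial_abs:
  assumes wp: "borel_weak_partial \<Omega> k b v g" and \<Omega>: "open \<Omega>"
  shows "borel_weak_partial \<Omega> k b (\<lambda>x. \<bar>v x\<bar>) (\<lambda>x. sgn (v x) * g x)"
proof (rule borel_weak_partial_chain_limit[OF wp \<Omega>])
  let ?e = "\<lambda>m. inverse (real (Suc m))"
  \<comment> \<open>Subtracting \<open>?e m\<close> normalises the smoothed absolute value to vanish
    at 0, as integrability on the whole space demands.\<close>
  let ?G = "\<lambda>m s. sqrt (s\<^sup>2 + (?e m)\<^sup>2) - ?e m"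
  let ?G' = "\<lambda>m s. s / sqrt (s\<^sup>2 + (?e m)\<^sup>2)"
  have pos: "s\<^sup>2 + (?e m)\<^sup>2 > 0" for m s by (intro add_nonneg_pos) auto
  show "(?G m has_real_derivative ?G' m s) (at s)" for m s
  proof -
    have "((\<lambda>s. sqrt (s\<^sup>2 + c\<^sup>2) - c) has_real_derivative s / sqrt (s\<^sup>2 + c\<^sup>2)) (at s)"
      if "s\<^sup>2 + c\<^sup>2 > 0" for c
      using that by (auto intro!: derivative_eq_intros simp: divide_simps)
    from this[OF pos] show ?thesis .
  qed
  show "?G m 0 = 0" for m by simp
  show "\<bar>?G' m s\<bar> \<le> 1" for m s
  proof -
    have "\<bar>s\<bar> = sqrt (s\<^sup>2)" by simp
    also have "\<dots> \<le> sqrt (s\<^sup>2 + (?e m)\<^sup>2)" by (intro real_sqrt_le_mono) simp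
    finally show ?thesis using pos[of s m] by (simp add: abs_divide divide_le_eq)
  qed
  show "?G' m \<in> borel_measurable borel" for m by measurable
  show "(\<lambda>m. ?G m s) \<longlonglongrightarrow> \<bar>s\<bar>" for s
  proof -
    have "(\<lambda>m. ?G m s) \<longlonglongrightarrow> sqrt (s\<^sup>2 + 0\<^sup>2) - 0" by (intro tendsto_intros LIMSEQ_inverse_real_of_nat)
    then show ?thesis by simp
  qed
  show "(\<lambda>m. ?G' m s) \<longlonglongrightarrow> sgn s" for s
  proof (cases "s = 0")
    case False
    have "(\<lambda>m. ?G' m s) \<longlonglongrightarrow> s / sqrt (s\<^sup>2 + 0\<^sup>2)"
      by (intro tendsto_intros LIMSEQ_inverse_real_of_nat) (use False in auto)
    moreover have "s / sqrt (s\<^sup>2 + 0\<^sup>2) = sgn s" using False by (simp add: sgn_if)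
    ultimately show ?thesis by simp
  qed simp
qed

text \<open>The functions \<open>\<epsilon> arctan (s / \<epsilon>)\<close> tend to 0, but their derivatives tend to the indicator of \<open>{0}\<close>.\<close>

lemma borel_weak_partial_zero_set:
  assumes wp: "borel_weak_partial \<Omega> k b v g" and \<Omega>: "open \<Omega>"
  shows "AE x in lborel. x \<in> \<Omega> \<longrightarrow> v x = 0 \<longrightarrow> g x = 0"
proof -
  have "borel_weak_partial \<Omega> k b (\<lambda>x. (\<lambda>_. 0) (v x)) (\<lambda>x. (\<lambda>s. if s = 0 then 1 else 0) (v x) * g x)"
  proof (rule borel_weak_partial_chain_limit[OF wp \<Omega>])
    let ?e = "\<lambda>m. inverse (real (Suc m))"
    let ?G = "\<lambda>m s. ?e m * arctan (real (Suc m) * s)"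
    let ?G' = "\<lambda>m s. inverse (1 + (real (Suc m) * s)\<^sup>2)"
    show "(?G m has_real_derivative ?G' m s) (at s)" for m s
      by (auto intro!: derivative_eq_intros simp del: of_nat_Suc)
    show "?G m 0 = 0" for m by simp
    show "\<bar>?G' m s\<bar> \<le> 1" for m s by (simp add: inverse_le_1_iff)
    show "?G' m \<in> borel_measurable borel" for m by measurable
    show "(\<lambda>m. ?G m s) \<longlonglongrightarrow> 0" for s
    proof (rule Lim_null_comparison)
      show "(\<lambda>m. ?e m * pi) \<longlonglongrightarrow> 0"
        using tendsto_mult_left_zero[OF LIMSEQ_inverse_real_of_nat] by blast
      have "\<bar>arctan y\<bar> \<le> pi" for y using arctan_bounded[of y] pi_gt_zero by linarith
      then show "\<forall>\<^sub>F m in sequentially. norm (?G m s) \<le> ?e m * pi"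
        by (simp add: abs_mult mult_left_mono del: of_nat_Suc)
    qed
    show "(\<lambda>m. ?G' m s) \<longlonglongrightarrow> (if s = 0 then 1 else 0)" for s
    proof (cases "s = 0")
      case False
      have "filterlim (\<lambda>m. 1 + (real (Suc m) * s)\<^sup>2) at_top sequentially"
        using False by real_asymp
      from tendsto_inverse_0_at_top[OF this] show ?thesis using False by simp
    qed simp
  qed
  moreover have "borel_weak_partial \<Omega> k b (\<lambda>x. (\<lambda>_. 0) (v x)) (\<lambda>x. 0)"
    by (simp add: borel_weak_partial_def)
  ultimately have "AE x in lborel. x \<in> \<Omega> \<longrightarrow> (if v x = 0 then 1 else 0) * g x = 0"
    by (rule borel_weak_partial_unique[OF \<Omega>])
  then show ?thesis by eventually_elim auto
qed

lemma borel_weak_partial_pos: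
  assumes wp: "borel_weak_partial \<Omega> k b v g" and \<Omega>: "open \<Omega>"
  shows "borel_weak_partial \<Omega> k b (\<lambda>x. max (v x) 0) (\<lambda>x. if v x > 0 then g x else 0)"
proof (rule borel_weak_partial_cong[OF _ \<Omega>])
  have i: "integrable lborel v" "integrable lborel g" using wp by (auto simp: borel_weak_partial_def)
  have [measurable]: "v \<in> borel_measurable borel" "g \<in> borel_measurable borel"
    using i[THEN borel_measurable_integrable] by simp_all
  show "borel_weak_partial \<Omega> k b (\<lambda>x. (1/2) * (v x + \<bar>v x\<bar>)) (\<lambda>x. (1/2) * (g x + sgn (v x) * g x))"
    by (intro borel_weak_partial_cmult borel_weak_partial_add borel_weak_partial_abs wp \<Omega>)
  show "integrable lborel (\<lambda>x. max (v x) 0)" using i by simp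
  show "integrable lborel (\<lambda>x. if v x > 0 then g x else 0)"
    by (rule Bochner_Integration.integrable_bound[OF i(2)]) auto
  show "AE x in lborel. x \<in> \<Omega> \<longrightarrow> (1/2) * (v x + \<bar>v x\<bar>) = max (v x) 0"
    by (auto simp: max_def)
  \<comment> \<open>Where \<open>v = 0\<close> the left side is \<open>g / 2\<close>, which is 0
    there by the zero-set lemma.\<close>
  show "AE x in lborel. x \<in> \<Omega> \<longrightarrow> (1/2) * (g x + sgn (v x) * g x) = (if v x > 0 then g x else 0)"
    using borel_weak_partial_zero_set[OF wp \<Omega>] by eventually_elim (auto simp: sgn_if)
qed measurable

end

section \<open>Lipschitz functions are weakly differentiable\<close>

text \<open>A substitute for the convex hull of the tail from \<open>m\<close>: the parallelogram
  law needs nothing but midpoints, and all properties transfer by rule induction without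
  coefficients.\<close>

inductive_set midpoint_hull :: "(nat \<Rightarrow> 'a \<Rightarrow> real) \<Rightarrow> nat \<Rightarrow> ('a \<Rightarrow> real) set" for D m where
  base: "m \<le> j \<Longrightarrow> D j \<in> midpoint_hull D m"
| mid: "f \<in> midpoint_hull D m \<Longrightarrow> g \<in> midpoint_hull D m \<Longrightarrow> (\<lambda>x. (f x + g x) / 2) \<in> midpoint_hull D m"

lemma midpoint_hull_antimono: "m \<le> m' \<Longrightarrow> midpoint_hull D m' \<subseteq> midpoint_hull D m"
proof
  fix f assume "m \<le> m'" "f \<in> midpoint_hull D m'"
  from this(2,1) show "f \<in> midpoint_hull D m"
    by (induction) (auto intro: midpoint_hull.intros)
qed

lemma midpoint_hull_bounded:
  assumes "\<And>j x. \<bar>D j x\<bar> \<le> B x" "f \<in> midpoint_hull D m" shows "\<bar>f x\<bar> \<le> B x"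
  using assms(2)
proof (induction)
  case (base j) show ?case by (rule assms(1))
next
  case (mid f g)
  then show ?case by (simp add: abs_le_iff)
qed

lemma midpoint_hull_measurable:
  assumes "\<And>j. D j \<in> borel_measurable M" "f \<in> midpoint_hull D m"
  shows "f \<in> borel_measurable M"
  using assms(2) by (induction) (auto intro: assms(1))

text \<open>Sequential weak compactness without duality: almost minimising the \<open>L\<^sup>2\<close> norm over convex
  combinations of tails produces, by the parallelogram law, a sequence converging almost everywhere.\<close>

lemma bounded_weak_limit:
  fixes D :: "nat \<Rightarrow> 'a \<Rightarrow> real"
  assumes D[measurable]: "\<And>j. D j \<in> borel_measurable M" and bd: "\<And>j x. \<bar>D j x\<bar> \<le> C * indicator S x"
    and S[measurable]: "S \<in> sets M" and fin: "emeasure M S < \<infinity>" and C: "0 \<le> C"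
  obtains g where "g \<in> borel_measurable M" "\<And>x. \<bar>g x\<bar> \<le> C * indicator S x"
    "\<And>w l W. w \<in> borel_measurable M \<Longrightarrow> (\<And>x. \<bar>w x\<bar> \<le> W) \<Longrightarrow> (\<lambda>j. LINT x|M. D j x * w x) \<longlonglongrightarrow> l \<Longrightarrow>
       (LINT x|M. g x * w x) = l"
proof -
  define H where "H = midpoint_hull D"
  have Hm[measurable_dest]: "f \<in> H m \<Longrightarrow> f \<in> borel_measurable M" for f m
    unfolding H_def by (rule midpoint_hull_measurable[OF D])
  have Hb: "f \<in> H m \<Longrightarrow> \<bar>f x\<bar> \<le> C * indicator S x" for f m x
    unfolding H_def by (rule midpoint_hull_bounded[OF bd])
  have Hanti: "m \<le> m' \<Longrightarrow> H m' \<subseteq> H m" for m m' unfolding H_def by (rule midpoint_hull_antimono)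
  have iS0: "integrable M (indicat_real S)" using fin by (intro integrable_real_indicator) auto
  then have iS: "integrable M (\<lambda>x. c * indicator S x :: real)" for c by simp
  have int: "integrable M h" if "h \<in> borel_measurable M" "\<And>x. \<bar>h x\<bar> \<le> c * indicator S x" for h :: "'a \<Rightarrow> real" and c
    by (rule Bochner_Integration.integrable_bound[OF iS[of c] that(1)])
      (use that(2) in \<open>auto intro!: AE_I2 order_trans[OF _ abs_ge_self]\<close>)
  define N where "N f = (LINT x|M. (f x)\<^sup>2)" for f :: "'a \<Rightarrow> real"
  have sq: "\<bar>(f x)\<^sup>2\<bar> \<le> C\<^sup>2 * indicator S x" if "f \<in> H m" for f m x
  proof -
    have "(f x)\<^sup>2 \<le> (C * indicator S x)\<^sup>2" using power_mono[OF Hb[OF that, of x], of 2] by simp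
    then show ?thesis by (auto simp: indicator_def split: if_splits)
  qed
  have isq: "integrable M (\<lambda>x. (f x)\<^sup>2)" if "f \<in> H m" for f m
    using Hm[OF that] sq[OF that] by (intro int[of _ "C\<^sup>2"]) auto
  have N0: "0 \<le> N f" for f unfolding N_def by simp
  have NC: "N f \<le> C\<^sup>2 * measure M S" if "f \<in> H m" for f m
  proof -
    have "N f \<le> (LINT x|M. C\<^sup>2 * indicator S x)"
      unfolding N_def using isq[OF that] iS sq[OF that] by (intro integral_mono) auto
    then show ?thesis using sets.sets_into_space[OF S] by (simp add: Int_absorb2)
  qed
  have ne: "H m \<noteq> {}" for m using midpoint_hull.base[of m m D] by (auto simp: H_def)
  have bdd: "bdd_below (N ` H m)" for m using N0 by (auto intro!: bdd_belowI[of _ 0])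
  \<comment> \<open>Minimal squared norm over the hull of a tail. Tails shrink, so \<open>J\<close>
    increases, and the uniform bound makes it converge.\<close>
  define J where "J m = Inf (N ` H m)" for m
  have Jle: "J m \<le> N f" if "f \<in> H m" for f m unfolding J_def using that bdd by (intro cInf_lower) auto
  have "incseq J" unfolding J_def
    by (intro incseq_SucI cInf_superset_mono image_mono Hanti bdd) (use ne in auto)
  moreover have "J m \<le> C\<^sup>2 * measure M S" for m
    using ne[of m] Jle NC by (metis ex_in_conv order_trans)
  ultimately obtain L where L: "J \<longlonglongrightarrow> L" "\<And>m. J m \<le> L" using incseq_convergent by metis
  \<comment> \<open>The tolerance 4^-i makes consecutive near-minimisers close at a geometric rate;
    \<open>m \<ge> i\<close> keeps the i-th one in the hull of the tail from \<open>i\<close>, which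
    identifies the limit at the end.\<close>
  have "\<exists>m\<ge>i. J m > L - (1/4)^i" for i
  proof -
    have "eventually (\<lambda>m. J m > L - (1/4)^i) sequentially" using order_tendstoD(1)[OF L(1)] by simp
    from eventually_conj[OF this eventually_ge_at_top[of i]] show ?thesis
      by (auto dest!: eventually_happens)
  qed
  then obtain \<mu> where \<mu>: "\<And>i. \<mu> i \<ge> i" "\<And>i. J (\<mu> i) > L - (1/4)^i" by metis
  have "\<exists>c\<in>H (\<mu> i). N c < L + (1/4)^i" for i
  proof -
    have "Inf (N ` H (\<mu> i)) < L + (1/4)^i" unfolding J_def[symmetric]
      by (rule le_less_trans[OF L(2)]) simp
    from cInf_lessD[OF _ this] ne show ?thesis by auto
  qed
  then obtain c where c: "\<And>i. c i \<in> H (\<mu> i)" "\<And>i. N (c i) < L + (1/4)^i" by metis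
  have [measurable]: "c i \<in> borel_measurable M" for i using Hm[OF c(1)] .
  define d where "d i x = c (Suc i) x - c i x" for i x
  have db: "\<bar>d i x\<bar> \<le> 2 * C * indicator S x" for i x
    using Hb[OF c(1), of i x] Hb[OF c(1), of "Suc i" x] by (auto simp: d_def)
  have [measurable]: "d i \<in> borel_measurable M" for i by (simp add: d_def[abs_def])
  have Nd: "N (d i) \<le> 8 * (1/4)^i" for i
  proof -
    \<comment> \<open>Both functions lie in the hull with the smaller index, so their midpoint
      competes for \<open>J p\<close>, and the parallelogram law bounds their distance.\<close>
    define p where "p = min (\<mu> i) (\<mu> (Suc i))"
    have "c i \<in> H p" "c (Suc i) \<in> H p"
      using c(1) Hanti[of p "\<mu> i"] Hanti[of p "\<mu> (Suc i)"] by (auto simp: p_def)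
    then have mid: "(\<lambda>x. (c i x + c (Suc i) x) / 2) \<in> H p"
      using midpoint_hull.mid by (auto simp: H_def)
    have pw: "(1/4::real)^Suc i \<le> (1/4)^i" by simp
    have "p = \<mu> i \<or> p = \<mu> (Suc i)" by (auto simp: p_def min_def)
    moreover have "J (\<mu> (Suc i)) > L - (1/4)^i" using \<mu>(2)[of "Suc i"] pw by linarith
    ultimately have Jp: "J p > L - (1/4)^i" using \<mu>(2)[of i] by auto
    have "N (d i) = (LINT x|M. 2 * (c i x)\<^sup>2 + 2 * (c (Suc i) x)\<^sup>2 - 4 * ((c i x + c (Suc i) x) / 2)\<^sup>2)"
      unfolding N_def d_def by (intro Bochner_Integration.integral_cong) (auto simp: power2_eq_square field_simps)
    also have "\<dots> = 2 * N (c i) + 2 * N (c (Suc i)) - 4 * N (\<lambda>x. (c i x + c (Suc i) x) / 2)"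
      unfolding N_def using isq[OF c(1)] isq[OF c(1)[of "Suc i"]] isq[OF mid] by simp
    finally show ?thesis using c(2)[of i] c(2)[of "Suc i"] Jle[OF mid] Jp pw by linarith
  qed
  have id: "integrable M (d i)" for i using db by (intro int[of _ "2 * C"]) auto
  have id2: "integrable M (\<lambda>x. (d i x)\<^sup>2)" for i
  proof (rule int[of _ "(2 * C)\<^sup>2"])
    show "\<bar>(d i x)\<^sup>2\<bar> \<le> (2 * C)\<^sup>2 * indicator S x" for x
      using power_mono[OF db[of i x], of 2] by (auto simp: indicator_def split: if_splits)
  qed measurable
  have Ld: "(LINT x|M. \<bar>d i x\<bar>) \<le> (1/2)^i * ((measure M S + 8) / 2)" for i
  proof -
    \<comment> \<open>On \<open>S\<close> the weighted inequality 2|d| \<le> 2^-i + 2^i d^2 converts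
      the bound 8 * 4^-i on the squared norm into a summable bound of order 2^-i in the
      mean.\<close>
    have "(LINT x|M. \<bar>d i x\<bar>) \<le> (LINT x|M. ((1/2)^i / 2) * indicator S x + (2^i / 2) * (d i x)\<^sup>2)"
    proof (rule integral_mono)
      fix x
      show "\<bar>d i x\<bar> \<le> ((1/2)^i / 2) * indicator S x + (2^i / 2) * (d i x)\<^sup>2"
      proof (cases "x \<in> S")
        case True
        have "0 \<le> (1 - 2^i * \<bar>d i x\<bar>)\<^sup>2" by simp
        then have "2 * (2^i * \<bar>d i x\<bar>) \<le> 1 + (2^i)\<^sup>2 * (d i x)\<^sup>2"
          by (simp add: power2_diff power_mult_distrib)
        then have "2^i * (2 * \<bar>d i x\<bar>) \<le> 2^i * ((1/2)^i + 2^i * (d i x)\<^sup>2)"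
          by (simp add: distrib_left power_one_over power2_eq_square mult.assoc mult.left_commute)
        then have "2 * \<bar>d i x\<bar> \<le> (1/2)^i + 2^i * (d i x)\<^sup>2"
          by (subst (asm) mult_le_cancel_left_pos) auto
        then show ?thesis using True by simp
      next
        case False
        then show ?thesis using db[of i x] by simp
      qed
    qed (use id id2 iS0 in auto)
    also have "\<dots> = ((1/2)^i / 2) * measure M S + (2^i / 2) * N (d i)"
      using id2 iS0 sets.sets_into_space[OF S] by (simp add: N_def Int_absorb2)
    also have "\<dots> \<le> ((1/2)^i / 2) * measure M S + (2^i / 2) * (8 * (1/4)^i)"
      by (intro add_left_mono mult_left_mono Nd) auto
    also have "(2::real)^i * (1/4)^i = (1/2)^i" by (simp add: power_mult_distrib[symmetric])
    then have "(2^i / 2) * (8 * (1/4)^i) = (1/2)^i * (8 / 2 :: real)" by simp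
    finally show ?thesis by (simp add: algebra_simps add_divide_distrib)
  qed
  have sm: "summable (\<lambda>i. (1/2::real)^i * ((measure M S + 8) / 2))"
    by (intro summable_mult2 summable_geometric) simp
  have "AE x in M. summable (\<lambda>i. \<bar>d i x\<bar>)"
  proof -
    have "(\<integral>\<^sup>+x. (\<Sum>i. ennreal \<bar>d i x\<bar>) \<partial>M) = (\<Sum>i. \<integral>\<^sup>+x. ennreal \<bar>d i x\<bar> \<partial>M)"
      by (rule nn_integral_suminf) measurable
    also have "\<dots> = (\<Sum>i. ennreal (LINT x|M. \<bar>d i x\<bar>))"
      using id by (intro arg_cong[where f=suminf] ext nn_integral_eq_integral) auto
    also have "\<dots> \<le> (\<Sum>i. ennreal ((1/2)^i * ((measure M S + 8) / 2)))"
      by (intro suminf_le ennreal_leI Ld) auto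
    also have "\<dots> = ennreal (\<Sum>i. (1/2)^i * ((measure M S + 8) / 2))"
      by (rule suminf_ennreal_eq[OF _ summable_sums[OF sm]]) simp
    also have "\<dots> < \<infinity>" by simp
    finally have "AE x in M. (\<Sum>i. ennreal \<bar>d i x\<bar>) \<noteq> \<infinity>"
      by (intro nn_integral_PInf_AE) auto
    then show ?thesis by eventually_elim (auto intro: summable_suminf_not_top)
  qed
  then have conv: "AE x in M. convergent (\<lambda>i. c i x)"
  proof eventually_elim
    case (elim x)
    then have "summable (\<lambda>i. d i x)" by (rule summable_rabs_cancel)
    then have "convergent (\<lambda>n. \<Sum>i<n. d i x)" by (simp add: summable_iff_convergent)
    moreover have "(\<Sum>i<n. d i x) = c n x - c 0 x" for n by (induction n) (auto simp: d_def)
    ultimately have "convergent (\<lambda>n. c n x - c 0 x)" by simp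
    then show ?case using convergent_add[of "\<lambda>n. c n x - c 0 x" "\<lambda>n. c 0 x"] by (simp add: convergent_const)
  qed
  define B where "B x = C * indicator S x" for x
  \<comment> \<open>\<open>lim\<close> is unspecified where the sequence diverges; clipping enforces
    the required bound at every point.\<close>
  define g where "g x = max (- B x) (min (B x) (lim (\<lambda>i. c i x)))" for x
  have B0: "0 \<le> B x" for x using C by (simp add: B_def)
  have cB: "\<bar>c i x\<bar> \<le> B x" for i x using Hb[OF c(1)] by (simp add: B_def)
  have [measurable]: "g \<in> borel_measurable M" unfolding g_def[abs_def] B_def by measurable
  have gl: "AE x in M. (\<lambda>i. c i x) \<longlonglongrightarrow> g x"
    using conv
  proof eventually_elim
    case (elim x)
    then have l: "(\<lambda>i. c i x) \<longlonglongrightarrow> lim (\<lambda>i. c i x)" by (simp add: convergent_LIMSEQ_iff)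
    have "\<bar>lim (\<lambda>i. c i x)\<bar> \<le> B x" by (rule LIMSEQ_le_const2[OF tendsto_rabs[OF l]]) (use cB in auto)
    then have "g x = lim (\<lambda>i. c i x)" by (auto simp: g_def)
    with l show ?case by simp
  qed
  show thesis
  proof (rule that)
    show "g \<in> borel_measurable M" by measurable
    show "\<bar>g x\<bar> \<le> C * indicator S x" for x using B0[of x] by (auto simp: g_def B_def[symmetric])
    fix w l W assume w[measurable]: "w \<in> borel_measurable M" and W: "\<And>x. \<bar>w x\<bar> \<le> W"
      and lim: "(\<lambda>j. LINT x|M. D j x * w x) \<longlonglongrightarrow> l"
    have l1: "(\<lambda>i. LINT x|M. c i x * w x) \<longlonglongrightarrow> (LINT x|M. g x * w x)"
    proof (rule integral_dominated_convergence)
      show "integrable M (\<lambda>x. C * W * indicator S x)" by (rule iS)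
      show "AE x in M. (\<lambda>i. c i x * w x) \<longlonglongrightarrow> g x * w x" using gl by eventually_elim (intro tendsto_intros)
      show "AE x in M. norm (c i x * w x) \<le> C * W * indicator S x" for i
      proof (rule AE_I2)
        fix x
        have "\<bar>c i x\<bar> * \<bar>w x\<bar> \<le> (C * indicator S x) * W"
          by (intro mult_mono Hb[OF c(1)] W) (use C in auto)
        then show "norm (c i x * w x) \<le> C * W * indicator S x" by (simp add: abs_mult ac_simps)
      qed
    qed measurable
    \<comment> \<open>Midpoints of numbers within \<open>\<epsilon>\<close> of \<open>l\<close> stay
      within \<open>\<epsilon>\<close>, so the limit of the pairings passes to the hull of a
      tail.\<close>
    have hull: "\<bar>(LINT x|M. f x * w x) - l\<bar> \<le> \<epsilon>"
      if f: "f \<in> H n" and n: "\<And>j. n \<le> j \<Longrightarrow> \<bar>(LINT x|M. D j x * w x) - l\<bar> \<le> \<epsilon>" for f n \<epsilon>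
      using f unfolding H_def
    proof (induction)
      case (base j) then show ?case by (rule n)
    next
      case (mid f g)
      have i: "integrable M (\<lambda>x. h x * w x)" if "h \<in> midpoint_hull D n" for h
      proof (rule integrable_mult_bounded[where C=W])
        show "integrable M h" using that Hm[of h n] Hb[of h n] by (intro int[of _ C]) (auto simp: H_def)
      qed (use W in auto)
      have "(LINT x|M. (f x + g x) / 2 * w x) = (LINT x|M. (f x * w x + g x * w x) / 2)"
        by (intro Bochner_Integration.integral_cong) (auto simp: algebra_simps)
      also have "\<dots> = ((LINT x|M. f x * w x) + (LINT x|M. g x * w x)) / 2"
        using i[OF mid.hyps(1)] i[OF mid.hyps(2)] by simp
      finally have e: "(LINT x|M. (f x + g x) / 2 * w x) = ((LINT x|M. f x * w x) + (LINT x|M. g x * w x)) / 2" .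
      have avg: "\<bar>(a + b) / 2 - l\<bar> \<le> \<epsilon>" if "\<bar>a - l\<bar> \<le> \<epsilon>" "\<bar>b - l\<bar> \<le> \<epsilon>" for a b :: real
        using that by (simp add: abs_le_iff field_simps)
      show ?case unfolding e by (rule avg[OF mid.IH])
    qed
    have l2: "(\<lambda>i. LINT x|M. c i x * w x) \<longlonglongrightarrow> l"
    proof (rule LIMSEQ_I)
      fix \<epsilon> :: real assume "\<epsilon> > 0"
      with LIMSEQ_D[OF lim, of "\<epsilon> / 2"] obtain n where n: "\<And>j. n \<le> j \<Longrightarrow> \<bar>(LINT x|M. D j x * w x) - l\<bar> < \<epsilon> / 2"
        by auto
      show "\<exists>n. \<forall>i\<ge>n. norm ((LINT x|M. c i x * w x) - l) < \<epsilon>"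
      proof (intro exI allI impI)
        fix i assume "n \<le> i"
        then have "c i \<in> H n" using c(1)[of i] Hanti[of n "\<mu> i"] \<mu>(1)[of i] by auto
        from hull[OF this, of "\<epsilon> / 2"] n \<open>\<epsilon> > 0\<close> show "norm ((LINT x|M. c i x * w x) - l) < \<epsilon>"
          by (force intro: less_imp_le)
      qed
    qed
    show "(LINT x|M. g x * w x) = l" by (rule LIMSEQ_unique[OF l1 l2])
  qed
qed

context direction_weight
begin

text \<open>The weighted difference quotients are uniformly bounded and live on a fixed ball, so
  \<open>bounded_weak_limit\<close> applies; discrete integration by parts shows that the limit is
  the weak derivative. Pointwise differentiability never enters.\<close>

lemma lipschitz_has_weak_partial:
  assumes L: "L-lipschitz_on UNIV \<psi>" and cs: "compact (closure {x. \<psi> x \<noteq> 0})"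
  obtains g C where "borel_weak_partial UNIV k b \<psi> g" "\<And>x. \<bar>g x\<bar> \<le> C"
proof -
  let ?e = "axis k 1 :: real^'n"
  obtain \<rho> where \<rho>: "\<And>x. x \<in> closure {x. \<psi> x \<noteq> 0} \<Longrightarrow> norm x \<le> \<rho>"
    using compact_imp_bounded[OF cs] by (auto simp: bounded_iff)
  have out: "\<psi> x = 0" if "norm x > \<rho>" for x
    using \<rho>[of x] that closure_subset[of "{x. \<psi> x \<noteq> 0}"] by fastforce
  \<comment> \<open>The steps have length at most 1, so all difference quotients vanish outside this
    enlarged ball.\<close>
  define S where "S = cball (0::real^'n) (\<rho> + 1)"
  obtain B where B: "B > 0" "\<And>x. x \<in> S \<Longrightarrow> \<bar>b x\<bar> \<le> B"
    using bounded_on_compact[of S] by (auto simp: S_def)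
  have L0: "0 \<le> L" using L by (rule lipschitz_on_nonneg)
  have lip: "\<bar>\<psi> x - \<psi> y\<bar> \<le> L * norm (x - y)" for x y
    using lipschitz_onD[OF L, of x y] by (simp add: dist_norm)
  have contp: "continuous_on UNIV \<psi>" using L by (rule lipschitz_on_continuous_on)
  have [measurable]: "\<psi> \<in> borel_measurable borel" by (intro borel_measurable_continuous_onI contp)
  have iS: "integrable lborel (\<lambda>x. c * indicator S x :: real)" for c
    using emeasure_lborel_cbox_finite emeasure_bounded_finite[of S] by (auto simp: S_def)
  have i\<psi>: "integrable lborel \<psi>"
  proof -
    have "compact (\<psi> ` S)" unfolding S_def
      using contp by (intro compact_continuous_image) (auto intro: continuous_on_subset)
    then obtain W where W: "\<And>y. y \<in> \<psi> ` S \<Longrightarrow> norm y \<le> W" by (meson compact_imp_bounded bounded_iff)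
    have "\<bar>\<psi> x\<bar> \<le> W * indicator S x" for x
      using W[of "\<psi> x"] out[of x] by (cases "x \<in> S") (auto simp: S_def)
    then show ?thesis by (intro Bochner_Integration.integrable_bound[OF iS[of W]]) (auto intro!: AE_I2 order_trans[OF _ abs_ge_self])
  qed
  define t where "t j = inverse (real (Suc j))" for j
  have t: "t j > 0" "t j \<le> 1" "t j \<noteq> 0" for j by (auto simp: t_def divide_simps)
  have t0: "t \<longlonglongrightarrow> 0" unfolding t_def by (rule LIMSEQ_inverse_real_of_nat)
  define D where "D j x = b x * (\<psi> (x + t j *\<^sub>R ?e) - \<psi> x) / t j" for j x
  have [measurable]: "D j \<in> borel_measurable lborel" for j by (simp add: D_def[abs_def])
  have Db: "\<bar>D j x\<bar> \<le> (B * L) * indicator S x" for j x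
  proof (cases "x \<in> S")
    case True
    have "\<bar>\<psi> (x + t j *\<^sub>R ?e) - \<psi> x\<bar> \<le> L * t j" using lip[of "x + t j *\<^sub>R ?e" x] t[of j] by simp
    then have "\<bar>b x\<bar> * \<bar>\<psi> (x + t j *\<^sub>R ?e) - \<psi> x\<bar> \<le> B * (L * t j)"
      using B True by (intro mult_mono) auto
    then show ?thesis using True t[of j] by (simp add: D_def abs_mult divide_le_eq mult.assoc)
  next
    case False
    then have n: "norm x > \<rho> + 1" by (simp add: S_def)
    have "norm x \<le> norm (x + t j *\<^sub>R ?e) + norm (t j *\<^sub>R ?e)" by (metis add_diff_cancel norm_triangle_ineq4)
    then have "norm (x + t j *\<^sub>R ?e) > \<rho>" using n t[of j] by simp
    with n False show ?thesis by (simp add: D_def out)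
  qed
  have "0 \<le> B * L" using B L0 by simp
  obtain g where g: "g \<in> borel_measurable lborel" "\<And>x. \<bar>g x\<bar> \<le> (B * L) * indicator S x"
    "\<And>w l W. w \<in> borel_measurable lborel \<Longrightarrow> (\<And>x. \<bar>w x\<bar> \<le> W) \<Longrightarrow> (\<lambda>j. LINT x|lborel. D j x * w x) \<longlonglongrightarrow> l \<Longrightarrow>
       (LINT x|lborel. g x * w x) = l"
  proof (rule bounded_weak_limit[of D lborel "B * L" S, OF _ Db])
    show "emeasure lborel S < \<infinity>" using emeasure_bounded_finite[of S] by (simp add: S_def)
  qed (auto simp: S_def \<open>0 \<le> B * L\<close>)
  have ig: "integrable lborel g"
    using g(2) by (intro Bochner_Integration.integrable_bound[OF iS[of "B * L"] g(1)]) (auto intro!: AE_I2 order_trans[OF _ abs_ge_self])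
  show thesis
  proof (rule that)
    show "\<bar>g x\<bar> \<le> B * L" for x using g(2)[of x] \<open>0 \<le> B * L\<close> by (cases "x \<in> S") auto
    show "borel_weak_partial UNIV k b \<psi> g"
      unfolding borel_weak_partial_def
    proof (intro conjI ballI ig i\<psi>)
      fix q :: "real^'n \<Rightarrow> real" assume q: "q \<in> test_functions UNIV"
      obtain W where W: "\<And>x. \<bar>q x\<bar> \<le> W" using test_bounded[OF q] by metis
      have [measurable]: "q \<in> borel_measurable borel" using test_measurable[OF q] .
      have "(\<lambda>j. LINT x|lborel. \<psi> x * (b x * ((q (x + (- t j) *\<^sub>R ?e) - q x) / (- t j))))
         \<longlonglongrightarrow> (LINT x|lborel. \<psi> x * (b x * partial_deriv k q x))"
      proof (rule difference_quotient_limit[OF q i\<psi>])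
        show "(\<lambda>j. - t j) \<longlonglongrightarrow> 0" using tendsto_minus[OF t0] by simp
      qed (use t in auto)
      from tendsto_minus[OF this]
      have "(\<lambda>j. - (LINT x|lborel. \<psi> x * (b x * ((q (x + (- t j) *\<^sub>R ?e) - q x) / (- t j)))))
         \<longlonglongrightarrow> - (LINT x|lborel. \<psi> x * (b x * partial_deriv k q x))" .
      moreover have "- (LINT x|lborel. \<psi> x * (b x * ((q (x + (- t j) *\<^sub>R ?e) - q x) / (- t j)))) =
         (LINT x|lborel. D j x * q x)" for j
        using shifted_difference_integral(1)[OF q i\<psi>, of "t j"] by (simp add: D_def)
      ultimately have "(\<lambda>j. LINT x|lborel. D j x * q x) \<longlonglongrightarrow> - (LINT x|lborel. \<psi> x * (b x * partial_deriv k q x))"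
        by simp
      from g(3)[OF _ W this]
      show "(LINT x|lborel. g x * q x) = - (LINT x|lborel. \<psi> x * (b x * partial_deriv k q x))" by simp
    qed
  qed
qed

end

section \<open>Degenerate Sobolev spaces\<close>

lemma AE_lebesgue_on_iff:
  assumes "\<Omega> \<in> sets borel"
  shows "(AE x in lebesgue_on \<Omega>. P x) \<longleftrightarrow> (AE x in lborel. x \<in> \<Omega> \<longrightarrow> P x)"
  using assms by (subst AE_restrict_space_iff) (auto simp: AE_completion_iff)

lemma
  fixes h :: "'a::euclidean_space \<Rightarrow> real"
  assumes h[measurable]: "h \<in> borel_measurable borel" and [measurable]: "\<Omega> \<in> sets borel"
  shows integral_lebesgue_on_borel: "(LINT x|lebesgue_on \<Omega>. h x) = (LINT x|lborel. indicator \<Omega> x * h x)"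
    and integrable_lebesgue_on_borel: "integrable (lebesgue_on \<Omega>) h \<longleftrightarrow> integrable lborel (\<lambda>x. indicator \<Omega> x * h x)"
proof -
  have m: "(\<lambda>x. indicator \<Omega> x *\<^sub>R h x) \<in> borel_measurable lborel" by measurable
  show "(LINT x|lebesgue_on \<Omega>. h x) = (LINT x|lborel. indicator \<Omega> x * h x)"
    using integral_completion[OF m] by (subst integral_restrict_space) auto
  show "integrable (lebesgue_on \<Omega>) h \<longleftrightarrow> integrable lborel (\<lambda>x. indicator \<Omega> x * h x)"
    using integrable_completion[OF m] by (subst integrable_restrict_space) auto
qed

text \<open>Completeness of Lebesgue measure. It makes the Hilbert choice \<open>A_gradient\<close>
  measurable, which is known only up to null sets.\<close>

lemma lebesgue_on_measurable_AE:
  fixes v v' :: "'a::euclidean_space \<Rightarrow> 'b::euclidean_space"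
  assumes \<Omega>: "\<Omega> \<in> sets borel" and v: "v \<in> borel_measurable (lebesgue_on \<Omega>)"
    and eq: "AE x in lebesgue_on \<Omega>. v x = v' x"
  shows "v' \<in> borel_measurable (lebesgue_on \<Omega>)"
proof -
  have \<Omega>': "\<Omega> \<in> sets lebesgue" using \<Omega> by simp
  have "AE x in lebesgue. (if x \<in> \<Omega> then v x else 0) = (if x \<in> \<Omega> then v' x else 0)"
    using eq \<Omega>' by (subst (asm) AE_restrict_space_iff) (auto elim!: eventually_mono)
  from borel_measurable_AE[OF _ this] show ?thesis
    using v \<Omega>' borel_measurable_if by blast
qed

lemma lebesgue_on_borel_measurable:
  assumes "h \<in> borel_measurable borel"
  shows "h \<in> borel_measurable (lebesgue_on \<Omega>)"
  using assms by (intro measurable_restrict_space1 measurable_completion) simp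

lemma lebesgue_on_borel_representative:
  fixes v :: "'a::euclidean_space \<Rightarrow> real"
  assumes \<Omega>: "\<Omega> \<in> sets borel" and v: "v \<in> borel_measurable (lebesgue_on \<Omega>)"
  obtains v' where "v' \<in> borel_measurable borel" "AE x in lebesgue_on \<Omega>. v x = v' x" "\<And>x. x \<notin> \<Omega> \<Longrightarrow> v' x = 0"
proof -
  have "(\<lambda>x. if x \<in> \<Omega> then v x else 0) \<in> borel_measurable lebesgue"
    using v \<Omega> by (intro borel_measurable_if_I) auto
  from completion_ex_borel_measurable_real[OF this] obtain w where
    w: "w \<in> borel_measurable borel" "AE x in lborel. (if x \<in> \<Omega> then v x else 0) = w x" by auto
  show thesis
  proof (rule that)
    show "(\<lambda>x. indicator \<Omega> x * w x) \<in> borel_measurable borel" using w(1) \<Omega> by simp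
    show "AE x in lebesgue_on \<Omega>. v x = indicator \<Omega> x * w x"
      unfolding AE_lebesgue_on_iff[OF \<Omega>] using w(2) by eventually_elim auto
  qed auto
qed

section \<open>Calculus of the degenerate gradient\<close>

locale degenerate_setting =
  fixes i1 iN :: "'n::finite" and f :: "real \<Rightarrow> real"
  assumes i1_iN: "i1 \<noteq> iN" and f_cont: "continuous_on UNIV f" and f_nz: "\<And>t. t \<noteq> 0 \<Longrightarrow> f t \<noteq> 0"
begin

abbreviation B :: "'n \<Rightarrow> real^'n \<Rightarrow> real" where
  "B k x \<equiv> degeneracy_B i1 iN f x $ k $ k"

lemma B_eq: "B k x = (if k = iN then f (x $ i1) else 1)"
  by (simp add: degeneracy_B_def diag_last_def)

lemma AE_first_coordinate_nz: "AE x in lborel. (x::real^'n) $ i1 \<noteq> 0"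
proof -
  have "{x::real^'n. x $ i1 = 0} \<in> null_sets lebesgue"
    using negligible_standard_hyperplane_cart[of i1] negligible_iff_null_sets by blast
  from AE_not_in[OF this] show ?thesis by (simp add: AE_completion_iff)
qed

sublocale direction_weight k "B k" for k
proof
  show "continuous_on UNIV (B k)"
  proof -
    have "(\<lambda>x. f (x $ i1)) = f \<circ> (\<lambda>x::real^'n. x $ i1)" by auto
    moreover have "continuous_on UNIV (f \<circ> (\<lambda>x::real^'n. x $ i1))"
      by (intro continuous_on_compose continuous_intros continuous_on_subset[OF f_cont]) auto
    ultimately show ?thesis by (cases "k = iN") (simp_all add: B_eq)
  qed
  show "B k (x + s *\<^sub>R axis k 1) = B k x" for x s
    using i1_iN by (auto simp: B_eq axis_def)
  show "AE x in lborel. B k x \<noteq> 0"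
    using AE_first_coordinate_nz by eventually_elim (auto simp: B_eq f_nz)
qed

text \<open>Integrability on all of \<open>\<Omega>\<close>, not just on compact subsets, permits
  integrable extensions by zero to the whole space.\<close>

definition wgrad :: "(real^'n) set \<Rightarrow> (real^'n \<Rightarrow> real) \<Rightarrow> (real^'n \<Rightarrow> real^'n) \<Rightarrow> bool" where
  "wgrad \<Omega> v g \<longleftrightarrow> integrable (lebesgue_on \<Omega>) v \<and> integrable (lebesgue_on \<Omega>) g \<and>
     has_weak_A_gradient i1 iN f \<Omega> v g"

lemma weak_partial_integrals:
  assumes \<Omega>: "open \<Omega>" and \<psi>: "\<psi> \<in> test_functions \<Omega>"
    and v: "v' \<in> borel_measurable borel" "AE x in lebesgue_on \<Omega>. v x = v' x" "v \<in> borel_measurable (lebesgue_on \<Omega>)"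
  shows "(LINT x|lebesgue_on \<Omega>. v x * \<psi> x) = (LINT x|lborel. v' x * \<psi> x)"
    and "(LINT x|lebesgue_on \<Omega>. v x * (B k x * partial_deriv k \<psi> x)) = (LINT x|lborel. v' x * (B k x * partial_deriv k \<psi> x))"
proof -
  have \<Omega>'[measurable]: "\<Omega> \<in> sets borel" using \<Omega> by simp
  note [measurable] = v(1) test_measurable[OF \<psi>] test_measurable[OF test_partial[OF \<psi>]]
  obtain S where S: "S \<subseteq> \<Omega>" "\<And>x. x \<notin> S \<Longrightarrow> \<psi> x = 0" "\<And>x k. x \<notin> S \<Longrightarrow> partial_deriv k \<psi> x = 0"
    by (rule test_support[OF \<psi>]) blast
  have *: "(LINT x|lebesgue_on \<Omega>. v x * q x) = (LINT x|lborel. v' x * q x)"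
    if [measurable]: "q \<in> borel_measurable borel" and q: "\<And>x. x \<notin> S \<Longrightarrow> q x = 0" for q :: "real^'n \<Rightarrow> real"
  proof -
    have "(LINT x|lebesgue_on \<Omega>. v x * q x) = (LINT x|lebesgue_on \<Omega>. v' x * q x)"
    proof (rule integral_cong_AE)
      show "AE x in lebesgue_on \<Omega>. v x * q x = v' x * q x" using v(2) by eventually_elim auto
    qed (intro borel_measurable_times lebesgue_on_borel_measurable that v)+
    also have "\<dots> = (LINT x|lborel. indicator \<Omega> x * (v' x * q x))"
      by (rule integral_lebesgue_on_borel) auto
    also have "\<dots> = (LINT x|lborel. v' x * q x)"
      using S(1) q by (intro Bochner_Integration.integral_cong) (auto simp: indicator_def)
    finally show ?thesis .
  qed
  show "(LINT x|lebesgue_on \<Omega>. v x * \<psi> x) = (LINT x|lborel. v' x * \<psi> x)" by (rule *) (auto simp: S)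
  show "(LINT x|lebesgue_on \<Omega>. v x * (B k x * partial_deriv k \<psi> x)) = (LINT x|lborel. v' x * (B k x * partial_deriv k \<psi> x))"
    by (rule *) (auto simp: S)
qed

lemma integrable_vec_iff:
  fixes g :: "'a \<Rightarrow> real^'n"
  shows "integrable M g \<longleftrightarrow> (\<forall>k. integrable M (\<lambda>x. g x $ k))"
proof
  assume "integrable M g"
  then show "\<forall>k. integrable M (\<lambda>x. g x $ k)"
    by (intro allI integrable_bounded_linear[OF bounded_linear_vec_nth])
next
  assume *: "\<forall>k. integrable M (\<lambda>x. g x $ k)"
  have "g = (\<lambda>x. \<Sum>k\<in>UNIV. g x $ k *\<^sub>R axis k 1)"
    by (auto simp: fun_eq_iff vec_eq_iff axis_def if_distrib cong: if_cong)
  moreover have "integrable M (\<lambda>x. \<Sum>k\<in>UNIV. g x $ k *\<^sub>R (axis k 1 :: real^'n))"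
    using * by (intro Bochner_Integration.integrable_sum integrable_scaleR_left) auto
  ultimately show "integrable M g" by simp
qed

lemma compact_set_integrable:
  fixes v :: "real^'n \<Rightarrow> 'b::{banach,second_countable_topology}"
  assumes \<Omega>: "open \<Omega>" and v: "integrable (lebesgue_on \<Omega>) v" and K: "compact K" "K \<subseteq> \<Omega>"
  shows "set_integrable lebesgue K v"
proof -
  have "integrable lebesgue (\<lambda>x. indicator \<Omega> x *\<^sub>R v x)"
    using v \<Omega> by (subst (asm) integrable_restrict_space) auto
  from integrable_mult_indicator[OF _ this, of K]
  have "integrable lebesgue (\<lambda>x. indicator K x *\<^sub>R indicator \<Omega> x *\<^sub>R v x)"
    using K(1) by (auto simp: compact_imp_closed)
  also have "(\<lambda>x. indicator K x *\<^sub>R indicator \<Omega> x *\<^sub>R v x) = (\<lambda>x. indicator K x *\<^sub>R v x)"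
    using K(2) by (auto simp: fun_eq_iff indicator_def)
  finally show ?thesis by (simp add: set_integrable_def)
qed

lemma wgradI:
  assumes \<Omega>: "open \<Omega>" and wp: "\<And>k. borel_weak_partial \<Omega> k (B k) v' (g' k)"
    and v: "AE x in lebesgue_on \<Omega>. v x = v' x" and g: "\<And>k. AE x in lebesgue_on \<Omega>. g x $ k = g' k x"
  shows "wgrad \<Omega> v g"
proof -
  have \<Omega>'[measurable]: "\<Omega> \<in> sets borel" using \<Omega> by simp
  have i: "integrable lborel v'" "integrable lborel (g' k)" for k
    using wp by (auto simp: borel_weak_partial_def)
  then have m[measurable]: "v' \<in> borel_measurable borel" "g' k \<in> borel_measurable borel" for k
    using borel_measurable_integrable by (metis measurable_lborel2)+
  have *: "w \<in> borel_measurable (lebesgue_on \<Omega>) \<and> integrable (lebesgue_on \<Omega>) w"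
    if "integrable lborel w'" "AE x in lebesgue_on \<Omega>. w x = w' x" for w w' :: "real^'n \<Rightarrow> real"
  proof -
    have [measurable]: "w' \<in> borel_measurable borel" using borel_measurable_integrable[OF that(1)] by simp
    have m: "w \<in> borel_measurable (lebesgue_on \<Omega>)"
    proof (rule lebesgue_on_measurable_AE[OF \<Omega>'])
      show "w' \<in> borel_measurable (lebesgue_on \<Omega>)" by (rule lebesgue_on_borel_measurable) fact
      show "AE x in lebesgue_on \<Omega>. w' x = w x" using that(2) by eventually_elim simp
    qed
    have "integrable (lebesgue_on \<Omega>) w'"
      using integrable_mult_indicator[OF _ that(1), of \<Omega>] by (subst integrable_lebesgue_on_borel) auto
    then have "integrable (lebesgue_on \<Omega>) w"
      using integrable_cong_AE[OF m lebesgue_on_borel_measurable that(2)] by simp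
    with m show ?thesis by simp
  qed
  note vi = *[OF i(1) v] and gi = *[OF i(2) g]
  have ig: "integrable (lebesgue_on \<Omega>) g" using gi by (simp add: integrable_vec_iff)
  have "has_weak_A_gradient i1 iN f \<Omega> v g"
    unfolding has_weak_A_gradient_def
  proof (intro conjI allI impI ballI)
    fix K assume "compact K \<and> K \<subseteq> \<Omega>"
    then show "set_integrable lebesgue K v" "set_integrable lebesgue K g"
      using compact_set_integrable[OF \<Omega>] vi ig by auto
  next
    fix \<psi> k assume \<psi>: "\<psi> \<in> test_functions \<Omega>"
    show "(LINT x|lebesgue_on \<Omega>. g x $ k * \<psi> x) = - (LINT x|lebesgue_on \<Omega>. v x * (B k x * partial_deriv k \<psi> x))"
      using weak_partial_integrals(1)[OF \<Omega> \<psi> m(2) g, of k] weak_partial_integrals(2)[OF \<Omega> \<psi> m(1) v, of k]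
        gi vi wp[of k] \<psi> by (auto simp: borel_weak_partial_def)
  qed
  with vi ig show ?thesis by (simp add: wgrad_def)
qed

text \<open>With \<open>wgradI\<close> this is the bridge to the Borel calculus: pass to
  representatives, argue there, return. The extension by zero may jump at the boundary, which is
  harmless as long as only test functions supported in \<open>\<Omega>\<close> are used.\<close>

lemma wgradE:
  assumes \<Omega>: "open \<Omega>" and w: "wgrad \<Omega> v g"
  obtains v' g' where "\<And>k. borel_weak_partial \<Omega> k (B k) v' (g' k)"
    "AE x in lebesgue_on \<Omega>. v x = v' x" "\<And>k. AE x in lebesgue_on \<Omega>. g x $ k = g' k x"
    "\<And>x. x \<notin> \<Omega> \<Longrightarrow> v' x = 0" "\<And>k x. x \<notin> \<Omega> \<Longrightarrow> g' k x = 0"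
proof -
  have \<Omega>'[measurable]: "\<Omega> \<in> sets borel" using \<Omega> by simp
  have rep: "\<exists>w'. integrable lborel w' \<and> w' \<in> borel_measurable borel \<and> (AE x in lebesgue_on \<Omega>. w x = w' x) \<and> (\<forall>x. x \<notin> \<Omega> \<longrightarrow> w' x = 0)"
    if iw: "integrable (lebesgue_on \<Omega>) w" for w :: "real^'n \<Rightarrow> real"
  proof -
    obtain w' where w': "w' \<in> borel_measurable borel" "AE x in lebesgue_on \<Omega>. w x = w' x" "\<And>x. x \<notin> \<Omega> \<Longrightarrow> w' x = 0"
      using lebesgue_on_borel_representative[OF \<Omega>' borel_measurable_integrable[OF iw]] by metis
    have "integrable (lebesgue_on \<Omega>) w'"
      using integrable_cong_AE[OF borel_measurable_integrable[OF iw] lebesgue_on_borel_measurable[OF w'(1)] w'(2)] iw by simp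
    then have "integrable lborel (\<lambda>x. indicator \<Omega> x * w' x)"
      using integrable_lebesgue_on_borel[OF w'(1) \<Omega>'] by simp
    moreover have "(\<lambda>x. indicator \<Omega> x * w' x) = w'" using w'(3) by (auto simp: fun_eq_iff indicator_def)
    ultimately show ?thesis using w' by auto
  qed
  have iv: "integrable (lebesgue_on \<Omega>) v" and ig: "\<And>k. integrable (lebesgue_on \<Omega>) (\<lambda>x. g x $ k)"
    and hw: "has_weak_A_gradient i1 iN f \<Omega> v g"
    using w by (auto simp: wgrad_def integrable_vec_iff)
  obtain v' where v': "integrable lborel v'" "v' \<in> borel_measurable borel" "AE x in lebesgue_on \<Omega>. v x = v' x"
    "\<And>x. x \<notin> \<Omega> \<Longrightarrow> v' x = 0" using rep[OF iv] by metis
  have "\<forall>k. \<exists>w'. integrable lborel w' \<and> w' \<in> borel_measurable borel \<and> (AE x in lebesgue_on \<Omega>. g x $ k = w' x) \<and> (\<forall>x. x \<notin> \<Omega> \<longrightarrow> w' x = 0)"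
    using rep[OF ig] by blast
  then obtain g' where g': "\<And>k. integrable lborel (g' k)" "\<And>k. g' k \<in> borel_measurable borel"
    "\<And>k. AE x in lebesgue_on \<Omega>. g x $ k = g' k x" "\<And>k x. x \<notin> \<Omega> \<Longrightarrow> g' k x = 0" by metis
  show thesis
  proof (rule that[OF _ v'(3) g'(3) v'(4) g'(4)])
    show "borel_weak_partial \<Omega> k (B k) v' (g' k)" for k
      unfolding borel_weak_partial_def
    proof (intro conjI ballI v' g')
      fix \<psi> :: "real^'n \<Rightarrow> real" assume \<psi>: "\<psi> \<in> test_functions \<Omega>"
      show "(LINT x|lborel. g' k x * \<psi> x) = - (LINT x|lborel. v' x * (B k x * partial_deriv k \<psi> x))"
        using weak_partial_integrals(1)[OF \<Omega> \<psi> g'(2,3)] weak_partial_integrals(2)[OF \<Omega> \<psi> v'(2,3)]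
          borel_measurable_integrable[OF iv] borel_measurable_integrable[OF ig] hw \<psi>
        by (auto simp: has_weak_A_gradient_def)
    qed
  qed auto
qed

text \<open>Both gradients are only assumed locally integrable, because nothing more is known about an
  \<open>A_gradient\<close> before uniqueness is available.\<close>

lemma has_weak_A_gradient_unique:
  assumes \<Omega>: "open \<Omega>" and 1: "has_weak_A_gradient i1 iN f \<Omega> v g1" and 2: "has_weak_A_gradient i1 iN f \<Omega> v g2"
  shows "AE x in lebesgue_on \<Omega>. g1 x = g2 x"
proof -
  have \<Omega>'[measurable]: "\<Omega> \<in> sets borel" using \<Omega> by simp
  have box: "AE x in lborel. x \<in> box a c \<longrightarrow> g1 x $ k = g2 x $ k" if sub: "cbox a c \<subseteq> \<Omega>" for a c k
  proof -
    have ik: "integrable lebesgue (\<lambda>x. indicator (cbox a c) x * g x $ k)"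
      if "has_weak_A_gradient i1 iN f \<Omega> v g" for g
    proof -
      have "set_integrable lebesgue (cbox a c) g"
        using that sub by (auto simp: has_weak_A_gradient_def)
      then have "integrable lebesgue (\<lambda>x. indicator (cbox a c) x *\<^sub>R g x)" by (simp add: set_integrable_def)
      then show ?thesis by (simp add: integrable_vec_iff)
    qed
    have red: "(LINT x|lebesgue_on \<Omega>. g x $ k * \<psi> x) = (LINT x|lebesgue. (indicator (cbox a c) x * g x $ k) * \<psi> x)"
      if \<psi>: "\<psi> \<in> test_functions (box a c)" for \<psi> and g :: "real^'n \<Rightarrow> real^'n"
    proof -
      obtain S where S: "S \<subseteq> box a c" "\<And>x. x \<notin> S \<Longrightarrow> \<psi> x = 0" by (rule test_support[OF \<psi>]) blast
      have "(LINT x|lebesgue_on \<Omega>. g x $ k * \<psi> x) = (LINT x|lebesgue. indicator \<Omega> x *\<^sub>R (g x $ k * \<psi> x))"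
        using \<Omega> by (subst integral_restrict_space) auto
      also have "\<dots> = (LINT x|lebesgue. (indicator (cbox a c) x * g x $ k) * \<psi> x)"
        using S sub box_subset_cbox[of a c]
        by (intro Bochner_Integration.integral_cong) (auto simp: indicator_def)
      finally show ?thesis .
    qed
    let ?h = "\<lambda>x. indicator (cbox a c) x * g1 x $ k - indicator (cbox a c) x * g2 x $ k"
    have ih: "integrable lebesgue ?h" using ik[OF 1] ik[OF 2] by simp
    obtain h where h: "h \<in> borel_measurable lborel" "AE x in lborel. ?h x = h x"
      using completion_ex_borel_measurable_real[OF borel_measurable_integrable[OF ih]] by auto
    have hl: "AE x in lebesgue. ?h x = h x" using h(2) by (simp add: AE_completion_iff)
    have hm: "h \<in> borel_measurable lebesgue" using h(1) by (rule measurable_completion)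
    have "integrable lebesgue h"
      using integrable_cong_AE[OF borel_measurable_integrable[OF ih] hm hl] ih by simp
    then have hi: "integrable lborel h" using integrable_completion[OF h(1)] by simp
    have "AE x in lborel. x \<in> box a c \<longrightarrow> h x = 0"
    proof (rule AE_zero_if_test_integrals_zero)
      show "h \<in> borel_measurable borel" using h(1) by simp
      show "integrable lborel (\<lambda>x. indicator (cbox a' c') x * h x)" for a' c'
        using integrable_mult_indicator[OF _ hi, of "cbox a' c'"] by simp
      fix \<psi> :: "real^'n \<Rightarrow> real" assume \<psi>: "\<psi> \<in> test_functions (box a c)"
      have \<psi>\<Omega>: "\<psi> \<in> test_functions \<Omega>"
        using \<psi> test_functions_mono sub box_subset_cbox by (metis subset_iff)
      obtain C where C: "\<And>x. \<bar>\<psi> x\<bar> \<le> C" using test_bounded[OF \<psi>] by metis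
      have m\<psi>: "\<psi> \<in> borel_measurable lebesgue" using test_measurable[OF \<psi>] by (intro measurable_completion) simp
      have i: "integrable lebesgue (\<lambda>x. (indicator (cbox a c) x * g x $ k) * \<psi> x)"
        if "has_weak_A_gradient i1 iN f \<Omega> v g" for g
        using integrable_mult_bounded[OF ik[OF that] m\<psi> C] .
      have "(LINT x|lborel. h x * \<psi> x) = (LINT x|lebesgue. h x * \<psi> x)"
        using integral_completion[of "\<lambda>x. h x * \<psi> x" lborel] h(1) test_measurable[OF \<psi>] by simp
      also have "\<dots> = (LINT x|lebesgue. ?h x * \<psi> x)"
        by (rule integral_cong_AE) (use hl hm m\<psi> borel_measurable_integrable[OF ih] in \<open>auto elim!: eventually_mono\<close>)
      also have "\<dots> = (LINT x|lebesgue. (indicator (cbox a c) x * g1 x $ k) * \<psi> x - (indicator (cbox a c) x * g2 x $ k) * \<psi> x)"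
        by (simp add: left_diff_distrib)
      also have "\<dots> = (LINT x|lebesgue_on \<Omega>. g1 x $ k * \<psi> x) - (LINT x|lebesgue_on \<Omega>. g2 x $ k * \<psi> x)"
        using i[OF 1] i[OF 2] red[OF \<psi>] by simp
      also have "\<dots> = 0" using 1 2 \<psi>\<Omega> by (auto simp: has_weak_A_gradient_def)
      finally show "(LINT x|lborel. h x * \<psi> x) = 0" .
    qed auto
    with h(2) show ?thesis
    proof eventually_elim
      case (elim x)
      then show ?case using box_subset_cbox[of a c] by (auto simp: indicator_def split: if_splits)
    qed
  qed
  have cb: "AE x in lborel. x \<in> cbox a c \<longrightarrow> g1 x = g2 x" if sub: "cbox a c \<subseteq> \<Omega>" for a c
  proof -
    have "AE x in lborel. \<forall>k\<in>UNIV. x \<in> box a c \<longrightarrow> g1 x $ k = g2 x $ k"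
      using box[OF sub] by (intro AE_ball_countable[THEN iffD2] ballI) auto
    moreover have "cbox a c - box a c \<in> null_sets lborel"
      by (simp add: null_sets_def emeasure_Diff[OF _ _ _ box_subset_cbox] emeasure_lborel_box_eq emeasure_lborel_cbox_eq)
    from AE_not_in[OF this] have "AE x in lborel. x \<notin> cbox a c - box a c" .
    ultimately show ?thesis by eventually_elim (auto simp: vec_eq_iff)
  qed
  obtain D where D: "countable D" "D \<subseteq> Pow \<Omega>" "\<And>X. X \<in> D \<Longrightarrow> \<exists>a b. X = cbox a b" "\<Union>D = \<Omega>"
    using open_countable_Union_open_cbox[OF \<Omega>] by metis
  have "AE x in lborel. \<forall>X\<in>D. x \<in> X \<longrightarrow> g1 x = g2 x"
    unfolding AE_ball_countable[OF D(1)] using D(2,3) cb by blast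
  then show ?thesis unfolding AE_lebesgue_on_iff[OF \<Omega>'] using D(4) by (auto elim!: eventually_mono)
qed

lemma A_gradient_eq:
  assumes "open \<Omega>" "wgrad \<Omega> v g"
  shows "AE x in lebesgue_on \<Omega>. A_gradient i1 iN f \<Omega> v x = g x"
proof -
  have g: "has_weak_A_gradient i1 iN f \<Omega> v g" using assms by (simp add: wgrad_def)
  then have "has_weak_A_gradient i1 iN f \<Omega> v (A_gradient i1 iN f \<Omega> v)"
    unfolding A_gradient_def by (rule someI[where P="has_weak_A_gradient i1 iN f \<Omega> v"])
  from has_weak_A_gradient_unique[OF assms(1) this g] show ?thesis .
qed

lemma wgrad_A_gradient:
  assumes "open \<Omega>" "wgrad \<Omega> v g"
  shows "wgrad \<Omega> v (A_gradient i1 iN f \<Omega> v)"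
proof -
  have g: "has_weak_A_gradient i1 iN f \<Omega> v g" "integrable (lebesgue_on \<Omega>) g" "integrable (lebesgue_on \<Omega>) v"
    using assms by (auto simp: wgrad_def)
  then have h: "has_weak_A_gradient i1 iN f \<Omega> v (A_gradient i1 iN f \<Omega> v)"
    unfolding A_gradient_def by (intro someI[where P="has_weak_A_gradient i1 iN f \<Omega> v"])
  have e: "AE x in lebesgue_on \<Omega>. g x = A_gradient i1 iN f \<Omega> v x"
    using A_gradient_eq[OF assms] by eventually_elim simp
  have "A_gradient i1 iN f \<Omega> v \<in> borel_measurable (lebesgue_on \<Omega>)"
    by (rule lebesgue_on_measurable_AE[OF _ _ e]) (use assms g in auto)
  then have "integrable (lebesgue_on \<Omega>) (A_gradient i1 iN f \<Omega> v)"
    using integrable_cong_AE[OF _ _ e] g(2) by (auto dest: borel_measurable_integrable)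
  with g h show ?thesis by (simp add: wgrad_def)
qed

lemma wgrad_diff:
  assumes \<Omega>: "open \<Omega>" and 1: "wgrad \<Omega> v1 g1" and 2: "wgrad \<Omega> v2 g2"
  shows "wgrad \<Omega> (\<lambda>x. v1 x - v2 x) (\<lambda>x. g1 x - g2 x)"
proof -
  obtain a1 b1 where a: "\<And>k. borel_weak_partial \<Omega> k (B k) a1 (b1 k)"
    "AE x in lebesgue_on \<Omega>. v1 x = a1 x" "\<And>k. AE x in lebesgue_on \<Omega>. g1 x $ k = b1 k x"
    by (rule wgradE[OF \<Omega> 1]) blast
  obtain a2 b2 where b: "\<And>k. borel_weak_partial \<Omega> k (B k) a2 (b2 k)"
    "AE x in lebesgue_on \<Omega>. v2 x = a2 x" "\<And>k. AE x in lebesgue_on \<Omega>. g2 x $ k = b2 k x"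
    by (rule wgradE[OF \<Omega> 2]) blast
  show ?thesis
  proof (rule wgradI[OF \<Omega> borel_weak_partial_diff[OF a(1) b(1)]])
    show "AE x in lebesgue_on \<Omega>. v1 x - v2 x = a1 x - a2 x" using a(2) b(2) by eventually_elim simp
    show "AE x in lebesgue_on \<Omega>. (g1 x - g2 x) $ k = b1 k x - b2 k x" for k
      using a(3)[of k] b(3)[of k] by eventually_elim simp
  qed
qed

text \<open>Truncation at level \<open>c\<close> needs \<open>u - c\<close>, but constants are not
  integrable on the whole space and are cut off outside \<open>\<Omega>\<close>, unseen by test
  functions. What remains is that the weighted derivative of a test function has integral 0: its
  difference quotients do, by translation invariance.\<close>

lemma borel_weak_partial_const:
  assumes \<Omega>: "open \<Omega>" "bounded \<Omega>"
  shows "borel_weak_partial \<Omega> k (B k) (\<lambda>x. indicator \<Omega> x * c) (\<lambda>x. 0)"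
  unfolding borel_weak_partial_def
proof (intro conjI ballI)
  have [measurable]: "\<Omega> \<in> sets borel" using \<Omega> by simp
  show "integrable lborel (\<lambda>x. indicator \<Omega> x * c)"
    using emeasure_bounded_finite[OF \<Omega>(2)] by (intro integrable_mult_left integrable_real_indicator) auto
  fix \<psi> :: "real^'n \<Rightarrow> real" assume \<psi>: "\<psi> \<in> test_functions \<Omega>"
  have [measurable]: "\<psi> \<in> borel_measurable borel" using test_measurable[OF \<psi>] .
  obtain S where S: "S \<subseteq> \<Omega>" "\<And>x. x \<notin> S \<Longrightarrow> \<psi> x = 0" "\<And>x k. x \<notin> S \<Longrightarrow> partial_deriv k \<psi> x = 0"
    by (rule test_support[OF \<psi>]) blast
  obtain \<rho> where \<rho>: "\<And>x. x \<in> \<Omega> \<Longrightarrow> norm x \<le> \<rho>" using \<Omega>(2) by (auto simp: bounded_iff)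
  \<comment> \<open>An integrable stand-in for the constant 1: it equals 1 wherever the test
    function or a translate by at most 1 is nonzero.\<close>
  define w where "w x = (indicator (cball 0 (\<rho> + 1)) x :: real)" for x :: "real^'n"
  have w: "integrable lborel w"
    unfolding w_def[abs_def] using emeasure_bounded_finite[of "cball 0 (\<rho> + 1)"] by (intro integrable_real_indicator) auto
  let ?e = "axis k 1 :: real^'n"
  define t where "t j = inverse (real (Suc j))" for j
  have t: "t j > 0" "t j \<le> 1" "t j \<noteq> 0" for j by (auto simp: t_def divide_simps)
  have t0: "t \<longlonglongrightarrow> 0" unfolding t_def by (rule LIMSEQ_inverse_real_of_nat)
  have lim: "(\<lambda>j. LINT x|lborel. w x * (B k x * ((\<psi> (x + t j *\<^sub>R ?e) - \<psi> x) / t j)))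
     \<longlonglongrightarrow> (LINT x|lborel. w x * (B k x * partial_deriv k \<psi> x))"
    by (rule difference_quotient_limit[OF \<psi> w t(3) t0])
  have z: "(LINT x|lborel. w x * (B k x * ((\<psi> (x + t j *\<^sub>R ?e) - \<psi> x) / t j))) = 0" for j
  proof -
    have out: "w x = 1" if "\<psi> x \<noteq> 0 \<or> \<psi> (x + t j *\<^sub>R ?e) \<noteq> 0" for x
    proof -
      have "norm x \<le> \<rho> \<or> norm (x + t j *\<^sub>R ?e) \<le> \<rho>" using that S \<rho> by (metis subset_iff)
      moreover have "norm x \<le> norm (x + t j *\<^sub>R ?e) + norm (t j *\<^sub>R ?e)"
        by (metis add_diff_cancel norm_triangle_ineq4)
      ultimately show ?thesis using t[of j] by (auto simp: w_def)
    qed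
    have i: "integrable lborel (\<lambda>x. B k x * \<psi> x)"
    proof -
      have "(\<lambda>x. B k x * \<psi> x) = (\<lambda>x. w x * (B k x * \<psi> x))" using out by (fastforce simp: fun_eq_iff)
      then show ?thesis using integrable_mult_test(2)[OF \<psi> w] by simp
    qed
    have "(LINT x|lborel. w x * (B k x * ((\<psi> (x + t j *\<^sub>R ?e) - \<psi> x) / t j))) =
       (LINT x|lborel. (B k (x + t j *\<^sub>R ?e) * \<psi> (x + t j *\<^sub>R ?e) - B k x * \<psi> x) / t j)"
    proof (intro Bochner_Integration.integral_cong refl)
      fix x
      show "w x * (B k x * ((\<psi> (x + t j *\<^sub>R ?e) - \<psi> x) / t j)) =
         (B k (x + t j *\<^sub>R ?e) * \<psi> (x + t j *\<^sub>R ?e) - B k x * \<psi> x) / t j"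
      proof (cases "\<psi> x \<noteq> 0 \<or> \<psi> (x + t j *\<^sub>R ?e) \<noteq> 0")
        case True
        then have "w x = 1" by (rule out)
        then show ?thesis by (simp add: inv right_diff_distrib)
      qed simp
    qed
    also have "\<dots> = ((LINT x|lborel. B k (x + t j *\<^sub>R ?e) * \<psi> (x + t j *\<^sub>R ?e)) - (LINT x|lborel. B k x * \<psi> x)) / t j"
      using i integrable_lborel_shift[OF i, of "t j *\<^sub>R ?e"] by simp
    also have "(LINT x|lborel. B k (x + t j *\<^sub>R ?e) * \<psi> (x + t j *\<^sub>R ?e)) = (LINT x|lborel. B k x * \<psi> x)"
      by (rule lborel_integral_shift[where g="\<lambda>x. B k x * \<psi> x"]) measurable
    finally show ?thesis by simp
  qed
  from lim have "(\<lambda>j::nat. 0) \<longlonglongrightarrow> (LINT x|lborel. w x * (B k x * partial_deriv k \<psi> x))" unfolding z .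
  then have 0: "(LINT x|lborel. w x * (B k x * partial_deriv k \<psi> x)) = 0"
    by (rule LIMSEQ_unique) (rule tendsto_const)
  have "(LINT x|lborel. indicator \<Omega> x * c * (B k x * partial_deriv k \<psi> x)) =
     (LINT x|lborel. c * (w x * (B k x * partial_deriv k \<psi> x)))"
  proof (intro Bochner_Integration.integral_cong refl)
    fix x
    show "indicator \<Omega> x * c * (B k x * partial_deriv k \<psi> x) = c * (w x * (B k x * partial_deriv k \<psi> x))"
    proof (cases "x \<in> S")
      case True
      then have "x \<in> \<Omega>" using S by auto
      moreover have "w x = 1" using \<rho>[OF \<open>x \<in> \<Omega>\<close>] by (simp add: w_def)
      ultimately show ?thesis by simp
    qed (simp add: S)
  qed
  then show "(LINT x|lborel. 0 * \<psi> x) = - (LINT x|lborel. indicator \<Omega> x * c * (B k x * partial_deriv k \<psi> x))"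
    using 0 by simp
qed auto

lemma wgrad_pos:
  assumes \<Omega>: "open \<Omega>" "bounded \<Omega>" and w: "wgrad \<Omega> v g"
  shows "wgrad \<Omega> (\<lambda>x. max (v x - c) 0) (\<lambda>x. if v x > c then g x else 0)"
    and "AE x in lebesgue_on \<Omega>. v x = c \<longrightarrow> g x = 0"
proof -
  have \<Omega>'[measurable]: "\<Omega> \<in> sets borel" using \<Omega> by simp
  obtain a b where a: "\<And>k. borel_weak_partial \<Omega> k (B k) a (b k)"
    "AE x in lebesgue_on \<Omega>. v x = a x" "\<And>k. AE x in lebesgue_on \<Omega>. g x $ k = b k x"
    by (rule wgradE[OF \<Omega>(1) w]) blast
  have d: "borel_weak_partial \<Omega> k (B k) (\<lambda>x. a x - indicator \<Omega> x * c) (\<lambda>x. b k x - 0)" for k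
    by (rule borel_weak_partial_diff[OF a(1) borel_weak_partial_const[OF \<Omega>]])
  have in\<Omega>: "AE x in lebesgue_on \<Omega>. x \<in> \<Omega>" by (simp add: AE_lebesgue_on_iff)
  show "wgrad \<Omega> (\<lambda>x. max (v x - c) 0) (\<lambda>x. if v x > c then g x else 0)"
  proof (rule wgradI[OF \<Omega>(1) borel_weak_partial_pos[OF d \<Omega>(1)]])
    show "AE x in lebesgue_on \<Omega>. max (v x - c) 0 = max (a x - indicator \<Omega> x * c) 0"
      using a(2) in\<Omega> by eventually_elim simp
    show "AE x in lebesgue_on \<Omega>. (if c < v x then g x else 0) $ k =
         (if 0 < a x - indicator \<Omega> x * c then b k x - 0 else 0)" for k
      using a(2) a(3)[of k] in\<Omega> by eventually_elim auto
  qed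
  have "AE x in lebesgue_on \<Omega>. v x = c \<longrightarrow> g x $ k = 0" for k
    using borel_weak_partial_zero_set[OF d[of k] \<Omega>(1)] a(2) a(3)[of k] in\<Omega>
    unfolding AE_lebesgue_on_iff[OF \<Omega>'] by eventually_elim auto
  then have "AE x in lebesgue_on \<Omega>. \<forall>k\<in>UNIV. v x = c \<longrightarrow> g x $ k = 0"
    by (intro AE_ball_countable[THEN iffD2] ballI) auto
  then show "AE x in lebesgue_on \<Omega>. v x = c \<longrightarrow> g x = 0" by eventually_elim (auto simp: vec_eq_iff)
qed

end

text \<open>The integral of (h - c)^2 over \<open>A\<close> is nonnegative; \<open>c\<close> is
  taken to be the mean of \<open>h\<close> over \<open>A\<close>.\<close>

lemma Cauchy_Schwarz_on_set:
  fixes h :: "'a \<Rightarrow> real"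
  assumes A: "A \<in> sets M" "emeasure M A < \<infinity>" and h: "integrable M h" "integrable M (\<lambda>x. (h x)\<^sup>2)"
    and supp: "AE x in M. x \<notin> A \<longrightarrow> h x = 0"
  shows "(LINT x|M. h x)\<^sup>2 \<le> measure M A * (LINT x|M. (h x)\<^sup>2)"
proof -
  let ?I = "LINT x|M. h x" and ?J = "LINT x|M. (h x)\<^sup>2" and ?m = "measure M A"
  have iA: "integrable M (indicat_real A)" using A by (intro integrable_real_indicator)
  have q: "0 \<le> ?J - 2 * c * ?I + c\<^sup>2 * ?m" for c
  proof -
    have "0 \<le> (LINT x|M. (h x)\<^sup>2 - 2 * c * h x + c\<^sup>2 * indicator A x)"
    proof (rule integral_nonneg_AE)
      show "AE x in M. 0 \<le> (h x)\<^sup>2 - 2 * c * h x + c\<^sup>2 * indicator A x"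
        using supp
      proof eventually_elim
        case (elim x)
        have "(h x - c)\<^sup>2 = (h x)\<^sup>2 - 2 * c * h x + c\<^sup>2" by (simp add: power2_diff)
        then show ?case using elim zero_le_power2[of "h x - c"] by (cases "x \<in> A") auto
      qed
    qed
    also have "\<dots> = ?J - 2 * c * ?I + c\<^sup>2 * ?m"
      using h iA sets.sets_into_space[OF A(1)] by (simp add: Int_absorb2)
    finally show ?thesis .
  qed
  show ?thesis
  proof (cases "?m = 0")
    case True
    have "?I = 0"
    proof (rule ccontr)
      assume "?I \<noteq> 0"
      \<comment> \<open>For a null set \<open>A\<close> the quadratic in \<open>c\<close> is linear,
        and this \<open>c\<close> gives it the value -1.\<close>
      then show False using q[of "(?J + 1) / (2 * ?I)"] True by simp
    qed
    then show ?thesis using True by simp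
  next
    case False
    then have m: "?m > 0" using measure_nonneg[of M A] by linarith
    from q[of "?I / ?m"] have "0 \<le> ?J - 2 * (?I / ?m) * ?I + (?I / ?m)\<^sup>2 * ?m" .
    also have "\<dots> = ?J - ?I\<^sup>2 / ?m" using m by (simp add: power2_eq_square field_simps)
    finally show ?thesis using m by (simp add: field_simps)
  qed
qed

section \<open>Comparison of the exponents 1 and 2 on bounded domains\<close>

lemma in_Lp_2: "in_Lp \<Omega> 2 v \<longleftrightarrow> v \<in> borel_measurable (lebesgue_on \<Omega>) \<and> integrable (lebesgue_on \<Omega>) (\<lambda>x. (norm (v x))\<^sup>2)"
  by (simp add: in_Lp_def)

lemma in_Lp_1: "in_Lp \<Omega> 1 v \<longleftrightarrow> v \<in> borel_measurable (lebesgue_on \<Omega>) \<and> integrable (lebesgue_on \<Omega>) (\<lambda>x. norm (v x))"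
  by (simp add: in_Lp_def)

lemma Lp_norm_2: "Lp_norm \<Omega> 2 v = sqrt (LINT x|lebesgue_on \<Omega>. (norm (v x))\<^sup>2)"
  by (simp add: Lp_norm_def powr_half_sqrt integral_nonneg)

lemma Lp_norm_1: "Lp_norm \<Omega> 1 v = (LINT x|lebesgue_on \<Omega>. norm (v x))"
  by (simp add: Lp_norm_def integral_nonneg)

lemma finite_emeasure_lebesgue_on:
  assumes "open \<Omega>" "bounded (\<Omega> :: 'a::euclidean_space set)"
  shows "emeasure (lebesgue_on \<Omega>) \<Omega> < \<infinity>" "\<Omega> \<in> sets (lebesgue_on \<Omega>)"
  using assms emeasure_bounded_finite[OF assms(2)] by (auto simp: emeasure_restrict_space)

lemma integrable_L2_imp_L1:
  fixes v :: "'a::euclidean_space \<Rightarrow> 'b::{banach,second_countable_topology}"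
  assumes \<Omega>: "open \<Omega>" "bounded \<Omega>"
    and v: "v \<in> borel_measurable (lebesgue_on \<Omega>)" "integrable (lebesgue_on \<Omega>) (\<lambda>x. (norm (v x))\<^sup>2)"
  shows "integrable (lebesgue_on \<Omega>) v"
proof (rule Bochner_Integration.integrable_bound)
  have "integrable (lebesgue_on \<Omega>) (indicat_real \<Omega>)"
    using finite_emeasure_lebesgue_on[OF \<Omega>] by (intro integrable_real_indicator)
  then show "integrable (lebesgue_on \<Omega>) (\<lambda>x. indicat_real \<Omega> x + (norm (v x))\<^sup>2)" using v by simp
  show "AE x in lebesgue_on \<Omega>. norm (v x) \<le> norm (indicat_real \<Omega> x + (norm (v x))\<^sup>2)"
  proof (rule AE_I2)
    fix x assume "x \<in> space (lebesgue_on \<Omega>)"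
    then have x: "x \<in> \<Omega>" by simp
    have "0 \<le> (norm (v x) - 1)\<^sup>2" by simp
    then have "2 * norm (v x) \<le> 1 + (norm (v x))\<^sup>2" by (simp add: power2_diff)
    moreover have "0 \<le> norm (v x)" by simp
    ultimately have "norm (v x) \<le> 1 + (norm (v x))\<^sup>2" by linarith
    then show "norm (v x) \<le> norm (indicat_real \<Omega> x + (norm (v x))\<^sup>2)" using x by simp
  qed
qed fact

lemma L2_tendsto_imp_L1:
  fixes v :: "nat \<Rightarrow> 'a::euclidean_space \<Rightarrow> 'b::{banach,second_countable_topology}"
  assumes \<Omega>: "open \<Omega>" "bounded \<Omega>"
    and v: "\<And>m. v m \<in> borel_measurable (lebesgue_on \<Omega>)" "\<And>m. integrable (lebesgue_on \<Omega>) (\<lambda>x. (norm (v m x))\<^sup>2)"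
    and lim: "(\<lambda>m. LINT x|lebesgue_on \<Omega>. (norm (v m x))\<^sup>2) \<longlonglongrightarrow> 0"
  shows "(\<lambda>m. LINT x|lebesgue_on \<Omega>. norm (v m x)) \<longlonglongrightarrow> 0"
proof -
  let ?\<mu> = "measure (lebesgue_on \<Omega>) \<Omega>"
  have "(\<lambda>m. sqrt (?\<mu> * (LINT x|lebesgue_on \<Omega>. (norm (v m x))\<^sup>2))) \<longlonglongrightarrow> sqrt (?\<mu> * 0)"
    by (intro tendsto_intros lim)
  then have l: "(\<lambda>m. sqrt (?\<mu> * (LINT x|lebesgue_on \<Omega>. (norm (v m x))\<^sup>2))) \<longlonglongrightarrow> 0" by simp
  show ?thesis
  proof (rule Lim_null_comparison[OF _ l], rule always_eventually, rule allI)
    fix m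
    have "(LINT x|lebesgue_on \<Omega>. norm (v m x))\<^sup>2 \<le> ?\<mu> * (LINT x|lebesgue_on \<Omega>. (norm (v m x))\<^sup>2)"
      using finite_emeasure_lebesgue_on[OF \<Omega>] integrable_L2_imp_L1[OF \<Omega> v] v
      by (intro Cauchy_Schwarz_on_set) auto
    then show "norm (LINT x|lebesgue_on \<Omega>. norm (v m x)) \<le> sqrt (?\<mu> * (LINT x|lebesgue_on \<Omega>. (norm (v m x))\<^sup>2))"
      by (simp add: real_le_rsqrt)
  qed
qed

lemma norm_diff_sq_le: "(norm (a - b))\<^sup>2 \<le> 2 * (norm a)\<^sup>2 + 2 * (norm (b::'a::real_normed_vector))\<^sup>2"
proof -
  have "(norm (a - b))\<^sup>2 \<le> (norm a + norm b)\<^sup>2" by (intro power_mono norm_triangle_ineq4) auto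
  also have "\<dots> \<le> 2 * (norm a)\<^sup>2 + 2 * (norm b)\<^sup>2"
    using zero_le_power2[of "norm a - norm b"] by (simp add: power2_sum power2_diff)
  finally show ?thesis .
qed

section \<open>Truncation and zero boundary values in the degenerate Sobolev spaces\<close>

context degenerate_setting
begin

text \<open>The gradient is an explicit argument so that gradients of truncations and differences
  can be written down; \<open>H1_A_gradient\<close> returns to the chosen
  \<open>A_gradient\<close>.\<close>

definition H1 :: "(real^'n) set \<Rightarrow> (real^'n \<Rightarrow> real) \<Rightarrow> (real^'n \<Rightarrow> real^'n) \<Rightarrow> bool" where
  "H1 \<Omega> v g \<longleftrightarrow> wgrad \<Omega> v g \<and> integrable (lebesgue_on \<Omega>) (\<lambda>x. (v x)\<^sup>2) \<and>
     integrable (lebesgue_on \<Omega>) (\<lambda>x. (norm (g x))\<^sup>2)"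

lemma H1_measurable:
  assumes "H1 \<Omega> v g"
  shows "v \<in> borel_measurable (lebesgue_on \<Omega>)" "g \<in> borel_measurable (lebesgue_on \<Omega>)"
  using assms by (auto simp: H1_def wgrad_def dest: borel_measurable_integrable)

lemma W1p_2_iff:
  assumes \<Omega>: "open \<Omega>" "bounded \<Omega>"
  shows "v \<in> W1p i1 iN f \<Omega> 2 \<longleftrightarrow> (\<exists>g. H1 \<Omega> v g)"
proof
  assume "v \<in> W1p i1 iN f \<Omega> 2"
  then obtain g where "has_weak_A_gradient i1 iN f \<Omega> v g" "in_Lp \<Omega> 2 g" "in_Lp \<Omega> 2 v"
    by (auto simp: W1p_def)
  then have w: "has_weak_A_gradient i1 iN f \<Omega> v g"
    and g: "g \<in> borel_measurable (lebesgue_on \<Omega>)" "integrable (lebesgue_on \<Omega>) (\<lambda>x. (norm (g x))\<^sup>2)"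
    and v: "v \<in> borel_measurable (lebesgue_on \<Omega>)" "integrable (lebesgue_on \<Omega>) (\<lambda>x. (norm (v x))\<^sup>2)"
    unfolding in_Lp_2 by blast+
  have "H1 \<Omega> v g"
    using w integrable_L2_imp_L1[OF \<Omega> g] integrable_L2_imp_L1[OF \<Omega> v] g(2) v(2)
    by (simp add: H1_def wgrad_def)
  then show "\<exists>g. H1 \<Omega> v g" by (rule exI[where x=g])
next
  assume "\<exists>g. H1 \<Omega> v g"
  then obtain g where h: "H1 \<Omega> v g" ..
  then show "v \<in> W1p i1 iN f \<Omega> 2"
    using H1_measurable[OF h] unfolding W1p_def in_Lp_2 by (auto simp: H1_def wgrad_def)
qed

lemma H1_A_gradient:
  assumes \<Omega>: "open \<Omega>" and h: "H1 \<Omega> v g"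
  shows "H1 \<Omega> v (A_gradient i1 iN f \<Omega> v)"
    "(LINT x|lebesgue_on \<Omega>. (norm (A_gradient i1 iN f \<Omega> v x))\<^sup>2) = (LINT x|lebesgue_on \<Omega>. (norm (g x))\<^sup>2)"
    "(LINT x|lebesgue_on \<Omega>. norm (A_gradient i1 iN f \<Omega> v x)) = (LINT x|lebesgue_on \<Omega>. norm (g x))"
proof -
  have w: "wgrad \<Omega> v g" using h by (simp add: H1_def)
  note e = A_gradient_eq[OF \<Omega> w] and wA = wgrad_A_gradient[OF \<Omega> w]
  have [measurable]: "A_gradient i1 iN f \<Omega> v \<in> borel_measurable (lebesgue_on \<Omega>)"
    "g \<in> borel_measurable (lebesgue_on \<Omega>)"
    using wA w by (auto simp: wgrad_def dest: borel_measurable_integrable)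
  have sq: "AE x in lebesgue_on \<Omega>. (norm (A_gradient i1 iN f \<Omega> v x))\<^sup>2 = (norm (g x))\<^sup>2"
    using e by eventually_elim simp
  then show "(LINT x|lebesgue_on \<Omega>. (norm (A_gradient i1 iN f \<Omega> v x))\<^sup>2) = (LINT x|lebesgue_on \<Omega>. (norm (g x))\<^sup>2)"
    by (intro integral_cong_AE) auto
  show "(LINT x|lebesgue_on \<Omega>. norm (A_gradient i1 iN f \<Omega> v x)) = (LINT x|lebesgue_on \<Omega>. norm (g x))"
    by (intro integral_cong_AE) (use e in \<open>auto elim!: eventually_mono\<close>)
  have "integrable (lebesgue_on \<Omega>) (\<lambda>x. (norm (A_gradient i1 iN f \<Omega> v x))\<^sup>2)"
    using integrable_cong_AE[OF _ _ sq] h by (simp add: H1_def)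
  then show "H1 \<Omega> v (A_gradient i1 iN f \<Omega> v)" using wA h by (simp add: H1_def)
qed

lemma H1_diff:
  assumes \<Omega>: "open \<Omega>" and 1: "H1 \<Omega> v1 g1" and 2: "H1 \<Omega> v2 g2"
  shows "H1 \<Omega> (\<lambda>x. v1 x - v2 x) (\<lambda>x. g1 x - g2 x)"
proof -
  note [measurable] = H1_measurable[OF 1] H1_measurable[OF 2]
  have "integrable (lebesgue_on \<Omega>) (\<lambda>x. (v1 x - v2 x)\<^sup>2)"
  proof (rule Bochner_Integration.integrable_bound)
    show "integrable (lebesgue_on \<Omega>) (\<lambda>x. 2 * (v1 x)\<^sup>2 + 2 * (v2 x)\<^sup>2)" using 1 2 by (simp add: H1_def)
    show "AE x in lebesgue_on \<Omega>. norm ((v1 x - v2 x)\<^sup>2) \<le> norm (2 * (v1 x)\<^sup>2 + 2 * (v2 x)\<^sup>2)"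
    proof (rule AE_I2)
      fix x show "norm ((v1 x - v2 x)\<^sup>2) \<le> norm (2 * (v1 x)\<^sup>2 + 2 * (v2 x)\<^sup>2)"
        using norm_diff_sq_le[of "v1 x" "v2 x"] by simp
    qed
  qed measurable
  moreover have "integrable (lebesgue_on \<Omega>) (\<lambda>x. (norm (g1 x - g2 x))\<^sup>2)"
  proof (rule Bochner_Integration.integrable_bound)
    show "integrable (lebesgue_on \<Omega>) (\<lambda>x. 2 * (norm (g1 x))\<^sup>2 + 2 * (norm (g2 x))\<^sup>2)" using 1 2 by (simp add: H1_def)
    show "AE x in lebesgue_on \<Omega>. norm ((norm (g1 x - g2 x))\<^sup>2) \<le> norm (2 * (norm (g1 x))\<^sup>2 + 2 * (norm (g2 x))\<^sup>2)"
    proof (rule AE_I2)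
      fix x show "norm ((norm (g1 x - g2 x))\<^sup>2) \<le> norm (2 * (norm (g1 x))\<^sup>2 + 2 * (norm (g2 x))\<^sup>2)"
        using norm_diff_sq_le[of "g1 x" "g2 x"] by simp
    qed
  qed measurable
  ultimately show ?thesis using wgrad_diff[OF \<Omega>] 1 2 by (simp add: H1_def)
qed

lemma H1_pos:
  assumes \<Omega>: "open \<Omega>" "bounded \<Omega>" and h: "H1 \<Omega> v g"
  shows "H1 \<Omega> (\<lambda>x. max (v x - c) 0) (\<lambda>x. if v x > c then g x else 0)"
proof -
  note [measurable] = H1_measurable[OF h]
  have w: "wgrad \<Omega> (\<lambda>x. max (v x - c) 0) (\<lambda>x. if v x > c then g x else 0)"
    using wgrad_pos(1)[OF \<Omega>] h by (simp add: H1_def)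
  have iO: "integrable (lebesgue_on \<Omega>) (indicat_real \<Omega>)"
    using finite_emeasure_lebesgue_on[OF \<Omega>] by (intro integrable_real_indicator)
  have "integrable (lebesgue_on \<Omega>) (\<lambda>x. (max (v x - c) 0)\<^sup>2)"
  proof (rule Bochner_Integration.integrable_bound)
    show "integrable (lebesgue_on \<Omega>) (\<lambda>x. 2 * (v x)\<^sup>2 + (2 * c\<^sup>2) * indicat_real \<Omega> x)" using h iO by (simp add: H1_def)
    show "AE x in lebesgue_on \<Omega>. norm ((max (v x - c) 0)\<^sup>2) \<le> norm (2 * (v x)\<^sup>2 + (2 * c\<^sup>2) * indicat_real \<Omega> x)"
    proof (rule AE_I2)
      fix x assume "x \<in> space (lebesgue_on \<Omega>)"
      then show "norm ((max (v x - c) 0)\<^sup>2) \<le> norm (2 * (v x)\<^sup>2 + (2 * c\<^sup>2) * indicat_real \<Omega> x)"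
        using norm_diff_sq_le[of "v x" c] by (auto simp: max_def)
    qed
  qed measurable
  moreover have "integrable (lebesgue_on \<Omega>) (\<lambda>x. (norm (if v x > c then g x else 0))\<^sup>2)"
    by (rule Bochner_Integration.integrable_bound[of _ "\<lambda>x. (norm (g x))\<^sup>2"]) (use h in \<open>auto simp: H1_def\<close>)
  ultimately show ?thesis using w by (simp add: H1_def)
qed

lemma borel_weak_partial_mono:
  "borel_weak_partial V k b v g \<Longrightarrow> U \<subseteq> V \<Longrightarrow> borel_weak_partial U k b v g"
  using test_functions_mono[of U V] by (auto simp: borel_weak_partial_def)

text \<open>The weak derivative is provided on the whole space because translations cross the
  boundary of \<open>\<Omega>\<close>. Off \<open>\<Omega>\<close> the function is 0, so by the
  zero-set lemma its derivative vanishes there almost everywhere.\<close>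

lemma lipschitz_H1:
  assumes \<Omega>: "open \<Omega>" "bounded \<Omega>" and \<psi>: "\<psi> \<in> lipschitz_compact_support \<Omega>"
  obtains g where "H1 \<Omega> \<psi> g"
    "\<And>k. borel_weak_partial UNIV k (B k) \<psi> (\<lambda>x. g x $ k)" "\<And>k. AE x in lborel. x \<notin> \<Omega> \<longrightarrow> g x $ k = 0"
proof -
  obtain L where L: "L-lipschitz_on UNIV \<psi>" and cs: "compact (closure {x. \<psi> x \<noteq> 0})" "closure {x. \<psi> x \<noteq> 0} \<subseteq> \<Omega>"
    using \<psi> by (auto simp: lipschitz_compact_support_def)
  have "\<exists>g C. borel_weak_partial UNIV k (B k) \<psi> g \<and> (\<forall>x. \<bar>g x\<bar> \<le> C)" for k
    using lipschitz_has_weak_partial[OF L cs(1), of k] by metis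
  then obtain g C where g: "\<And>k. borel_weak_partial UNIV k (B k) \<psi> (g k)" "\<And>k x. \<bar>g k x\<bar> \<le> C k" by metis
  define G where "G x = (\<chi> k. g k x)" for x
  have Gk: "(\<lambda>x. G x $ k) = g k" for k by (simp add: G_def)
  have w: "wgrad \<Omega> \<psi> G"
    by (rule wgradI[OF \<Omega>(1) borel_weak_partial_mono[OF g(1)]]) (auto simp: G_def)
  have mG: "G \<in> borel_measurable (lebesgue_on \<Omega>)" and m\<psi>: "\<psi> \<in> borel_measurable (lebesgue_on \<Omega>)"
    using w by (auto simp: wgrad_def dest: borel_measurable_integrable)
  have iO: "integrable (lebesgue_on \<Omega>) (\<lambda>x. c * indicat_real \<Omega> x)" for c
    using finite_emeasure_lebesgue_on[OF \<Omega>] integrable_real_indicator by auto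
  have bound: "integrable (lebesgue_on \<Omega>) h"
    if "h \<in> borel_measurable (lebesgue_on \<Omega>)" "\<And>x. \<bar>h x\<bar> \<le> c" for h :: "real^'n \<Rightarrow> real" and c
    by (rule Bochner_Integration.integrable_bound[OF iO[of c] that(1)])
       (use that(2) in \<open>auto intro!: AE_I2 order_trans[OF _ abs_ge_self]\<close>)
  obtain W where W: "\<And>x. \<bar>\<psi> x\<bar> \<le> W"
  proof -
    have "compact (\<psi> ` closure {x. \<psi> x \<noteq> 0})"
      using cs(1) lipschitz_on_continuous_on[OF L]
      by (intro compact_continuous_image) (auto intro: continuous_on_subset)
    then obtain W where W: "\<And>y. y \<in> \<psi> ` closure {x. \<psi> x \<noteq> 0} \<Longrightarrow> norm y \<le> W" by (meson compact_imp_bounded bounded_iff)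
    have "\<bar>\<psi> x\<bar> \<le> max W 0" for x
    proof (cases "\<psi> x = 0")
      case False
      then have "x \<in> closure {x. \<psi> x \<noteq> 0}" using closure_subset[of "{x. \<psi> x \<noteq> 0}"] by auto
      then show ?thesis using W[of "\<psi> x"] by auto
    qed simp
    then show ?thesis by (rule that)
  qed
  have i1: "integrable (lebesgue_on \<Omega>) (\<lambda>x. (\<psi> x)\<^sup>2)"
  proof (rule bound[of _ "W\<^sup>2"])
    show "\<bar>(\<psi> x)\<^sup>2\<bar> \<le> W\<^sup>2" for x using power_mono[OF W[of x], of 2] by simp
  qed (use m\<psi> in measurable)
  have i2: "integrable (lebesgue_on \<Omega>) (\<lambda>x. (norm (G x))\<^sup>2)"
  proof (rule bound[of _ "(\<Sum>k\<in>UNIV. C k)\<^sup>2"])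
    fix x
    have "norm (G x) \<le> (\<Sum>k\<in>UNIV. \<bar>G x $ k\<bar>)" by (rule norm_le_l1_cart)
    also have "\<dots> \<le> (\<Sum>k\<in>UNIV. C k)" using g(2) by (intro sum_mono) (simp add: G_def)
    finally show "\<bar>(norm (G x))\<^sup>2\<bar> \<le> (\<Sum>k\<in>UNIV. C k)\<^sup>2" using power_mono[of "norm (G x)" _ 2] by simp
  qed (use mG in measurable)
  show thesis
  proof (rule that)
    show "H1 \<Omega> \<psi> G" using w i1 i2 by (simp add: H1_def)
    show "borel_weak_partial UNIV k (B k) \<psi> (\<lambda>x. G x $ k)" for k unfolding Gk by (rule g)
    show "AE x in lborel. x \<notin> \<Omega> \<longrightarrow> G x $ k = 0" for k
      using borel_weak_partial_zero_set[OF g(1) open_UNIV, of k]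
    proof eventually_elim
      case (elim x)
      show ?case
      proof
        assume "x \<notin> \<Omega>"
        then have "\<psi> x = 0" using cs(2) closure_subset[of "{x. \<psi> x \<noteq> 0}"] by auto
        then show "G x $ k = 0" using elim by (simp add: G_def)
      qed
    qed
  qed
qed

lemma W1p_norm_2:
  assumes "open \<Omega>" "H1 \<Omega> v g"
  shows "W1p_norm i1 iN f \<Omega> 2 v = sqrt (LINT x|lebesgue_on \<Omega>. (v x)\<^sup>2) + sqrt (LINT x|lebesgue_on \<Omega>. (norm (g x))\<^sup>2)"
  using H1_A_gradient(2)[OF assms] by (simp add: W1p_norm_def Lp_norm_2)

lemma W1p_0_approx:
  assumes \<Omega>: "open \<Omega>" "bounded \<Omega>" and v: "v \<in> W1p_0 i1 iN f \<Omega> 2" and g: "H1 \<Omega> v g"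
  obtains \<psi> \<gamma> where "\<And>m. \<psi> m \<in> lipschitz_compact_support \<Omega>" "\<And>m. H1 \<Omega> (\<psi> m) (\<gamma> m)"
    "\<And>m k. borel_weak_partial UNIV k (B k) (\<psi> m) (\<lambda>x. \<gamma> m x $ k)"
    "\<And>m k. AE x in lborel. x \<notin> \<Omega> \<longrightarrow> \<gamma> m x $ k = 0"
    "(\<lambda>m. LINT x|lebesgue_on \<Omega>. (v x - \<psi> m x)\<^sup>2) \<longlonglongrightarrow> 0"
    "(\<lambda>m. LINT x|lebesgue_on \<Omega>. (norm (g x - \<gamma> m x))\<^sup>2) \<longlonglongrightarrow> 0"
proof -
  have "\<forall>m. \<exists>\<psi>\<in>lipschitz_compact_support \<Omega>. W1p_norm i1 iN f \<Omega> 2 (\<lambda>x. v x - \<psi> x) < inverse (real (Suc m))"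
    using v by (auto simp: W1p_0_def)
  then obtain \<psi> where \<psi>: "\<And>m. \<psi> m \<in> lipschitz_compact_support \<Omega>"
    "\<And>m. W1p_norm i1 iN f \<Omega> 2 (\<lambda>x. v x - \<psi> m x) < inverse (real (Suc m))" by metis
  define P where "P m \<gamma> \<longleftrightarrow> H1 \<Omega> (\<psi> m) \<gamma> \<and> (\<forall>k. borel_weak_partial UNIV k (B k) (\<psi> m) (\<lambda>x. \<gamma> x $ k)) \<and>
     (\<forall>k. AE x in lborel. x \<notin> \<Omega> \<longrightarrow> \<gamma> x $ k = 0)" for m \<gamma>
  have "\<exists>\<gamma>. P m \<gamma>" for m
    unfolding P_def by (rule lipschitz_H1[OF \<Omega> \<psi>(1)[of m]]) blast
  then obtain \<gamma> where "\<And>m. P m (\<gamma> m)" by metis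
  then have \<gamma>: "\<And>m. H1 \<Omega> (\<psi> m) (\<gamma> m)" "\<And>m k. borel_weak_partial UNIV k (B k) (\<psi> m) (\<lambda>x. \<gamma> m x $ k)"
    "\<And>m k. AE x in lborel. x \<notin> \<Omega> \<longrightarrow> \<gamma> m x $ k = 0"
    unfolding P_def by blast+
  have n: "sqrt (LINT x|lebesgue_on \<Omega>. (v x - \<psi> m x)\<^sup>2) + sqrt (LINT x|lebesgue_on \<Omega>. (norm (g x - \<gamma> m x))\<^sup>2)
      \<le> inverse (real (Suc m))" for m
    using \<psi>(2)[of m] W1p_norm_2[OF \<Omega>(1) H1_diff[OF \<Omega>(1) g \<gamma>(1)], of m] by simp
  have sq: "(\<lambda>m. a m) \<longlonglongrightarrow> 0" if "\<And>m. sqrt (a m) \<le> inverse (real (Suc m))" "\<And>m. 0 \<le> a m" for a :: "nat \<Rightarrow> real"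
  proof -
    have "(\<lambda>m. sqrt (a m)) \<longlonglongrightarrow> 0"
      by (rule tendsto_sandwich[OF _ _ tendsto_const LIMSEQ_inverse_real_of_nat]) (use that in auto)
    then have "(\<lambda>m. (sqrt (a m))\<^sup>2) \<longlonglongrightarrow> 0\<^sup>2" by (intro tendsto_intros)
    then show ?thesis using that(2) by simp
  qed
  show thesis
  proof (rule that[OF \<psi>(1) \<gamma>])
    have "sqrt (LINT x|lebesgue_on \<Omega>. (v x - \<psi> m x)\<^sup>2) \<le> inverse (real (Suc m))"
      "sqrt (LINT x|lebesgue_on \<Omega>. (norm (g x - \<gamma> m x))\<^sup>2) \<le> inverse (real (Suc m))" for m
    proof -
      have "0 \<le> sqrt (LINT x|lebesgue_on \<Omega>. (v x - \<psi> m x)\<^sup>2)" "0 \<le> sqrt (LINT x|lebesgue_on \<Omega>. (norm (g x - \<gamma> m x))\<^sup>2)"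
        by (simp_all add: integral_nonneg)
      with n[of m] show "sqrt (LINT x|lebesgue_on \<Omega>. (v x - \<psi> m x)\<^sup>2) \<le> inverse (real (Suc m))"
      "sqrt (LINT x|lebesgue_on \<Omega>. (norm (g x - \<gamma> m x))\<^sup>2) \<le> inverse (real (Suc m))" by linarith+
    qed
    then show "(\<lambda>m. LINT x|lebesgue_on \<Omega>. (v x - \<psi> m x)\<^sup>2) \<longlonglongrightarrow> 0"
     "(\<lambda>m. LINT x|lebesgue_on \<Omega>. (norm (g x - \<gamma> m x))\<^sup>2) \<longlonglongrightarrow> 0"
      by (auto intro!: sq simp: integral_nonneg)
  qed
qed

text \<open>Reconciles the test functions of the equation, of exponent 2, with admissibility, which
  is stated for exponent 1. Cauchy-Schwarz on the bounded set \<open>\<Omega>\<close> turns the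
  approximation for 2 into one for 1.\<close>

lemma W1p_0_2_imp_1:
  assumes \<Omega>: "open \<Omega>" "bounded \<Omega>" and v: "v \<in> W1p_0 i1 iN f \<Omega> 2"
  shows "v \<in> W1p_0 i1 iN f \<Omega> 1"
proof -
  have "v \<in> W1p i1 iN f \<Omega> 2" using v by (simp add: W1p_0_def)
  then obtain g where g: "H1 \<Omega> v g" using W1p_2_iff[OF \<Omega>] by auto
  obtain \<psi> \<gamma> where a: "\<And>m. \<psi> m \<in> lipschitz_compact_support \<Omega>" "\<And>m. H1 \<Omega> (\<psi> m) (\<gamma> m)"
    "(\<lambda>m. LINT x|lebesgue_on \<Omega>. (v x - \<psi> m x)\<^sup>2) \<longlonglongrightarrow> 0"
    "(\<lambda>m. LINT x|lebesgue_on \<Omega>. (norm (g x - \<gamma> m x))\<^sup>2) \<longlonglongrightarrow> 0"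
    by (rule W1p_0_approx[OF \<Omega> v g]) blast
  have d: "H1 \<Omega> (\<lambda>x. v x - \<psi> m x) (\<lambda>x. g x - \<gamma> m x)" for m by (rule H1_diff[OF \<Omega>(1) g a(2)])
  have l1: "(\<lambda>m. LINT x|lebesgue_on \<Omega>. norm (v x - \<psi> m x)) \<longlonglongrightarrow> 0"
    by (rule L2_tendsto_imp_L1[OF \<Omega>]) (use d[THEN H1_measurable(1)] d a(3) in \<open>auto simp: H1_def\<close>)
  have l2: "(\<lambda>m. LINT x|lebesgue_on \<Omega>. norm (g x - \<gamma> m x)) \<longlonglongrightarrow> 0"
    by (rule L2_tendsto_imp_L1[OF \<Omega>]) (use d[THEN H1_measurable(2)] d a(4) in \<open>auto simp: H1_def\<close>)
  have "v \<in> W1p i1 iN f \<Omega> 1"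
    using g H1_measurable[OF g] unfolding W1p_def in_Lp_1 by (auto simp: H1_def wgrad_def)
  moreover have "\<exists>\<psi>\<in>lipschitz_compact_support \<Omega>. W1p_norm i1 iN f \<Omega> 1 (\<lambda>x. v x - \<psi> x) < e" if "e > 0" for e
  proof -
    have W: "W1p_norm i1 iN f \<Omega> 1 (\<lambda>x. v x - \<psi> m x) =
        (LINT x|lebesgue_on \<Omega>. norm (v x - \<psi> m x)) + (LINT x|lebesgue_on \<Omega>. norm (g x - \<gamma> m x))" for m
      using H1_A_gradient(3)[OF \<Omega>(1) d, of m] by (simp add: W1p_norm_def Lp_norm_1)
    have "(\<lambda>m. W1p_norm i1 iN f \<Omega> 1 (\<lambda>x. v x - \<psi> m x)) \<longlonglongrightarrow> 0"
      unfolding W using tendsto_add[OF l1 l2] by simp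
    from order_tendstoD(2)[OF this that] obtain m where "W1p_norm i1 iN f \<Omega> 1 (\<lambda>x. v x - \<psi> m x) < e"
      by (auto simp: eventually_sequentially)
    then show ?thesis using a(1) by blast
  qed
  ultimately show ?thesis by (simp add: W1p_0_def)
qed

lemma lipschitz_truncate:
  assumes \<psi>: "\<psi> \<in> lipschitz_compact_support \<Omega>" and s: "s \<ge> 0"
  shows "(\<lambda>x. max (\<psi> x - s) 0) \<in> lipschitz_compact_support \<Omega>"
proof -
  obtain L where L: "L-lipschitz_on UNIV \<psi>" and cs: "compact (closure {x. \<psi> x \<noteq> 0})" "closure {x. \<psi> x \<noteq> 0} \<subseteq> \<Omega>"
    using \<psi> by (auto simp: lipschitz_compact_support_def)
  have sub: "closure {x. max (\<psi> x - s) 0 \<noteq> 0} \<subseteq> closure {x. \<psi> x \<noteq> 0}"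
    using s by (intro closure_mono) auto
  have "L-lipschitz_on UNIV (\<lambda>x. max (\<psi> x - s) 0)"
  proof (rule lipschitz_onI)
    fix x y
    have "dist (max (\<psi> x - s) 0) (max (\<psi> y - s) 0) \<le> dist (\<psi> x) (\<psi> y)" by (auto simp: dist_real_def max_def)
    also have "\<dots> \<le> L * dist x y" using lipschitz_onD[OF L] by simp
    finally show "dist (max (\<psi> x - s) 0) (max (\<psi> y - s) 0) \<le> L * dist x y" .
  qed (rule lipschitz_on_nonneg[OF L])
  moreover have "compact (closure {x. max (\<psi> x - s) 0 \<noteq> 0})"
    using bounded_subset[OF compact_imp_bounded[OF cs(1)] sub] by (simp add: compact_eq_bounded_closed)
  ultimately show ?thesis using sub cs(2) by (auto simp: lipschitz_compact_support_def)
qed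

text \<open>Makes higher truncations of \<open>u\<close> legitimate test functions. Truncated
  Lipschitz approximants converge; the delicate point is the gradient on the level set
  \<open>v = s\<close>, where the indicators need not converge but the gradient of \<open>v\<close>
  is 0.\<close>

lemma W1p_0_truncate:
  assumes \<Omega>: "open \<Omega>" "bounded \<Omega>" and v: "v \<in> W1p_0 i1 iN f \<Omega> 2" and s: "s \<ge> 0"
  shows "(\<lambda>x. max (v x - s) 0) \<in> W1p_0 i1 iN f \<Omega> 2"
proof -
  let ?M = "lebesgue_on \<Omega>"
  have "v \<in> W1p i1 iN f \<Omega> 2" using v by (simp add: W1p_0_def)
  then obtain g where g: "H1 \<Omega> v g" using W1p_2_iff[OF \<Omega>] by auto
  obtain \<psi> \<gamma> where a: "\<And>m. \<psi> m \<in> lipschitz_compact_support \<Omega>" "\<And>m. H1 \<Omega> (\<psi> m) (\<gamma> m)"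
    "(\<lambda>m. LINT x|?M. (v x - \<psi> m x)\<^sup>2) \<longlonglongrightarrow> 0"
    "(\<lambda>m. LINT x|?M. (norm (g x - \<gamma> m x))\<^sup>2) \<longlonglongrightarrow> 0"
    by (rule W1p_0_approx[OF \<Omega> v g]) blast
  have d: "H1 \<Omega> (\<lambda>x. v x - \<psi> m x) (\<lambda>x. g x - \<gamma> m x)" for m by (rule H1_diff[OF \<Omega>(1) g a(2)])
  have i2: "integrable ?M (\<lambda>x. (v x - \<psi> m x)\<^sup>2)" for m using d by (simp add: H1_def)
  have "(\<lambda>m. LINT x|?M. norm ((v x - \<psi> m x)\<^sup>2)) \<longlonglongrightarrow> 0" using a(3) by simp
  from tendsto_L1_AE_subseq[OF i2 this] obtain r where r: "strict_mono r"
    "AE x in ?M. (\<lambda>m. (v x - \<psi> (r m) x)\<^sup>2) \<longlonglongrightarrow> 0" by blast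
  have ae: "AE x in ?M. (\<lambda>m. \<psi> (r m) x) \<longlonglongrightarrow> v x"
    using r(2)
  proof eventually_elim
    case (elim x)
    have "(\<lambda>m. sqrt ((v x - \<psi> (r m) x)\<^sup>2)) \<longlonglongrightarrow> sqrt 0" by (intro tendsto_intros elim)
    then have "(\<lambda>m. v x - \<psi> (r m) x) \<longlonglongrightarrow> 0" by (simp add: tendsto_rabs_zero_iff)
    from tendsto_diff[OF tendsto_const[of "v x"] this] show ?case by simp
  qed
  have l2: "(\<lambda>m. LINT x|?M. (v x - \<psi> (r m) x)\<^sup>2) \<longlonglongrightarrow> 0"
    and lg: "(\<lambda>m. LINT x|?M. (norm (g x - \<gamma> (r m) x))\<^sup>2) \<longlonglongrightarrow> 0"
    using LIMSEQ_subseq_LIMSEQ[OF a(3) r(1)] LIMSEQ_subseq_LIMSEQ[OF a(4) r(1)] by (simp_all add: o_def)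
  note mg[measurable] = H1_measurable[OF g] and m\<psi>[measurable] = H1_measurable[OF a(2)]
  let ?w = "\<lambda>x. max (v x - s) 0" and ?gw = "\<lambda>x. if v x > s then g x else 0"
  let ?wm = "\<lambda>m x. max (\<psi> (r m) x - s) 0" and ?gm = "\<lambda>m x. if \<psi> (r m) x > s then \<gamma> (r m) x else 0"
  have hw: "H1 \<Omega> ?w ?gw" by (rule H1_pos[OF \<Omega> g])
  have hm: "H1 \<Omega> (?wm m) (?gm m)" for m by (rule H1_pos[OF \<Omega> a(2)])
  have hd: "H1 \<Omega> (\<lambda>x. ?w x - ?wm m x) (\<lambda>x. ?gw x - ?gm m x)" for m by (rule H1_diff[OF \<Omega>(1) hw hm])
  have t1: "(\<lambda>m. LINT x|?M. (?w x - ?wm m x)\<^sup>2) \<longlonglongrightarrow> 0"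
  proof (rule Lim_null_comparison[OF _ l2], rule always_eventually, rule allI)
    fix m
    have "(LINT x|?M. (?w x - ?wm m x)\<^sup>2) \<le> (LINT x|?M. (v x - \<psi> (r m) x)\<^sup>2)"
    proof (rule integral_mono)
      show "integrable ?M (\<lambda>x. (?w x - ?wm m x)\<^sup>2)" using hd by (simp add: H1_def)
      fix x
      have "\<bar>?w x - ?wm m x\<bar> \<le> \<bar>v x - \<psi> (r m) x\<bar>" by (auto simp: max_def)
      then show "(?w x - ?wm m x)\<^sup>2 \<le> (v x - \<psi> (r m) x)\<^sup>2" by (rule abs_le_square_iff[THEN iffD1])
    qed (rule i2)
    then show "norm (LINT x|?M. (?w x - ?wm m x)\<^sup>2) \<le> (LINT x|?M. (v x - \<psi> (r m) x)\<^sup>2)"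
      by (simp add: integral_nonneg)
  qed
  \<comment> \<open>The error of replacing the set \<open>v > s\<close> by the set where the
    approximant exceeds \<open>s\<close>, with the gradient \<open>g\<close> held fixed. What is
    left is the convergence of the gradients themselves.\<close>
  let ?E = "\<lambda>m x. (norm (?gw x - (if \<psi> (r m) x > s then g x else 0)))\<^sup>2"
  have ig: "integrable ?M (\<lambda>x. (norm (g x))\<^sup>2)" using g by (simp add: H1_def)
  have Eb: "?E m x \<le> (norm (g x))\<^sup>2" for m x by auto
  have iE: "integrable ?M (?E m)" for m
    by (rule Bochner_Integration.integrable_bound[OF ig]) (use Eb in auto)
  have wg: "wgrad \<Omega> v g" using g by (simp add: H1_def)
  have tE: "(\<lambda>m. LINT x|?M. ?E m x) \<longlonglongrightarrow> 0"
  proof -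
    have "(\<lambda>m. LINT x|?M. ?E m x) \<longlonglongrightarrow> (LINT x|?M. (0::real))"
    proof (rule integral_dominated_convergence[OF _ _ ig])
      show "AE x in ?M. (\<lambda>m. ?E m x) \<longlonglongrightarrow> 0"
        using ae wgrad_pos(2)[OF \<Omega> wg, of s]
      proof eventually_elim
        case (elim x)
        then have gz: "v x = s \<Longrightarrow> g x = 0" by simp
        have "eventually (\<lambda>m. ?E m x = 0) sequentially"
        proof (cases "v x" s rule: linorder_cases)
          case less
          from order_tendstoD(2)[OF elim(1) less] show ?thesis by eventually_elim (use less in auto)
        next
          case greater
          from order_tendstoD(1)[OF elim(1) greater] show ?thesis by eventually_elim (use greater in auto)
        next
          case equal
          then show ?thesis using gz by auto
        qed
        then show ?case by (rule tendsto_eventually)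
      qed
      show "AE x in ?M. norm (?E m x) \<le> (norm (g x))\<^sup>2" for m using Eb by auto
    qed measurable
    then show ?thesis by simp
  qed
  have t2: "(\<lambda>m. LINT x|?M. (norm (?gw x - ?gm m x))\<^sup>2) \<longlonglongrightarrow> 0"
  proof (rule Lim_null_comparison, rule always_eventually, rule allI)
    show "(\<lambda>m. 2 * (LINT x|?M. ?E m x) + 2 * (LINT x|?M. (norm (g x - \<gamma> (r m) x))\<^sup>2)) \<longlonglongrightarrow> 0"
      using tendsto_add[OF tendsto_mult_right_zero[OF tE, of 2] tendsto_mult_right_zero[OF lg, of 2]] by simp
    fix m
    have id: "integrable ?M (\<lambda>x. (norm (g x - \<gamma> (r m) x))\<^sup>2)" using d by (simp add: H1_def)
    have "(LINT x|?M. (norm (?gw x - ?gm m x))\<^sup>2) \<le> (LINT x|?M. 2 * ?E m x + 2 * (norm (g x - \<gamma> (r m) x))\<^sup>2)"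
    proof (rule integral_mono)
      show "integrable ?M (\<lambda>x. (norm (?gw x - ?gm m x))\<^sup>2)" using hd by (simp add: H1_def)
      show "integrable ?M (\<lambda>x. 2 * ?E m x + 2 * (norm (g x - \<gamma> (r m) x))\<^sup>2)" using iE id by simp
      fix x
      show "(norm (?gw x - ?gm m x))\<^sup>2 \<le> 2 * ?E m x + 2 * (norm (g x - \<gamma> (r m) x))\<^sup>2"
        using norm_diff_sq_le[of "g x" 0] norm_diff_sq_le[of "g x - \<gamma> (r m) x" "- g x"]
          norm_diff_sq_le[of 0 "\<gamma> (r m) x"] norm_diff_sq_le[of "g x - \<gamma> (r m) x" "g x"]
        by (auto simp: norm_minus_commute)
    qed
    also have "\<dots> = 2 * (LINT x|?M. ?E m x) + 2 * (LINT x|?M. (norm (g x - \<gamma> (r m) x))\<^sup>2)" using iE id by simp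
    finally show "norm (LINT x|?M. (norm (?gw x - ?gm m x))\<^sup>2) \<le>
       2 * (LINT x|?M. ?E m x) + 2 * (LINT x|?M. (norm (g x - \<gamma> (r m) x))\<^sup>2)" by (simp add: integral_nonneg)
  qed
  have "(\<lambda>m. sqrt (LINT x|?M. (?w x - ?wm m x)\<^sup>2) + sqrt (LINT x|?M. (norm (?gw x - ?gm m x))\<^sup>2)) \<longlonglongrightarrow> sqrt 0 + sqrt 0"
    by (intro tendsto_intros t1 t2)
  then have lim: "(\<lambda>m. W1p_norm i1 iN f \<Omega> 2 (\<lambda>x. ?w x - ?wm m x)) \<longlonglongrightarrow> 0"
    unfolding W1p_norm_2[OF \<Omega>(1) hd] by simp
  have "\<exists>\<psi>\<in>lipschitz_compact_support \<Omega>. W1p_norm i1 iN f \<Omega> 2 (\<lambda>x. ?w x - \<psi> x) < e" if "e > 0" for e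
  proof -
    from order_tendstoD(2)[OF lim that] obtain m where "W1p_norm i1 iN f \<Omega> 2 (\<lambda>x. ?w x - ?wm m x) < e"
      by (auto simp: eventually_sequentially)
    then show ?thesis by (rule bexI[OF _ lipschitz_truncate[OF a(1) s]])
  qed
  moreover have "?w \<in> W1p i1 iN f \<Omega> 2" using W1p_2_iff[OF \<Omega>] hw by blast
  ultimately show ?thesis by (simp add: W1p_0_def)
qed

text \<open>Extension by zero turns membership in the closure of the compactly supported Lipschitz functions
  into a difference estimate on the whole space.\<close>

lemma W1p_0_shift_estimate:
  assumes \<Omega>: "open \<Omega>" "bounded \<Omega>" and v: "v \<in> W1p_0 i1 iN f \<Omega> 2" and g: "H1 \<Omega> v g"
    and w: "w \<in> borel_measurable borel" "AE x in lebesgue_on \<Omega>. v x = w x" "\<And>x. x \<notin> \<Omega> \<Longrightarrow> w x = 0"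
    and t: "t \<ge> 0"
  shows "(LINT x|lborel. \<bar>B k x * (w (x + t *\<^sub>R axis k 1) - w x)\<bar>) \<le> t * (LINT x|lebesgue_on \<Omega>. norm (g x))"
    and "integrable lborel (\<lambda>x. B k x * (w (x + t *\<^sub>R axis k 1) - w x))"
    and "integrable lborel w"
proof -
  let ?M = "lebesgue_on \<Omega>" and ?e = "axis k 1 :: real^'n"
  note w(1)[measurable]
  have \<Omega>'[measurable]: "\<Omega> \<in> sets borel" using \<Omega> by simp
  obtain \<psi> \<gamma> where a: "\<And>m. \<psi> m \<in> lipschitz_compact_support \<Omega>" "\<And>m. H1 \<Omega> (\<psi> m) (\<gamma> m)"
    "\<And>m k. borel_weak_partial UNIV k (B k) (\<psi> m) (\<lambda>x. \<gamma> m x $ k)"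
    "\<And>m k. AE x in lborel. x \<notin> \<Omega> \<longrightarrow> \<gamma> m x $ k = 0"
    "(\<lambda>m. LINT x|?M. (v x - \<psi> m x)\<^sup>2) \<longlonglongrightarrow> 0"
    "(\<lambda>m. LINT x|?M. (norm (g x - \<gamma> m x))\<^sup>2) \<longlonglongrightarrow> 0"
    by (rule W1p_0_approx[OF \<Omega> v g]) blast
  have d: "H1 \<Omega> (\<lambda>x. v x - \<psi> m x) (\<lambda>x. g x - \<gamma> m x)" for m by (rule H1_diff[OF \<Omega>(1) g a(2)])
  have l1: "(\<lambda>m. LINT x|?M. norm (v x - \<psi> m x)) \<longlonglongrightarrow> 0"
    by (rule L2_tendsto_imp_L1[OF \<Omega>]) (use d[THEN H1_measurable(1)] d a(5) in \<open>auto simp: H1_def\<close>)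
  have l2: "(\<lambda>m. LINT x|?M. norm (g x - \<gamma> m x)) \<longlonglongrightarrow> 0"
    by (rule L2_tendsto_imp_L1[OF \<Omega>]) (use d[THEN H1_measurable(2)] d a(6) in \<open>auto simp: H1_def\<close>)
  have iv: "integrable ?M v" and ig: "integrable ?M g" using g by (auto simp: H1_def wgrad_def)
  have iw: "integrable lborel w"
  proof -
    have "integrable ?M w"
      using integrable_cong_AE[OF borel_measurable_integrable[OF iv] lebesgue_on_borel_measurable[OF w(1)] w(2)] iv by simp
    then have "integrable lborel (\<lambda>x. indicator \<Omega> x * w x)"
      using integrable_lebesgue_on_borel[OF w(1) \<Omega>'] by simp
    moreover have "(\<lambda>x. indicator \<Omega> x * w x) = w" using w(3) by (auto simp: fun_eq_iff indicator_def)
    ultimately show ?thesis by simp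
  qed
  then show "integrable lborel w" .
  have i\<psi>: "integrable lborel (\<psi> m)" for m using a(3) by (auto simp: borel_weak_partial_def)
  have [measurable]: "\<psi> m \<in> borel_measurable borel" for m using borel_measurable_integrable[OF i\<psi>] by simp
  have out: "\<psi> m x = 0" if "x \<notin> \<Omega>" for m x
    using a(1)[of m] that closure_subset[of "{x. \<psi> m x \<noteq> 0}"] by (auto simp: lipschitz_compact_support_def)
  obtain C where C: "C > 0" "\<And>x. x \<in> closure \<Omega> \<Longrightarrow> \<bar>B k x\<bar> \<le> C"
    using bounded_on_compact[of "closure \<Omega>" k] \<Omega>(2) by auto
  have CB: "\<bar>B k x * h x\<bar> \<le> C * \<bar>h x\<bar>" if "\<And>x. x \<notin> \<Omega> \<Longrightarrow> h x = 0" for h :: "real^'n \<Rightarrow> real" and x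
  proof (cases "x \<in> \<Omega>")
    case True
    then have "\<bar>B k x\<bar> \<le> C" using C(2) closure_subset by blast
    then show ?thesis by (simp add: abs_mult mult_right_mono)
  qed (simp add: that)
  have iB: "integrable lborel (\<lambda>x. B k x * h x)" "(LINT x|lborel. \<bar>B k x * h x\<bar>) \<le> C * (LINT x|lborel. \<bar>h x\<bar>)"
    if h: "integrable lborel h" and z: "\<And>x. x \<notin> \<Omega> \<Longrightarrow> h x = 0" for h
  proof -
    have [measurable]: "h \<in> borel_measurable borel" using borel_measurable_integrable[OF h] by simp
    show i: "integrable lborel (\<lambda>x. B k x * h x)"
    proof (rule Bochner_Integration.integrable_bound[of _ "\<lambda>x. C * h x"])
      show "AE x in lborel. norm (B k x * h x) \<le> norm (C * h x)"
        using CB[of h, OF z] C(1) by (simp add: abs_mult)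
    qed (use h in auto)
    have "(LINT x|lborel. \<bar>B k x * h x\<bar>) \<le> (LINT x|lborel. C * \<bar>h x\<bar>)"
      using i h CB[of h, OF z] by (intro integral_mono) auto
    then show "(LINT x|lborel. \<bar>B k x * h x\<bar>) \<le> C * (LINT x|lborel. \<bar>h x\<bar>)" by simp
  qed
  have iBs: "integrable lborel (\<lambda>x. B k x * (h (x + t *\<^sub>R ?e) - h x))"
    if h: "integrable lborel h" and z: "\<And>x. x \<notin> \<Omega> \<Longrightarrow> h x = 0" for h
    using Bochner_Integration.integrable_diff[OF integrable_lborel_shift[OF iB(1)[OF h z], of "t *\<^sub>R ?e"] iB(1)[OF h z]]
    by (simp add: inv right_diff_distrib)
  show "integrable lborel (\<lambda>x. B k x * (w (x + t *\<^sub>R ?e) - w x))" by (rule iBs[OF iw w(3)])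
  have \<psi>est: "(LINT x|lborel. \<bar>B k x * (\<psi> m (x + t *\<^sub>R ?e) - \<psi> m x)\<bar>) \<le> t * (LINT x|?M. norm (\<gamma> m x))" for m
  proof -
    let ?g = "\<lambda>x. \<gamma> m x $ k"
    have igm: "integrable lborel ?g" using a(3)[of k m] by (auto simp: borel_weak_partial_def)
    have [measurable]: "?g \<in> borel_measurable borel" using borel_measurable_integrable[OF igm] by simp
    have "(LINT x|lborel. \<bar>B k x * (\<psi> m (x + t *\<^sub>R ?e) - \<psi> m x)\<bar>) = (LINT x|lborel. \<bar>line_integral ?e t ?g x\<bar>)"
    proof (rule integral_cong_AE)
      show "AE x in lborel. \<bar>B k x * (\<psi> m (x + t *\<^sub>R ?e) - \<psi> m x)\<bar> = \<bar>line_integral ?e t ?g x\<bar>"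
        using line_identity[OF a(3)[of k m] open_UNIV t UNIV_I] by eventually_elim simp
    qed measurable
    also have "\<dots> \<le> t * (LINT x|lborel. \<bar>?g x\<bar>)" by (rule line_integral_L1_le[OF igm t])
    also have "(LINT x|lborel. \<bar>?g x\<bar>) = (LINT x|lborel. indicator \<Omega> x * \<bar>?g x\<bar>)"
    proof (rule integral_cong_AE)
      show "AE x in lborel. \<bar>?g x\<bar> = indicator \<Omega> x * \<bar>?g x\<bar>"
        using a(4)[of m k] by eventually_elim (auto simp: indicator_def)
    qed measurable
    also have "\<dots> = (LINT x|?M. \<bar>?g x\<bar>)" by (rule integral_lebesgue_on_borel[symmetric]) measurable
    also have "\<dots> \<le> (LINT x|?M. norm (\<gamma> m x))"
      using a(2)[of m] by (intro integral_mono) (auto simp: H1_def wgrad_def integrable_vec_iff component_le_norm_cart)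
    finally show ?thesis using t by (simp add: mult_left_mono)
  qed
  have \<gamma>n: "(LINT x|?M. norm (\<gamma> m x)) \<le> (LINT x|?M. norm (g x)) + (LINT x|?M. norm (g x - \<gamma> m x))" for m
  proof -
    have i: "integrable ?M (\<gamma> m)" using a(2) by (auto simp: H1_def wgrad_def)
    have "(LINT x|?M. norm (\<gamma> m x)) \<le> (LINT x|?M. norm (g x) + norm (g x - \<gamma> m x))"
    proof (rule integral_mono)
      fix x show "norm (\<gamma> m x) \<le> norm (g x) + norm (g x - \<gamma> m x)"
        using norm_triangle_ineq4[of "g x" "g x - \<gamma> m x"] by simp
    qed (use i ig in auto)
    then show ?thesis using i ig by simp
  qed
  have diff: "(LINT x|lborel. \<bar>w x - \<psi> m x\<bar>) = (LINT x|?M. norm (v x - \<psi> m x))" for m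
  proof -
    have "(LINT x|?M. norm (v x - \<psi> m x)) = (LINT x|?M. \<bar>w x - \<psi> m x\<bar>)"
    proof (rule integral_cong_AE)
      show "AE x in ?M. norm (v x - \<psi> m x) = \<bar>w x - \<psi> m x\<bar>" using w(2) by eventually_elim simp
      show "(\<lambda>x. norm (v x - \<psi> m x)) \<in> borel_measurable ?M"
        using H1_measurable(1)[OF d[of m]] by measurable
      show "(\<lambda>x. \<bar>w x - \<psi> m x\<bar>) \<in> borel_measurable ?M"
        by (rule lebesgue_on_borel_measurable) measurable
    qed
    also have "\<dots> = (LINT x|lborel. indicator \<Omega> x * \<bar>w x - \<psi> m x\<bar>)"
      by (rule integral_lebesgue_on_borel) measurable
    also have "\<dots> = (LINT x|lborel. \<bar>w x - \<psi> m x\<bar>)"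
      using w(3) out by (intro Bochner_Integration.integral_cong) (auto simp: indicator_def)
    finally show ?thesis by simp
  qed
  \<comment> \<open>The remainder \<open>w - \<psi> m\<close> is not estimated through a gradient
    but by brute force: its two translates cost \<open>2 * C\<close> times its norm, which tends to
    0. The bound \<open>C\<close> on the weight suffices because the remainder vanishes off
    \<open>\<Omega>\<close>.\<close>
  have est: "(LINT x|lborel. \<bar>B k x * (w (x + t *\<^sub>R ?e) - w x)\<bar>) \<le>
     t * ((LINT x|?M. norm (g x)) + (LINT x|?M. norm (g x - \<gamma> m x))) + 2 * C * (LINT x|?M. norm (v x - \<psi> m x))" for m
  proof -
    let ?h = "\<lambda>x. w x - \<psi> m x"
    have ih: "integrable lborel ?h" and zh: "\<And>x. x \<notin> \<Omega> \<Longrightarrow> ?h x = 0" using iw i\<psi> w(3) out by auto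
    have [measurable]: "?h \<in> borel_measurable borel" by measurable
    note iBh = iB(1)[OF ih zh]
    note sh = integrable_lborel_shift[OF iBh, of "t *\<^sub>R ?e"]
    note i\<psi>s = iBs[OF i\<psi>[of m] out[where m=m]]
    have "(LINT x|lborel. \<bar>B k x * (w (x + t *\<^sub>R ?e) - w x)\<bar>) \<le>
      (LINT x|lborel. \<bar>B k x * (\<psi> m (x + t *\<^sub>R ?e) - \<psi> m x)\<bar> + \<bar>B k (x + t *\<^sub>R ?e) * ?h (x + t *\<^sub>R ?e)\<bar> + \<bar>B k x * ?h x\<bar>)"
    proof (rule integral_mono)
      show "integrable lborel (\<lambda>x. \<bar>B k x * (w (x + t *\<^sub>R ?e) - w x)\<bar>)" using iBs[OF iw w(3)] by simp
      show "integrable lborel (\<lambda>x. \<bar>B k x * (\<psi> m (x + t *\<^sub>R ?e) - \<psi> m x)\<bar> + \<bar>B k (x + t *\<^sub>R ?e) * ?h (x + t *\<^sub>R ?e)\<bar> + \<bar>B k x * ?h x\<bar>)"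
        using i\<psi>s sh iBh by (intro Bochner_Integration.integrable_add integrable_abs) auto
      fix x
      have "B k x * (w (x + t *\<^sub>R ?e) - w x) = B k x * (\<psi> m (x + t *\<^sub>R ?e) - \<psi> m x) +
         B k (x + t *\<^sub>R ?e) * ?h (x + t *\<^sub>R ?e) - B k x * ?h x" by (simp add: inv algebra_simps)
      then show "\<bar>B k x * (w (x + t *\<^sub>R ?e) - w x)\<bar> \<le> \<bar>B k x * (\<psi> m (x + t *\<^sub>R ?e) - \<psi> m x)\<bar> +
         \<bar>B k (x + t *\<^sub>R ?e) * ?h (x + t *\<^sub>R ?e)\<bar> + \<bar>B k x * ?h x\<bar>" by linarith
    qed
    also have "\<dots> = (LINT x|lborel. \<bar>B k x * (\<psi> m (x + t *\<^sub>R ?e) - \<psi> m x)\<bar>) +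
       (LINT x|lborel. \<bar>B k (x + t *\<^sub>R ?e) * ?h (x + t *\<^sub>R ?e)\<bar>) + (LINT x|lborel. \<bar>B k x * ?h x\<bar>)"
      using i\<psi>s sh iBh by simp
    also have "(LINT x|lborel. \<bar>B k (x + t *\<^sub>R ?e) * ?h (x + t *\<^sub>R ?e)\<bar>) = (LINT x|lborel. \<bar>B k x * ?h x\<bar>)"
      by (rule lborel_integral_shift[where g="\<lambda>x. \<bar>B k x * ?h x\<bar>"]) measurable
    also have "(LINT x|lborel. \<bar>B k x * (\<psi> m (x + t *\<^sub>R ?e) - \<psi> m x)\<bar>) + (LINT x|lborel. \<bar>B k x * ?h x\<bar>) + (LINT x|lborel. \<bar>B k x * ?h x\<bar>)
      \<le> t * ((LINT x|?M. norm (g x)) + (LINT x|?M. norm (g x - \<gamma> m x))) + 2 * C * (LINT x|?M. norm (v x - \<psi> m x))"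
      using order_trans[OF \<psi>est mult_left_mono[OF \<gamma>n t], of m] iB(2)[OF ih zh] diff[of m] by simp
    finally show ?thesis .
  qed
  have "(\<lambda>m. t * ((LINT x|?M. norm (g x)) + (LINT x|?M. norm (g x - \<gamma> m x))) + 2 * C * (LINT x|?M. norm (v x - \<psi> m x)))
    \<longlonglongrightarrow> t * ((LINT x|?M. norm (g x)) + 0) + 2 * C * 0"
    by (intro tendsto_intros l1 l2)
  then have "(\<lambda>m. t * ((LINT x|?M. norm (g x)) + (LINT x|?M. norm (g x - \<gamma> m x))) + 2 * C * (LINT x|?M. norm (v x - \<psi> m x)))
    \<longlonglongrightarrow> t * (LINT x|?M. norm (g x))" by simp
  from LIMSEQ_le_const[OF this] est
  show "(LINT x|lborel. \<bar>B k x * (w (x + t *\<^sub>R ?e) - w x)\<bar>) \<le> t * (LINT x|?M. norm (g x))" by blast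
qed

section \<open>A Faber-Krahn inequality\<close>

text \<open>Here \<open>G\<close> stands for the integral of the norm of the degenerate gradient:
  the inequalities below see the gradient only through its control of translations.\<close>

context
  fixes w :: "real^'n \<Rightarrow> real" and G :: real
  assumes wint: "integrable lborel w" and G0: "G \<ge> 0"
    and shift: "\<And>k t. t \<ge> 0 \<Longrightarrow> (LINT x|lborel. \<bar>B k x * (w (x + t *\<^sub>R axis k 1) - w x)\<bar>) \<le> t * G"
    and shint: "\<And>k t. t \<ge> 0 \<Longrightarrow> integrable lborel (\<lambda>x. B k x * (w (x + t *\<^sub>R axis k 1) - w x))"
begin

lemma w_measurable[measurable]: "w \<in> borel_measurable borel"
  using borel_measurable_integrable[OF wint] by simp

lemma shift_signed: "(\<integral>\<^sup>+x. ennreal \<bar>B k x * (w (x + t *\<^sub>R axis k 1) - w x)\<bar> \<partial>lborel) \<le> ennreal (\<bar>t\<bar> * G)"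
proof -
  let ?e = "axis k 1 :: real^'n"
  have pos: "(\<integral>\<^sup>+x. ennreal \<bar>B k x * (w (x + t *\<^sub>R ?e) - w x)\<bar> \<partial>lborel) \<le> ennreal (\<bar>t\<bar> * G)" if "t \<ge> 0" for t
    using shint[OF that, of k] shift[OF that, of k] that
    by (subst nn_integral_eq_integral) (auto intro!: ennreal_leI)
  show ?thesis
  proof (cases "t \<ge> 0")
    case False
    have "(\<integral>\<^sup>+x. ennreal \<bar>B k x * (w (x + t *\<^sub>R ?e) - w x)\<bar> \<partial>lborel) =
       (\<integral>\<^sup>+x. ennreal \<bar>B k (x + (- t) *\<^sub>R ?e) * (w ((x + (- t) *\<^sub>R ?e) + t *\<^sub>R ?e) - w (x + (- t) *\<^sub>R ?e))\<bar> \<partial>lborel)"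
      by (rule nn_integral_lborel_shift[symmetric]) measurable
    also have "\<dots> = (\<integral>\<^sup>+x. ennreal \<bar>B k x * (w (x + (- t) *\<^sub>R ?e) - w x)\<bar> \<partial>lborel)"
      by (simp only: inv) (simp add: abs_mult abs_minus_commute)
    also have "\<dots> \<le> ennreal (\<bar>- t\<bar> * G)" using False by (intro pos) simp
    finally show ?thesis by simp
  qed (rule pos)
qed

text \<open>In every direction except \<open>iN\<close> the weight is 1, so the estimates for single
  shifts add up by telescoping along the coordinates.\<close>

lemma multi_shift:
  assumes "finite I" "iN \<notin> I"
  shows "(\<integral>\<^sup>+x. ennreal \<bar>w (x + (\<Sum>i\<in>I. h i *\<^sub>R axis i 1)) - w x\<bar> \<partial>lborel) \<le> ennreal ((\<Sum>i\<in>I. \<bar>h i\<bar>) * G)"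
  using assms
proof (induction I)
  case (insert i I)
  let ?S = "\<Sum>i\<in>I. h i *\<^sub>R (axis i 1 :: real^'n)" and ?e = "axis i 1 :: real^'n"
  have "(\<integral>\<^sup>+x. ennreal \<bar>w (x + (\<Sum>i\<in>insert i I. h i *\<^sub>R axis i 1)) - w x\<bar> \<partial>lborel) \<le>
    (\<integral>\<^sup>+x. ennreal \<bar>w ((x + ?S) + h i *\<^sub>R ?e) - w (x + ?S)\<bar> + ennreal \<bar>w (x + ?S) - w x\<bar> \<partial>lborel)"
    using insert(1,2) by (intro nn_integral_mono) (simp add: ennreal_plus[symmetric] add_ac del: ennreal_plus)
  also have "\<dots> = (\<integral>\<^sup>+x. ennreal \<bar>w ((x + ?S) + h i *\<^sub>R ?e) - w (x + ?S)\<bar> \<partial>lborel) + (\<integral>\<^sup>+x. ennreal \<bar>w (x + ?S) - w x\<bar> \<partial>lborel)"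
    by (rule nn_integral_add) measurable
  also have "(\<integral>\<^sup>+x. ennreal \<bar>w ((x + ?S) + h i *\<^sub>R ?e) - w (x + ?S)\<bar> \<partial>lborel) = (\<integral>\<^sup>+x. ennreal \<bar>w (x + h i *\<^sub>R ?e) - w x\<bar> \<partial>lborel)"
    by (rule nn_integral_lborel_shift[where g="\<lambda>x. ennreal \<bar>w (x + h i *\<^sub>R ?e) - w x\<bar>"]) measurable
  also have "\<dots> \<le> ennreal (\<bar>h i\<bar> * G)"
    using shift_signed[of i "h i"] insert.prems by (auto simp: B_eq)
  also have "ennreal (\<bar>h i\<bar> * G) + (\<integral>\<^sup>+x. ennreal \<bar>w (x + ?S) - w x\<bar> \<partial>lborel) \<le> ennreal (\<bar>h i\<bar> * G) + ennreal ((\<Sum>i\<in>I. \<bar>h i\<bar>) * G)"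
    using insert by (intro add_left_mono) auto
  also have "\<dots> = ennreal ((\<Sum>i\<in>insert i I. \<bar>h i\<bar>) * G)"
    using insert(1,2) G0 by (subst ennreal_plus[symmetric]) (auto simp: distrib_right sum_nonneg)
  finally show ?case by simp
qed simp

text \<open>Averaging over translations \<open>h\<close> in a box of twice the measure of the support: most translates leave
  the support.  Moving first by at least \<open>\<delta>\<close> away from the degenerate hyperplane makes the shift in
  direction \<open>iN\<close> affordable.\<close>

lemma half_space_faber_krahn:
  fixes \<delta> m \<rho> \<tau> :: real
  assumes supp: "\<And>x. w x \<noteq> 0 \<Longrightarrow> \<bar>x $ i1\<bar> \<le> \<rho>" and fin: "emeasure lborel {x. w x \<noteq> 0} \<le> ennreal (\<delta> ^ CARD('n) * m / 2)"
    and m: "m > 0" "\<delta> > 0" "\<And>s. \<delta> \<le> \<bar>s\<bar> \<Longrightarrow> \<bar>s\<bar> \<le> \<rho> \<Longrightarrow> m \<le> \<bar>f s\<bar>"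
    and \<tau>: "\<tau> = 1 \<or> \<tau> = (-1::real)"
  shows "(\<integral>\<^sup>+x. indicator {x. \<tau> * x $ i1 \<ge> 0} x * ennreal \<bar>w x\<bar> \<partial>lborel) \<le> ennreal (2 * (2 * CARD('n) + 1) * \<delta> * G)"
proof -
  let ?n = "CARD('n)" and ?N = "axis iN 1 :: real^'n"
  define H where "H = {x::real^'n. \<tau> * x $ i1 \<ge> 0}"
  have [measurable]: "H \<in> sets borel" unfolding H_def by measurable
  \<comment> \<open>The first coordinate of a translation lies between \<delta> and 2 \<delta> in
    absolute value and has the sign \<open>\<tau>\<close>, so it points away from the hyperplane on
    the given half-space. The side in direction \<open>iN\<close> is shortened to \<delta> m to pay
    for the weight.\<close>
  define a :: "real^'n" where "a = (\<chi> i. if i = i1 then (if \<tau> = 1 then \<delta> else - 2 * \<delta>) else 0)"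
  define c :: "real^'n" where "c = (\<chi> i. if i = i1 then (if \<tau> = 1 then 2 * \<delta> else - \<delta>) else if i = iN then \<delta> * m else \<delta>)"
  define q where "q = \<delta> ^ ?n * m"
  define K where "K = (2 * real ?n + 1) * \<delta> * G"
  have K0: "0 \<le> K" using m G0 by (simp add: K_def)
  have q0: "q > 0" using m by (simp add: q_def)
  have diff: "c $ i - a $ i = (if i = iN then \<delta> * m else \<delta>)" for i
    using i1_iN \<tau> by (auto simp: a_def c_def)
  have "0 < c $ i - a $ i" for i unfolding diff using m by simp
  then have le: "a $ i \<le> c $ i" for i by (simp add: less_imp_le)
  have emQ: "emeasure lborel (cbox a c) = ennreal q"
  proof -
    have ne: "cbox a c \<noteq> {}" using le by (auto simp: interval_ne_empty_cart)
    have "measure lborel (cbox a c) = (\<Prod>i\<in>UNIV. c $ i - a $ i)" using content_cbox_cart[OF ne] .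
    also have "\<dots> = (\<delta> * m) * (\<Prod>i\<in>UNIV - {iN}. \<delta>)"
      unfolding diff by (subst prod.remove[of _ iN]) auto
    also have "\<dots> = (\<delta> * m) * \<delta> ^ (?n - 1)" by (simp add: card_Diff_singleton)
    also have "\<dots> = q" unfolding q_def using power_minus_mult[of ?n \<delta>] by (simp add: ac_simps)
    finally have "measure lborel (cbox a c) = q" .
    moreover have "emeasure lborel (cbox a c) = ennreal (measure lborel (cbox a c))"
      using emeasure_lborel_cbox_finite[of a c] by (intro emeasure_eq_ennreal_measure) auto
    ultimately show ?thesis by simp
  qed
  have per_h: "(\<integral>\<^sup>+x. indicator H x * ennreal \<bar>w (x + h) - w x\<bar> \<partial>lborel) \<le> ennreal K" if h: "h \<in> cbox a c" for h
  proof -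
    have hb: "a $ i \<le> h $ i" "h $ i \<le> c $ i" for i using h by (auto simp: mem_box_cart)
    define S where "S = (\<Sum>i\<in>UNIV - {iN}. h $ i *\<^sub>R (axis i 1 :: real^'n))"
    have Si: "S $ i = (if i = iN then 0 else h $ i)" for i
    proof -
      have "S $ i = (\<Sum>j\<in>UNIV - {iN}. h $ j * (axis j 1 :: real^'n) $ i)" by (simp add: S_def)
      also have "\<dots> = (\<Sum>j\<in>UNIV - {iN}. if j = i then h $ j else 0)"
        by (intro sum.cong) (simp_all add: axis_def)
      finally show ?thesis by (simp add: sum.delta)
    qed
    have hS: "h = S + h $ iN *\<^sub>R ?N" by (auto simp: vec_eq_iff Si axis_def)
    \<comment> \<open>After the shift by \<open>S\<close> the first coordinate is at least \<delta>
      in absolute value. There |f| \<ge> m on the support, so the unweighted difference in direction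
      \<open>iN\<close> is at most 1/m times the weighted one, and the length at most \<delta> m of
      this shift cancels the 1/m.\<close>
    let ?p = "\<lambda>y. indicator {y. \<delta> \<le> \<bar>y $ i1\<bar>} y * ennreal \<bar>w (y + h $ iN *\<^sub>R ?N) - w y\<bar>"
    have far: "\<delta> \<le> \<bar>(x + S) $ i1\<bar>" if "x \<in> H" for x
      using that \<tau> hb[of i1] m(2) i1_iN by (auto simp: H_def Si a_def c_def split: if_splits)
    have "(\<integral>\<^sup>+x. indicator H x * ennreal \<bar>w (x + h) - w x\<bar> \<partial>lborel) \<le>
       (\<integral>\<^sup>+x. ?p (x + S) + ennreal \<bar>w (x + S) - w x\<bar> \<partial>lborel)"
    proof (rule nn_integral_mono)
      fix x
      have "\<bar>w (x + h) - w x\<bar> \<le> \<bar>w (x + S + h $ iN *\<^sub>R ?N) - w (x + S)\<bar> + \<bar>w (x + S) - w x\<bar>"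
        using hS by (metis abs_triangle_ineq add.assoc diff_add_cancel add_diff_eq)
      then have "ennreal \<bar>w (x + h) - w x\<bar> \<le> ennreal \<bar>w (x + S + h $ iN *\<^sub>R ?N) - w (x + S)\<bar> + ennreal \<bar>w (x + S) - w x\<bar>"
        by (simp add: ennreal_plus[symmetric] ennreal_leI del: ennreal_plus)
      then show "indicator H x * ennreal \<bar>w (x + h) - w x\<bar> \<le> ?p (x + S) + ennreal \<bar>w (x + S) - w x\<bar>"
        using far[of x] by (cases "x \<in> H") auto
    qed
    also have "\<dots> = (\<integral>\<^sup>+x. ?p (x + S) \<partial>lborel) + (\<integral>\<^sup>+x. ennreal \<bar>w (x + S) - w x\<bar> \<partial>lborel)"
      by (rule nn_integral_add) measurable
    also have "(\<integral>\<^sup>+x. ?p (x + S) \<partial>lborel) = (\<integral>\<^sup>+x. ?p x \<partial>lborel)"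
      by (rule nn_integral_lborel_shift[where g="?p"]) measurable
    also have "\<dots> \<le> (\<integral>\<^sup>+x. ennreal (1 / m) * ennreal \<bar>B iN x * (w (x + h $ iN *\<^sub>R ?N) - w x)\<bar> \<partial>lborel)"
    proof (rule nn_integral_mono)
      fix y
      show "?p y \<le> ennreal (1 / m) * ennreal \<bar>B iN y * (w (y + h $ iN *\<^sub>R ?N) - w y)\<bar>"
      proof (cases "\<delta> \<le> \<bar>y $ i1\<bar> \<and> w (y + h $ iN *\<^sub>R ?N) - w y \<noteq> 0")
        case True
        then have "w (y + h $ iN *\<^sub>R ?N) \<noteq> 0 \<or> w y \<noteq> 0" by auto
        then have "\<bar>y $ i1\<bar> \<le> \<rho>"
          using supp[of y] supp[of "y + h $ iN *\<^sub>R ?N"] i1_iN by (auto simp: axis_def)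
        then have "m \<le> \<bar>B iN y\<bar>" using m(3) True by (simp add: B_eq)
        then have "1 * \<bar>w (y + h $ iN *\<^sub>R ?N) - w y\<bar> \<le> (1 / m * \<bar>B iN y\<bar>) * \<bar>w (y + h $ iN *\<^sub>R ?N) - w y\<bar>"
          using m(1) by (intro mult_right_mono) (auto simp: field_simps)
        then show ?thesis using True m(1)
          by (simp add: ennreal_mult[symmetric] abs_mult mult.assoc ennreal_leI)
      qed auto
    qed
    also have "\<dots> = ennreal (1 / m) * (\<integral>\<^sup>+x. ennreal \<bar>B iN x * (w (x + h $ iN *\<^sub>R ?N) - w x)\<bar> \<partial>lborel)"
      by (rule nn_integral_cmult) measurable
    also have "\<dots> \<le> ennreal (1 / m) * ennreal (\<bar>h $ iN\<bar> * G)"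
      by (intro mult_left_mono shift_signed) auto
    also have "\<dots> = ennreal (\<bar>h $ iN\<bar> * G / m)"
      using m(1) G0 by (subst ennreal_mult[symmetric]) (auto simp: field_simps)
    also have "\<dots> \<le> ennreal (\<delta> * G)"
    proof (rule ennreal_leI)
      have "\<bar>h $ iN\<bar> \<le> \<delta> * m" using hb[of iN] i1_iN by (auto simp: a_def c_def)
      then have "\<bar>h $ iN\<bar> * G \<le> \<delta> * m * G" using G0 by (intro mult_right_mono)
      then show "\<bar>h $ iN\<bar> * G / m \<le> \<delta> * G" using m(1) by (simp add: field_simps)
    qed
    also have "(\<integral>\<^sup>+x. ennreal \<bar>w (x + S) - w x\<bar> \<partial>lborel) \<le> ennreal ((\<Sum>i\<in>UNIV - {iN}. \<bar>h $ i\<bar>) * G)"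
      unfolding S_def by (rule multi_shift) auto
    also have "\<dots> \<le> ennreal (2 * real ?n * \<delta> * G)"
    proof (rule ennreal_leI, rule mult_right_mono[OF _ G0])
      have "(\<Sum>i\<in>UNIV - {iN}. \<bar>h $ i\<bar>) \<le> (\<Sum>i\<in>UNIV - {iN}. 2 * \<delta>)"
      proof (rule sum_mono)
        fix i assume "i \<in> UNIV - {iN}"
        then show "\<bar>h $ i\<bar> \<le> 2 * \<delta>" using hb[of i] m(2) by (auto simp: a_def c_def split: if_splits)
      qed
      also have "\<dots> \<le> (\<Sum>i\<in>(UNIV::'n set). 2 * \<delta>)" using m(2) by (intro sum_mono2) auto
      finally show "(\<Sum>i\<in>UNIV - {iN}. \<bar>h $ i\<bar>) \<le> 2 * real ?n * \<delta>" by simp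
    qed
    finally have "(\<integral>\<^sup>+x. indicator H x * ennreal \<bar>w (x + h) - w x\<bar> \<partial>lborel) \<le> ennreal (\<delta> * G) + ennreal (2 * real ?n * \<delta> * G)"
      by (simp add: add_mono)
    also have "\<dots> = ennreal K" using m G0 by (subst ennreal_plus[symmetric]) (auto simp: K_def algebra_simps)
    finally show ?thesis .
  qed
  \<comment> \<open>For \<open>h\<close> outside \<open>?E\<close> the translate has left the
    support and the difference is |w x|; \<open>?E\<close> occupies at most half of the box.\<close>
  have per_x: "ennreal \<bar>w x\<bar> * ennreal (q / 2) \<le> (\<integral>\<^sup>+h. indicator (cbox a c) h * ennreal \<bar>w (x + h) - w x\<bar> \<partial>lborel)" for x
  proof -
    let ?E = "{h. w (h + x) \<noteq> 0}"
    have E[measurable]: "?E \<in> sets borel" by measurable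
    have "emeasure lborel ?E = (\<integral>\<^sup>+h. indicator ?E h \<partial>lborel)" by (rule nn_integral_indicator[symmetric]) simp
    also have "\<dots> = (\<integral>\<^sup>+h. indicator {y. w y \<noteq> 0} (h + x) \<partial>lborel)"
      by (intro nn_integral_cong) (simp add: indicator_def)
    also have "\<dots> = (\<integral>\<^sup>+h. indicator {y. w y \<noteq> 0} h \<partial>lborel)" by (rule nn_integral_lborel_shift) measurable
    also have "\<dots> = emeasure lborel {y. w y \<noteq> 0}" by (rule nn_integral_indicator) simp
    finally have mE: "emeasure lborel ?E \<le> ennreal (q / 2)" using fin by (simp add: q_def)
    have "ennreal q \<le> emeasure lborel ((cbox a c - ?E) \<union> ?E)"
      unfolding emQ[symmetric] by (intro emeasure_mono) auto
    also have "\<dots> \<le> emeasure lborel (cbox a c - ?E) + emeasure lborel ?E" by (intro emeasure_subadditive) auto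
    also have "\<dots> \<le> emeasure lborel (cbox a c - ?E) + ennreal (q / 2)" using mE by (rule add_left_mono)
    finally have "ennreal (q / 2) \<le> emeasure lborel (cbox a c - ?E)"
    proof (cases "emeasure lborel (cbox a c - ?E)")
      case (real r)
      assume "ennreal q \<le> emeasure lborel (cbox a c - ?E) + ennreal (q / 2)"
      then have "ennreal q \<le> ennreal (r + q / 2)" using real q0 by simp
      then have "q \<le> r + q / 2" using real q0 by (subst (asm) ennreal_le_iff) auto
      then show ?thesis using real by (simp add: ennreal_leI)
    qed simp
    then have "ennreal \<bar>w x\<bar> * ennreal (q / 2) \<le> ennreal \<bar>w x\<bar> * emeasure lborel (cbox a c - ?E)"
      by (rule mult_left_mono) simp
    also have "\<dots> = (\<integral>\<^sup>+h. ennreal \<bar>w x\<bar> * indicator (cbox a c - ?E) h \<partial>lborel)"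
      by (rule nn_integral_cmult_indicator[symmetric]) simp
    also have "\<dots> \<le> (\<integral>\<^sup>+h. indicator (cbox a c) h * ennreal \<bar>w (x + h) - w x\<bar> \<partial>lborel)"
      by (intro nn_integral_mono) (auto simp: indicator_def add.commute)
    finally show ?thesis .
  qed
  \<comment> \<open>By Tonelli the double integral over the half-space and the box is at least q/2
    times the integral sought, and at most \<open>K\<close> times \<open>q\<close>.\<close>
  have "(\<integral>\<^sup>+x. indicator H x * ennreal \<bar>w x\<bar> \<partial>lborel) * ennreal (q / 2) =
     (\<integral>\<^sup>+x. indicator H x * ennreal \<bar>w x\<bar> * ennreal (q / 2) \<partial>lborel)"
    by (rule nn_integral_multc[symmetric]) measurable
  also have "\<dots> \<le> (\<integral>\<^sup>+x. indicator H x * (\<integral>\<^sup>+h. indicator (cbox a c) h * ennreal \<bar>w (x + h) - w x\<bar> \<partial>lborel) \<partial>lborel)"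
    unfolding mult.assoc by (intro nn_integral_mono mult_left_mono per_x) auto
  also have "\<dots> = (\<integral>\<^sup>+x. \<integral>\<^sup>+h. indicator H x * (indicator (cbox a c) h * ennreal \<bar>w (x + h) - w x\<bar>) \<partial>lborel \<partial>lborel)"
    by (intro nn_integral_cong nn_integral_cmult[symmetric]) measurable
  also have "\<dots> = (\<integral>\<^sup>+h. \<integral>\<^sup>+x. indicator H x * (indicator (cbox a c) h * ennreal \<bar>w (x + h) - w x\<bar>) \<partial>lborel \<partial>lborel)"
    by (rule lborel_pair.Fubini'[symmetric]) measurable
  also have "\<dots> \<le> (\<integral>\<^sup>+h. ennreal K * indicator (cbox a c) h \<partial>lborel)"
  proof (rule nn_integral_mono)
    fix h :: "real^'n"
    show "(\<integral>\<^sup>+x. indicator H x * (indicator (cbox a c) h * ennreal \<bar>w (x + h) - w x\<bar>) \<partial>lborel) \<le> ennreal K * indicator (cbox a c) h"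
      using per_h[of h] by (cases "h \<in> cbox a c") auto
  qed
  also have "\<dots> = ennreal K * ennreal q" using emQ by (subst nn_integral_cmult_indicator) auto
  also have "\<dots> = ennreal (2 * K) * ennreal (q / 2)" using K0 q0 by (simp add: ennreal_mult[symmetric])
  finally have "(\<integral>\<^sup>+x. indicator H x * ennreal \<bar>w x\<bar> \<partial>lborel) * ennreal (q / 2) \<le> ennreal (2 * K) * ennreal (q / 2)" .
  then have "(\<integral>\<^sup>+x. indicator H x * ennreal \<bar>w x\<bar> \<partial>lborel) \<le> ennreal (2 * K)"
    using q0 by (subst (asm) ennreal_mult_le_mult_iff[of "ennreal (q/2)", unfolded mult.commute[of "ennreal (q/2)"]]) auto
  moreover have "2 * K = 2 * (2 * CARD('n) + 1) * \<delta> * G" by (simp add: K_def algebra_simps)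
  ultimately show ?thesis by (simp only: H_def)
qed

lemma faber_krahn:
  fixes \<delta> m \<rho> :: real
  assumes supp: "\<And>x. w x \<noteq> 0 \<Longrightarrow> \<bar>x $ i1\<bar> \<le> \<rho>" and fin: "emeasure lborel {x. w x \<noteq> 0} \<le> ennreal (\<delta> ^ CARD('n) * m / 2)"
    and m: "m > 0" "\<delta> > 0" "\<And>s. \<delta> \<le> \<bar>s\<bar> \<Longrightarrow> \<bar>s\<bar> \<le> \<rho> \<Longrightarrow> m \<le> \<bar>f s\<bar>"
  shows "(LINT x|lborel. \<bar>w x\<bar>) \<le> 4 * (2 * CARD('n) + 1) * \<delta> * G"
proof -
  let ?c = "2 * (2 * CARD('n) + 1) * \<delta> * G"
  have c0: "0 \<le> ?c" using m G0 by simp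
  have "ennreal (LINT x|lborel. \<bar>w x\<bar>) = (\<integral>\<^sup>+x. ennreal \<bar>w x\<bar> \<partial>lborel)"
    using wint by (subst nn_integral_eq_integral) auto
  also have "\<dots> \<le> (\<integral>\<^sup>+x. indicator {x. 1 * x $ i1 \<ge> 0} x * ennreal \<bar>w x\<bar> + indicator {x. (-1) * x $ i1 \<ge> 0} x * ennreal \<bar>w x\<bar> \<partial>lborel)"
    by (intro nn_integral_mono) (auto simp: indicator_def)
  also have "\<dots> = (\<integral>\<^sup>+x. indicator {x. 1 * x $ i1 \<ge> 0} x * ennreal \<bar>w x\<bar> \<partial>lborel) + (\<integral>\<^sup>+x. indicator {x. (-1) * x $ i1 \<ge> 0} x * ennreal \<bar>w x\<bar> \<partial>lborel)"
    by (rule nn_integral_add) measurable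
  also have "\<dots> \<le> ennreal ?c + ennreal ?c"
    by (intro add_mono half_space_faber_krahn[OF supp fin m]) auto
  also have "\<dots> = ennreal (?c + ?c)" by (rule ennreal_plus[OF c0 c0, symmetric])
  finally have le: "ennreal (LINT x|lborel. \<bar>w x\<bar>) \<le> ennreal (?c + ?c)" .
  have "0 \<le> ?c + ?c" using c0 by (rule add_nonneg_nonneg[OF _ c0])
  with le have "(LINT x|lborel. \<bar>w x\<bar>) \<le> ?c + ?c" using ennreal_le_iff by blast
  then show ?thesis by (simp add: algebra_simps)
qed

text \<open>A shift by 3 \<rho> > 2 \<rho> in direction \<open>i1\<close>, where the weight is 1,
  moves the slab containing the support off itself. No smallness of the support is required, so this
  starts the iteration.\<close>

lemma poincare:
  assumes supp: "\<And>x. w x \<noteq> 0 \<Longrightarrow> \<bar>x $ i1\<bar> \<le> \<rho>" and \<rho>: "\<rho> > 0"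
  shows "(LINT x|lborel. \<bar>w x\<bar>) \<le> 3 * \<rho> * G"
proof -
  let ?e = "axis i1 1 :: real^'n"
  have s: "integrable lborel (\<lambda>x. \<bar>w (x + (3 * \<rho>) *\<^sub>R ?e) - w x\<bar>)" using integrable_lborel_shift[OF wint] wint by auto
  have "(LINT x|lborel. \<bar>w x\<bar>) \<le> (LINT x|lborel. \<bar>w (x + (3 * \<rho>) *\<^sub>R ?e) - w x\<bar>)"
  proof (rule integral_mono)
    fix x
    show "\<bar>w x\<bar> \<le> \<bar>w (x + (3 * \<rho>) *\<^sub>R ?e) - w x\<bar>"
    proof (cases "w x = 0")
      case False
      then have "\<bar>x $ i1\<bar> \<le> \<rho>" by (rule supp)
      then have "w (x + (3 * \<rho>) *\<^sub>R ?e) = 0" using supp[of "x + (3 * \<rho>) *\<^sub>R ?e"] \<rho>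
        by (cases "w (x + (3 * \<rho>) *\<^sub>R ?e) = 0") (simp_all add: axis_def)
      then show ?thesis by simp
    qed simp
  qed (use wint s in auto)
  also have "\<dots> \<le> 3 * \<rho> * G" using shift[of "3 * \<rho>" i1] \<rho> i1_iN by (simp add: B_eq)
  finally show ?thesis .
qed

end

section \<open>De Giorgi iteration\<close>

text \<open>The matrix is the square of \<open>B\<close>, and the weak gradient is the degenerate
  one divided by \<open>B\<close>, so the weights cancel. The hyperplane is excluded because
  division by a vanishing weight would return 0.\<close>

lemma quadratic_form_weak_gradient:
  assumes "x $ i1 \<noteq> 0"
  shows "weak_gradient i1 iN f \<Omega> u x \<bullet> (degeneracy_A i1 iN f x *v weak_gradient i1 iN f \<Omega> u x) =
    (norm (A_gradient i1 iN f \<Omega> u x))\<^sup>2"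
proof -
  let ?\<xi> = "weak_gradient i1 iN f \<Omega> u x" and ?g = "A_gradient i1 iN f \<Omega> u x"
  have nz: "B k x \<noteq> 0" for k using assms f_nz by (simp add: B_eq)
  have "(degeneracy_A i1 iN f x *v ?\<xi>) $ k = (B k x)\<^sup>2 * ?\<xi> $ k" for k
  proof -
    have "(degeneracy_A i1 iN f x *v ?\<xi>) $ k = (\<Sum>j\<in>UNIV. degeneracy_A i1 iN f x $ k $ j * ?\<xi> $ j)"
      by (simp add: matrix_vector_mult_def)
    also have "\<dots> = (\<Sum>j\<in>UNIV. if j = k then (B k x)\<^sup>2 * ?\<xi> $ k else 0)"
      by (rule sum.cong) (auto simp: degeneracy_A_def diag_last_def B_eq)
    finally show ?thesis by simp
  qed
  then have "?\<xi> \<bullet> (degeneracy_A i1 iN f x *v ?\<xi>) = (\<Sum>k\<in>UNIV. ?\<xi> $ k * ((B k x)\<^sup>2 * ?\<xi> $ k))"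
    by (simp add: inner_vec_def)
  also have "\<dots> = (\<Sum>k\<in>UNIV. ?g $ k * ?g $ k)"
    using nz by (intro sum.cong) (simp_all add: weak_gradient_def power2_eq_square)
  also have "\<dots> = ?g \<bullet> ?g" by (simp add: inner_vec_def)
  finally show ?thesis by (simp add: power2_norm_eq_inner)
qed

definition super_level :: "(real^'n) set \<Rightarrow> (real^'n \<Rightarrow> real) \<Rightarrow> real \<Rightarrow> real" where
  "super_level \<Omega> u k = measure (lebesgue_on \<Omega>) {x\<in>\<Omega>. u x > k}"

lemma X_norm_bound:
  assumes w: "w \<in> W1p_0 i1 iN f \<Omega> 1" and X: "X_norm i1 iN f \<Omega> \<phi> \<le> ennreal N" and N: "0 \<le> N"
    and i1: "integrable (lebesgue_on \<Omega>) (\<lambda>x. w x * \<phi> x)"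
    and i2: "integrable (lebesgue_on \<Omega>) (A_gradient i1 iN f \<Omega> w)"
  shows "(LINT x|lebesgue_on \<Omega>. \<bar>w x * \<phi> x\<bar>) \<le> N * (LINT x|lebesgue_on \<Omega>. norm (A_gradient i1 iN f \<Omega> w x))"
proof -
  let ?P = "LINT x|lebesgue_on \<Omega>. \<bar>w x * \<phi> x\<bar>" and ?I = "LINT x|lebesgue_on \<Omega>. norm (A_gradient i1 iN f \<Omega> w x)"
  have P: "(\<integral>\<^sup>+x. ennreal \<bar>w x * \<phi> x\<bar> \<partial>lebesgue_on \<Omega>) = ennreal ?P"
    using i1 by (intro nn_integral_eq_integral) auto
  have I: "(\<integral>\<^sup>+x. ennreal (norm (A_gradient i1 iN f \<Omega> w x)) \<partial>lebesgue_on \<Omega>) = ennreal ?I"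
    using i2 by (intro nn_integral_eq_integral) auto
  have P0: "0 \<le> ?P" "0 \<le> ?I" by (simp_all add: integral_nonneg)
  have "ennreal ?P / ennreal ?I \<le> X_norm i1 iN f \<Omega> \<phi>"
    unfolding X_norm_def P[symmetric] I[symmetric] using w by (rule SUP_upper)
  then have le: "ennreal ?P / ennreal ?I \<le> ennreal N" using X by (rule order_trans)
  show ?thesis
  proof (cases "?I = 0")
    \<comment> \<open>A positive numerator over 0 is \<open>top\<close> in \<open>ennreal\<close>,
      which the finite norm rules out.\<close>
    case True
    have "?P = 0"
    proof (rule ccontr)
      assume "?P \<noteq> 0"
      then have "?P > 0" using P0(1) by linarith
      then have "ennreal ?P / ennreal ?I = top" using True by (simp add: ennreal_divide_eq_top_iff)
      with le show False by (simp add: top_unique)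
    qed
    then show ?thesis using True by simp
  next
    case False
    then have pos: "?I > 0" using P0(2) by linarith
    then have "ennreal (?P / ?I) \<le> ennreal N" using le P0 by (simp add: divide_ennreal)
    then have "?P / ?I \<le> N" using N by (simp add: ennreal_le_iff)
    then show ?thesis using pos by (simp add: divide_le_eq)
  qed
qed

text \<open>With I and J the integrals of the norm of the gradient and of its square, ellipticity
  and admissibility give J \<le> K N I, while Cauchy-Schwarz gives I^2 \<le> |A| J. One factor I
  cancels, which is why the bound is linear in the measure.\<close>

lemma energy_estimate:
  assumes \<Omega>: "open \<Omega>" "bounded \<Omega>" and K: "K \<ge> 1" and N: "N \<ge> 0"
    and comp: "comparable_with K \<Omega> \<A> (degeneracy_A i1 iN f)"
    and X: "X_norm i1 iN f \<Omega> \<phi> \<le> ennreal N"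
    and sub: "weak_subsolution i1 iN f \<Omega> \<A> \<phi> u"
    and l: "weakly_bounded_on_boundary_by i1 iN f \<Omega> u l" and k: "l \<le> k"
  obtains g where "(\<lambda>x. max (u x - k) 0) \<in> W1p_0 i1 iN f \<Omega> 2" "H1 \<Omega> (\<lambda>x. max (u x - k) 0) g"
    "(LINT x|lebesgue_on \<Omega>. norm (g x)) \<le> K * N * super_level \<Omega> u k"
proof -
  let ?M = "lebesgue_on \<Omega>"
  have \<Omega>'[measurable]: "\<Omega> \<in> sets borel" using \<Omega> by simp
  have "u \<in> W1p i1 iN f \<Omega> 2" using sub by (simp add: weak_subsolution_def)
  then obtain g0 where "H1 \<Omega> u g0" using W1p_2_iff[OF \<Omega>] by blast
  define gu where "gu = A_gradient i1 iN f \<Omega> u"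
  have hu: "H1 \<Omega> u gu" unfolding gu_def using H1_A_gradient(1)[OF \<Omega>(1)] \<open>H1 \<Omega> u g0\<close> .
  define w where "w = (\<lambda>x. max (u x - k) 0)"
  \<comment> \<open>The truncation at \<open>k\<close> is the truncation of (u - l)^+ at height
    \<open>k - l\<close>, so zero boundary values are inherited from level \<open>l\<close>.\<close>
  have "(\<lambda>x. max (max (u x - l) 0 - (k - l)) 0) \<in> W1p_0 i1 iN f \<Omega> 2"
    using l k by (intro W1p_0_truncate[OF \<Omega>, of "\<lambda>x. max (u x - l) 0" "k - l"])
      (auto simp: weakly_bounded_on_boundary_by_def)
  moreover have "(\<lambda>x. max (max (u x - l) 0 - (k - l)) 0) = w" using k by (auto simp: w_def fun_eq_iff max_def)
  ultimately have w0: "w \<in> W1p_0 i1 iN f \<Omega> 2" by simp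
  define gw where "gw = (\<lambda>x. if u x > k then gu x else 0)"
  have hw: "H1 \<Omega> w gw" unfolding w_def gw_def by (rule H1_pos[OF \<Omega> hu])
  have ew: "AE x in ?M. A_gradient i1 iN f \<Omega> w x = gw x"
    using A_gradient_eq[OF \<Omega>(1)] hw by (simp add: H1_def)
  have hwA: "H1 \<Omega> w (A_gradient i1 iN f \<Omega> w)" by (rule H1_A_gradient(1)[OF \<Omega>(1) hw])
  note [measurable] = H1_measurable[OF hu] H1_measurable[OF hw]
  let ?I = "LINT x|?M. norm (gw x)" and ?J = "LINT x|?M. (norm (gw x))\<^sup>2"
  let ?q = "\<lambda>x. weak_gradient i1 iN f \<Omega> w x \<bullet> (\<A> x (u x) *v weak_gradient i1 iN f \<Omega> u x)"
  have iq: "integrable ?M ?q" and ip: "integrable ?M (\<lambda>x. \<phi> x * w x)"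
    and ineq: "(LINT x|?M. \<phi> x * w x) \<le> - (LINT x|?M. ?q x)"
    using sub w0 by (auto simp: weak_subsolution_def w_def)
  have iJ: "integrable ?M (\<lambda>x. (norm (gw x))\<^sup>2)" using hw by (simp add: H1_def)
  have igw: "integrable ?M gw" using hw by (simp add: H1_def wgrad_def)
  have nz: "AE x in ?M. x $ i1 \<noteq> 0"
    unfolding AE_lebesgue_on_iff[OF \<Omega>'] using AE_first_coordinate_nz by eventually_elim simp
  have "?J / K = (LINT x|?M. (norm (gw x))\<^sup>2 / K)" by simp
  also have "\<dots> \<le> (LINT x|?M. ?q x)"
  proof (rule integral_mono_AE)
    show "AE x in ?M. (norm (gw x))\<^sup>2 / K \<le> ?q x"
      using ew nz comp[unfolded comparable_with_def]
    proof eventually_elim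
      case (elim x)
      show ?case
      proof (cases "u x > k")
        case True
        then have "A_gradient i1 iN f \<Omega> w x = A_gradient i1 iN f \<Omega> u x" using elim(1) by (simp add: gw_def gu_def)
        then have "weak_gradient i1 iN f \<Omega> w x = weak_gradient i1 iN f \<Omega> u x" by (simp add: weak_gradient_def)
        moreover have "(norm (gw x))\<^sup>2 = weak_gradient i1 iN f \<Omega> u x \<bullet> (degeneracy_A i1 iN f x *v weak_gradient i1 iN f \<Omega> u x)"
          using quadratic_form_weak_gradient[OF elim(2)] True by (simp add: gw_def gu_def)
        ultimately show ?thesis using elim(3) by metis
      next
        case False
        then have "A_gradient i1 iN f \<Omega> w x = 0" using elim(1) by (simp add: gw_def)
        then have "weak_gradient i1 iN f \<Omega> w x = 0" by (simp add: weak_gradient_def vec_eq_iff)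
        then show ?thesis using False by (simp add: gw_def)
      qed
    qed
  qed (use iJ iq in auto)
  also have "\<dots> \<le> - (LINT x|?M. \<phi> x * w x)" using ineq by simp
  also have "\<dots> \<le> (LINT x|?M. \<bar>w x * \<phi> x\<bar>)"
  proof -
    have "\<bar>LINT x|?M. \<phi> x * w x\<bar> \<le> (LINT x|?M. \<bar>w x * \<phi> x\<bar>)"
      using integral_norm_bound[of ?M "\<lambda>x. \<phi> x * w x"] by (simp add: mult.commute)
    then show ?thesis by linarith
  qed
  also have "\<dots> \<le> N * (LINT x|?M. norm (A_gradient i1 iN f \<Omega> w x))"
    using ip hwA by (intro X_norm_bound[OF W1p_0_2_imp_1[OF \<Omega> w0] X N]) (auto simp: mult.commute H1_def wgrad_def)
  also have "(LINT x|?M. norm (A_gradient i1 iN f \<Omega> w x)) = ?I" by (rule H1_A_gradient(3)[OF \<Omega>(1) hw])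
  finally have J: "?J \<le> K * N * ?I" using K by (simp add: divide_le_eq mult.commute mult.left_commute)
  define A where "A = {x\<in>\<Omega>. u x > k}"
  have A[measurable]: "A \<in> sets ?M"
  proof -
    have "{x \<in> space ?M. u x > k} \<in> sets ?M" by measurable
    then show ?thesis by (simp add: A_def)
  qed
  have fin: "emeasure ?M A < \<infinity>"
  proof -
    have "emeasure ?M A \<le> emeasure ?M \<Omega>" by (intro emeasure_mono) (auto simp: A_def)
    also have "\<dots> < \<infinity>" by (rule finite_emeasure_lebesgue_on[OF \<Omega>])
    finally show ?thesis .
  qed
  have "?I\<^sup>2 \<le> measure ?M A * ?J"
  proof (rule Cauchy_Schwarz_on_set[OF A fin])
    show "AE x in ?M. x \<notin> A \<longrightarrow> norm (gw x) = 0" by (rule AE_I2) (auto simp: A_def gw_def)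
  qed (use igw iJ in auto)
  also have "\<dots> \<le> measure ?M A * (K * N * ?I)" using J by (intro mult_left_mono) auto
  \<comment> \<open>Cancelling \<open>?I\<close> needs the case \<open>?I = 0\<close>, where the
    claim is trivial.\<close>
  finally have "?I * ?I \<le> (K * N * measure ?M A) * ?I" by (simp add: power2_eq_square ac_simps)
  moreover have "0 \<le> ?I" by (simp add: integral_nonneg)
  ultimately have "?I \<le> K * N * measure ?M A"
    using K N by (cases "?I = 0") (auto simp: mult_le_cancel_right)
  then show thesis using that w0 hw unfolding w_def super_level_def A_def by blast
qed

text \<open>Chebyshev bounds the left side by the integral of (u - k)^+, and the energy estimate
  bounds its gradient. The Poincare inequality links the two unconditionally, Faber-Krahn with the
  small factor \<delta> once the level set is small.\<close>

lemma super_level_decay: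
  assumes \<Omega>: "open \<Omega>" "bounded \<Omega>" and K: "K \<ge> 1" and N: "N \<ge> 0"
    and comp: "comparable_with K \<Omega> \<A> (degeneracy_A i1 iN f)"
    and X: "X_norm i1 iN f \<Omega> \<phi> \<le> ennreal N"
    and sub: "weak_subsolution i1 iN f \<Omega> \<A> \<phi> u"
    and l: "weakly_bounded_on_boundary_by i1 iN f \<Omega> u l" and k: "l \<le> k" and h: "k < h"
    and \<rho>: "\<rho> > 0" "\<And>x. x \<in> \<Omega> \<Longrightarrow> \<bar>x $ i1\<bar> \<le> \<rho>"
  shows "(h - k) * super_level \<Omega> u h \<le> 3 * \<rho> * (K * N * super_level \<Omega> u k)"
    and "\<And>(\<delta>::real) (m::real). \<delta> > 0 \<Longrightarrow> m > 0 \<Longrightarrow> (\<And>s. \<delta> \<le> \<bar>s\<bar> \<Longrightarrow> \<bar>s\<bar> \<le> \<rho> \<Longrightarrow> m \<le> \<bar>f s\<bar>) \<Longrightarrow>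
      super_level \<Omega> u k \<le> \<delta> ^ CARD('n) * m / 2 \<Longrightarrow>
      (h - k) * super_level \<Omega> u h \<le> 4 * (2 * CARD('n) + 1) * \<delta> * (K * N * super_level \<Omega> u k)"
proof -
  let ?M = "lebesgue_on \<Omega>"
  have \<Omega>'[measurable]: "\<Omega> \<in> sets borel" using \<Omega> by simp
  define w where "w = (\<lambda>x. max (u x - k) 0)"
  obtain g where g: "w \<in> W1p_0 i1 iN f \<Omega> 2" "H1 \<Omega> w g"
    "(LINT x|?M. norm (g x)) \<le> K * N * super_level \<Omega> u k"
    unfolding w_def by (rule energy_estimate[OF \<Omega> K N comp X sub l k]) blast
  have "u \<in> W1p i1 iN f \<Omega> 2" using sub by (simp add: weak_subsolution_def)
  then have [measurable]: "u \<in> borel_measurable ?M" using W1p_2_iff[OF \<Omega>] H1_measurable(1) by blast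
  have wm[measurable]: "w \<in> borel_measurable ?M" using H1_measurable(1)[OF g(2)] .
  obtain w' where w': "w' \<in> borel_measurable borel" "AE x in ?M. w x = w' x" "\<And>x. x \<notin> \<Omega> \<Longrightarrow> w' x = 0"
    using lebesgue_on_borel_representative[OF \<Omega>' wm] by blast
  note [measurable] = w'(1)
  let ?G = "LINT x|?M. norm (g x)"
  have G0: "0 \<le> ?G" by (simp add: integral_nonneg)
  have sh: "(LINT x|lborel. \<bar>B i x * (w' (x + t *\<^sub>R axis i 1) - w' x)\<bar>) \<le> t * ?G"
     "integrable lborel (\<lambda>x. B i x * (w' (x + t *\<^sub>R axis i 1) - w' x))" if "t \<ge> 0" for i t
    using W1p_0_shift_estimate(1,2)[OF \<Omega> g(1,2) w' that] by auto
  have iw: "integrable lborel w'"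
    by (rule W1p_0_shift_estimate(3)[OF \<Omega> g(1,2) w']) (auto intro: order_refl)
  have supp: "\<bar>x $ i1\<bar> \<le> \<rho>" if "w' x \<noteq> 0" for x using \<rho>(2) w'(3) that by blast
  have meas: "{x\<in>\<Omega>. u x > c} \<in> sets ?M" for c
  proof -
    have "{x \<in> space ?M. u x > c} \<in> sets ?M" by measurable
    then show ?thesis by simp
  qed
  have fin: "emeasure ?M {x\<in>\<Omega>. u x > c} < \<infinity>" for c
  proof -
    have "emeasure ?M {x\<in>\<Omega>. u x > c} \<le> emeasure ?M \<Omega>" by (intro emeasure_mono) auto
    also have "\<dots> < \<infinity>" by (rule finite_emeasure_lebesgue_on[OF \<Omega>])
    finally show ?thesis .
  qed
  have w'm: "w' \<in> borel_measurable ?M" by (rule lebesgue_on_borel_measurable) fact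
  have eqI: "(LINT x|lborel. \<bar>w' x\<bar>) = (LINT x|?M. w x)"
  proof -
    have "(LINT x|?M. w x) = (LINT x|?M. \<bar>w' x\<bar>)"
    proof (rule integral_cong_AE)
      show "AE x in ?M. w x = \<bar>w' x\<bar>" using w'(2)
      proof eventually_elim
        case (elim x)
        have "0 \<le> w x" by (simp add: w_def)
        with elim show ?case by simp
      qed
    qed (use w'm in auto)
    also have "\<dots> = (LINT x|lborel. indicator \<Omega> x * \<bar>w' x\<bar>)" by (rule integral_lebesgue_on_borel) measurable
    also have "\<dots> = (LINT x|lborel. \<bar>w' x\<bar>)"
      using w'(3) by (intro Bochner_Integration.integral_cong) (auto simp: indicator_def)
    finally show ?thesis by simp
  qed
  have cheb: "(h - k) * super_level \<Omega> u h \<le> (LINT x|?M. w x)"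
  proof -
    have "(h - k) * super_level \<Omega> u h = (LINT x|?M. (h - k) * indicator {x\<in>\<Omega>. u x > h} x)"
    proof -
      have "{x\<in>\<Omega>. u x > h} \<inter> space ?M = {x\<in>\<Omega>. u x > h}" by auto
      then show ?thesis by (simp add: super_level_def)
    qed
    also have "\<dots> \<le> (LINT x|?M. w x)"
    proof (rule integral_mono)
      show "integrable ?M (\<lambda>x. (h - k) * indicator {x\<in>\<Omega>. u x > h} x)"
        using integrable_real_indicator[OF meas fin, of h] by simp
      show "integrable ?M w" using g(2) by (simp add: H1_def wgrad_def)
      show "(h - k) * indicator {x\<in>\<Omega>. u x > h} x \<le> w x" for x
        using h by (auto simp: w_def indicator_def)
    qed
    finally show ?thesis .
  qed
  have em: "emeasure lborel {x. w' x \<noteq> 0} = ennreal (super_level \<Omega> u k)"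
  proof -
    have E: "{x. w' x \<noteq> 0} \<in> sets borel" by measurable
    have "emeasure lborel {x. w' x \<noteq> 0} = emeasure lebesgue {x. w' x \<noteq> 0}" using E by simp
    also have "\<dots> = emeasure ?M {x. w' x \<noteq> 0}"
      using w'(3) by (subst emeasure_restrict_space) auto
    also have "\<dots> = emeasure ?M {x\<in>\<Omega>. u x > k}"
    proof (rule emeasure_eq_AE)
      have "AE x in ?M. x \<in> \<Omega>" by (simp add: AE_lebesgue_on_iff)
      with w'(2) show "AE x in ?M. x \<in> {x. w' x \<noteq> 0} \<longleftrightarrow> x \<in> {x\<in>\<Omega>. u x > k}"
      proof eventually_elim
        case (elim x)
        then show ?case by (auto simp: w_def max_def split: if_splits)
      qed
      have "{x \<in> space ?M. w' x \<noteq> 0} \<in> sets ?M" using w'm by measurable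
      moreover have "{x \<in> space ?M. w' x \<noteq> 0} = {x. w' x \<noteq> 0}" using w'(3) by auto
      ultimately show "{x. w' x \<noteq> 0} \<in> sets ?M" by simp
    qed (rule meas)
    also have "\<dots> = ennreal (super_level \<Omega> u k)"
      unfolding super_level_def using fin[of k] by (intro emeasure_eq_ennreal_measure) auto
    finally show ?thesis .
  qed
  have "(h - k) * super_level \<Omega> u h \<le> 3 * \<rho> * ?G"
    using cheb poincare[OF iw G0 sh supp \<rho>(1)] by (simp add: eqI)
  also have "\<dots> \<le> 3 * \<rho> * (K * N * super_level \<Omega> u k)" using g(3) \<rho>(1) by (intro mult_left_mono) auto
  finally show "(h - k) * super_level \<Omega> u h \<le> 3 * \<rho> * (K * N * super_level \<Omega> u k)" .
  fix \<delta> m :: real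
  assume d: "\<delta> > 0" "m > 0" "\<And>s. \<delta> \<le> \<bar>s\<bar> \<Longrightarrow> \<bar>s\<bar> \<le> \<rho> \<Longrightarrow> m \<le> \<bar>f s\<bar>"
    and V: "super_level \<Omega> u k \<le> \<delta> ^ CARD('n) * m / 2"
  have "emeasure lborel {x. w' x \<noteq> 0} \<le> ennreal (\<delta> ^ CARD('n) * m / 2)" unfolding em using V by (rule ennreal_leI)
  from faber_krahn[OF iw G0 sh supp this d(2,1,3)]
  have "(h - k) * super_level \<Omega> u h \<le> 4 * (2 * CARD('n) + 1) * \<delta> * ?G" using cheb by (simp add: eqI)
  also have "\<dots> \<le> 4 * (2 * CARD('n) + 1) * \<delta> * (K * N * super_level \<Omega> u k)" using g(3) d by (intro mult_left_mono) auto
  finally show "(h - k) * super_level \<Omega> u h \<le> 4 * (2 * CARD('n) + 1) * \<delta> * (K * N * super_level \<Omega> u k)" .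
qed

end

section \<open>Bounds on the degeneracy, the abstract level iteration and the final estimate\<close>

lemma degeneracy_continuous:
  assumes L: "\<exists>L. L-lipschitz_on UNIV (degeneracy_B i1 iN f :: real^'n::finite \<Rightarrow> real^'n^'n)"
  shows "continuous_on UNIV f"
proof -
  obtain L where L: "L-lipschitz_on UNIV (degeneracy_B i1 iN f :: real^'n \<Rightarrow> real^'n^'n)" using L by blast
  have "L-lipschitz_on UNIV f"
  proof (rule lipschitz_onI)
    fix s t :: real
    let ?D = "degeneracy_B i1 iN f (axis i1 s :: real^'n) - degeneracy_B i1 iN f (axis i1 t)"
    have "dist (f s) (f t) = norm (?D $ iN $ iN)"
      by (simp add: degeneracy_B_def diag_last_def dist_real_def axis_def)
    also have "\<dots> \<le> norm (?D $ iN)" by (rule Finite_Cartesian_Product.norm_nth_le)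
    also have "\<dots> \<le> norm ?D" by (rule Finite_Cartesian_Product.norm_nth_le)
    also have "\<dots> \<le> L * dist (axis i1 s :: real^'n) (axis i1 t)"
      using lipschitz_onD[OF L, of "axis i1 s" "axis i1 t"] by (simp add: dist_norm)
    also have "dist (axis i1 s :: real^'n) (axis i1 t) = dist s t"
    proof -
      have "(axis i1 s :: real^'n) - axis i1 t = (s - t) *\<^sub>R axis i1 1" by (auto simp: vec_eq_iff axis_def)
      then show ?thesis by (simp add: dist_norm)
    qed
    finally show "dist (f s) (f t) \<le> L * dist s t" .
  qed (rule lipschitz_on_nonneg[OF L])
  then show ?thesis by (rule lipschitz_on_continuous_on)
qed

text \<open>Close to 0 the bound on \<open>F\<close> gives the estimate with constant 1, by
  monotonicity of the power. On the remaining compact annulus \<open>f\<close> is continuous without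
  zeros, and \<open>c0\<close> absorbs its minimum.\<close>

lemma degeneracy_lower_bound:
  fixes f F :: "real \<Rightarrow> real" and R \<sigma> \<rho> :: real
  assumes f: "degeneracy_function f F R" and c: "continuous_on UNIV f" and R: "R > 0" and \<sigma>: "\<sigma> > 0"
    and F: "\<forall>r\<in>{0<..<R}. F r \<le> r powr (- \<sigma>)"
  obtains c0 where "0 < c0" "c0 \<le> 1"
    "\<And>\<delta> s. 0 < \<delta> \<Longrightarrow> \<delta> \<le> \<bar>s\<bar> \<Longrightarrow> \<bar>s\<bar> \<le> \<rho> \<Longrightarrow> c0 * exp (- (\<delta> powr (- \<sigma>))) \<le> \<bar>f s\<bar>"
proof -
  \<comment> \<open>Starting the annulus at \<open>R / 2\<close> makes it compact and leaves only
    points with |s| < R outside it.\<close>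
  define C where "C = cball (0::real) \<rho> - ball 0 (R / 2)"
  have C: "compact C" unfolding C_def by (intro compact_diff) auto
  have fnz: "f s \<noteq> 0" if "s \<noteq> 0" for s using f that by (auto simp: degeneracy_function_def)
  obtain c1 where c1: "c1 > 0" "\<And>s. s \<in> C \<Longrightarrow> c1 \<le> \<bar>f s\<bar>"
  proof (cases "C = {}")
    case False
    have "continuous_on C (\<lambda>s. \<bar>f s\<bar>)" using c by (intro continuous_intros) (auto intro: continuous_on_subset)
    from continuous_attains_inf[OF C False this] obtain s0 where s0: "s0 \<in> C" "\<And>s. s \<in> C \<Longrightarrow> \<bar>f s0\<bar> \<le> \<bar>f s\<bar>" by blast
    have "s0 \<noteq> 0" using s0(1) R by (auto simp: C_def)
    then show thesis using that[of "\<bar>f s0\<bar>"] s0 fnz by auto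
  qed (use that[of 1] in auto)
  show thesis
  proof (rule that[of "min 1 c1"])
    fix \<delta> s :: real assume \<delta>: "0 < \<delta>" "\<delta> \<le> \<bar>s\<bar>" "\<bar>s\<bar> \<le> \<rho>"
    let ?e = "exp (- (\<delta> powr (- \<sigma>)))"
    have e1: "0 < ?e" "?e \<le> 1" by simp_all
    show "min 1 c1 * ?e \<le> \<bar>f s\<bar>"
    proof (cases "s \<in> C")
      case True
      have "min 1 c1 * ?e \<le> c1 * 1" using e1 c1(1) by (intro mult_mono) auto
      then show ?thesis using c1(2)[OF True] by simp
    next
      case False
      then have sR: "\<bar>s\<bar> < R" "0 < \<bar>s\<bar>" using \<delta> R by (auto simp: C_def)
      have "F \<bar>s\<bar> \<le> \<bar>s\<bar> powr (- \<sigma>)" using F sR by auto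
      also have "\<dots> \<le> \<delta> powr (- \<sigma>)" using \<delta> \<sigma> by (intro powr_mono2') auto
      finally have "?e \<le> exp (- F \<bar>s\<bar>)" by simp
      also have "\<dots> = f s" using f sR by (auto simp: degeneracy_function_def)
      finally have "?e \<le> \<bar>f s\<bar>" by simp
      moreover have "min 1 c1 * ?e \<le> 1 * ?e" by (rule mult_right_mono) auto
      ultimately show ?thesis by linarith
    qed
  qed (use c1 in auto)
qed

text \<open>The increment \<open>D / \<kappa> * \<delta> j\<close> is chosen so that the decay
  yields exactly the factor \<open>\<kappa>\<close>; then \<open>a (h j) \<le> V j\<close> persists
  because \<open>V\<close> loses at most this factor per step. All levels lie below one finite
  level, where \<open>a\<close> is therefore bounded by every \<open>V j\<close>.\<close>

lemma level_iteration:
  fixes a :: "real \<Rightarrow> real" and V \<delta> :: "nat \<Rightarrow> real"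
  assumes anti: "\<And>k h. k \<le> h \<Longrightarrow> a h \<le> a k" and nonneg: "\<And>k. 0 \<le> a k"
    and V: "V \<longlonglongrightarrow> 0" "\<And>j. \<kappa> * V j \<le> V (Suc j)" and \<kappa>: "\<kappa> > 0"
    and \<delta>: "\<And>j. \<delta> j > 0" "summable \<delta>" and D: "D > 0"
    and decay: "\<And>k h j. l \<le> k \<Longrightarrow> k < h \<Longrightarrow> a k \<le> V j \<Longrightarrow> (h - k) * a h \<le> D * \<delta> j * a k"
    and h0: "l \<le> h0" "a h0 \<le> V 0"
  shows "a (h0 + D / \<kappa> * suminf \<delta>) = 0"
proof -
  define h where "h j = h0 + D / \<kappa> * (\<Sum>i<j. \<delta> i)" for j
  have lh: "l \<le> h j" for j
  proof -
    have "0 \<le> D / \<kappa> * (\<Sum>i<j. \<delta> i)"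
      using D \<kappa> \<delta>(1) by (intro mult_nonneg_nonneg sum_nonneg) (auto intro: less_imp_le)
    then show ?thesis using h0(1) by (simp add: h_def)
  qed
  have step: "h (Suc j) - h j = D / \<kappa> * \<delta> j" for j by (simp add: h_def algebra_simps)
  have aV: "a (h j) \<le> V j" for j
  proof (induction j)
    case (Suc j)
    have p: "D / \<kappa> * \<delta> j > 0" using D \<kappa> \<delta>(1) by simp
    then have "h j < h (Suc j)" using step[of j] by linarith
    from decay[OF lh this Suc.IH] have "(D / \<kappa> * \<delta> j) * a (h (Suc j)) \<le> D * \<delta> j * a (h j)" unfolding step .
    also have "\<dots> = (D / \<kappa> * \<delta> j) * (\<kappa> * a (h j))" using \<kappa> by simp
    finally have "a (h (Suc j)) \<le> \<kappa> * a (h j)" using p by (subst (asm) mult_le_cancel_left_pos)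
    also have "\<dots> \<le> \<kappa> * V j" using \<kappa> Suc.IH by simp
    also have "\<dots> \<le> V (Suc j)" by (rule V)
    finally show ?case .
  qed (simp add: h_def h0)
  have "a (h0 + D / \<kappa> * suminf \<delta>) \<le> V j" for j
  proof -
    have "(\<Sum>i<j. \<delta> i) \<le> suminf \<delta>" using \<delta> by (intro sum_le_suminf) (auto intro: less_imp_le)
    then have "h j \<le> h0 + D / \<kappa> * suminf \<delta>" using D \<kappa> by (simp add: h_def mult_left_mono divide_right_mono)
    from order_trans[OF anti[OF this] aV] show ?thesis .
  qed
  then have "a (h0 + D / \<kappa> * suminf \<delta>) \<le> 0" using V(1) by (intro LIMSEQ_le_const[OF V(1)]) auto
  with nonneg show ?thesis by (simp add: order_antisym)
qed

theorem theorem17: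
  fixes i1 iN :: "'n::finite"
    and f F :: "real \<Rightarrow> real"
    and R \<sigma> K :: real
    and \<Omega> :: "(real ^ 'n) set"
  assumes "i1 \<noteq> iN"
    and "R > 0"
    and "degeneracy_function f F R"
    and "\<exists>L. L-lipschitz_on UNIV (degeneracy_B i1 iN f)"
    and "geometric_structure F R"
    and "0 < \<sigma>" and "\<sigma> < 1"
    and "\<forall>r\<in>{0<..<R}. F r \<le> r powr (- \<sigma>)"
    and "open \<Omega>" and "connected \<Omega>" and "bounded \<Omega>" and "\<Omega> \<noteq> {}"
    and "K \<ge> 1"
  shows "\<exists>C>0. \<forall>\<A> \<phi> u.
     bounded_measurable_components \<Omega> \<A> \<longrightarrow>
     comparable_with K \<Omega> \<A> (degeneracy_A i1 iN f) \<longrightarrow>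
     A_admissible i1 iN f \<Omega> \<phi> \<longrightarrow>
     weak_subsolution i1 iN f \<Omega> \<A> \<phi> u \<longrightarrow>
     (\<exists>l. weakly_bounded_on_boundary_by i1 iN f \<Omega> u l) \<longrightarrow>
     (\<exists>M. AE x in lebesgue_on \<Omega>. u x \<le> M) \<and>
     esssup (lebesgue_on \<Omega>) (\<lambda>x. ereal (u x))
       \<le> boundary_sup i1 iN f \<Omega> u + ereal C * enn2ereal (X_norm i1 iN f \<Omega> \<phi>)"
proof -
  have fc: "continuous_on UNIV f" using assms(4) by (rule degeneracy_continuous)
  interpret degenerate_setting i1 iN f
    by standard (use assms(1,3) fc in \<open>auto simp: degeneracy_function_def\<close>)
  note \<Omega> = \<open>open \<Omega>\<close> \<open>bounded \<Omega>\<close>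
  let ?n = "CARD('n)" and ?M = "lebesgue_on \<Omega>"
  obtain \<rho> where \<rho>: "\<rho> > 0" "\<And>x. x \<in> \<Omega> \<Longrightarrow> \<bar>x $ i1\<bar> \<le> \<rho>"
  proof -
    obtain b where b: "b > 0" "\<And>x. x \<in> \<Omega> \<Longrightarrow> norm x \<le> b" using \<Omega>(2) bounded_pos by metis
    have "\<bar>x $ i1\<bar> \<le> b" if "x \<in> \<Omega>" for x using b(2)[OF that] component_le_norm_cart[of x i1] by linarith
    then show thesis using that b(1) by blast
  qed
  obtain c0 where c0: "0 < c0" "c0 \<le> 1"
    "\<And>\<delta> s. 0 < \<delta> \<Longrightarrow> \<delta> \<le> \<bar>s\<bar> \<Longrightarrow> \<bar>s\<bar> \<le> \<rho> \<Longrightarrow> c0 * exp (- (\<delta> powr (- \<sigma>))) \<le> \<bar>f s\<bar>"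
    using degeneracy_lower_bound[OF assms(3) fc assms(2,6,8)] by blast
  \<comment> \<open>\<open>V j\<close> is the measure of the support up to which the Faber-Krahn inequality holds at scale \<open>\<delta> j\<close>; since
      \<open>\<delta> j\<close> to the power \<open>- \<sigma>\<close> is \<open>j + 1\<close>, consecutive thresholds are comparable.\<close>
  define \<delta> where "\<delta> j = real (Suc j) powr (- 1 / \<sigma>)" for j
  define m where "m j = c0 * exp (- real (Suc j))" for j
  define V where "V j = \<delta> j ^ ?n * m j / 2" for j
  \<comment> \<open>Since j + 2 \<le> 2 (j + 1), \<open>\<theta>\<close> bounds the ratio of
    consecutive scales from below; \<open>exp (-1)\<close> is the exact ratio of consecutive
    \<open>m\<close>, so \<open>\<kappa>\<close> bounds the ratio of consecutive
    \<open>V\<close>.\<close>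
  define \<theta> where "\<theta> = (2::real) powr (- 1 / \<sigma>)"
  define \<kappa> where "\<kappa> = \<theta> ^ ?n * exp (-1)"
  have \<delta>pos: "\<delta> j > 0" for j by (simp add: \<delta>_def)
  have mpos: "m j > 0" for j using c0 by (simp add: m_def)
  have Vpos: "V j > 0" for j using \<delta>pos mpos by (simp add: V_def)
  have \<theta>pos: "\<theta> > 0" by (simp add: \<theta>_def)
  have \<kappa>pos: "\<kappa> > 0" using \<theta>pos by (simp add: \<kappa>_def)
  have m_le: "m j \<le> \<bar>f s\<bar>" if "\<delta> j \<le> \<bar>s\<bar>" "\<bar>s\<bar> \<le> \<rho>" for j s
  proof -
    have "\<delta> j powr (- \<sigma>) = real (Suc j)"
      using \<open>0 < \<sigma>\<close> by (simp add: \<delta>_def powr_powr del: of_nat_Suc)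
    then show ?thesis using c0(3)[OF \<delta>pos that] by (simp add: m_def)
  qed
  have sum\<delta>: "summable \<delta>"
  proof -
    have "- 1 / \<sigma> < - 1" using \<open>0 < \<sigma>\<close> \<open>\<sigma> < 1\<close> by (simp add: field_simps)
    then have "summable (\<lambda>j. real j powr (- 1 / \<sigma>))" by (subst summable_real_powr_iff)
    then show ?thesis unfolding \<delta>_def[abs_def] by (subst summable_Suc_iff)
  qed
  have V\<kappa>: "\<kappa> * V j \<le> V (Suc j)" for j
  proof -
    have "\<theta> * \<delta> j = (2 * real (Suc j)) powr (- 1 / \<sigma>)"
      by (simp add: \<theta>_def \<delta>_def powr_mult del: of_nat_Suc)
    also have "\<dots> \<le> \<delta> (Suc j)"
      unfolding \<delta>_def using \<open>0 < \<sigma>\<close> by (intro powr_mono2') auto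
    finally have "(\<theta> * \<delta> j) ^ ?n \<le> \<delta> (Suc j) ^ ?n"
      using \<theta>pos \<delta>pos[of j] by (intro power_mono) auto
    then have "(\<theta> * \<delta> j) ^ ?n * (m (Suc j) / 2) \<le> \<delta> (Suc j) ^ ?n * (m (Suc j) / 2)"
      using mpos[of "Suc j"] by (intro mult_right_mono) auto
    moreover have "m (Suc j) = exp (-1) * m j" by (simp add: m_def exp_add[symmetric])
    ultimately show ?thesis by (simp add: V_def \<kappa>_def power_mult_distrib mult_ac)
  qed
  have V0: "V \<longlonglongrightarrow> 0"
  proof (rule tendsto_sandwich[OF _ _ tendsto_const])
    show "(\<lambda>j. exp (- real (Suc j))) \<longlonglongrightarrow> 0" by real_asymp
    have "V j \<le> exp (- real (Suc j))" for j
    proof -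
      have "\<delta> j \<le> real (Suc j) powr 0"
        unfolding \<delta>_def using \<open>0 < \<sigma>\<close> by (intro powr_mono) auto
      then have "\<delta> j ^ ?n \<le> 1" using \<delta>pos[of j] by (intro power_le_one) auto
      then have "\<delta> j ^ ?n * m j \<le> 1 * (1 * exp (- real (Suc j)))"
        unfolding m_def using c0 by (intro mult_mono) auto
      then show ?thesis using Vpos[of j] by (simp add: V_def)
    qed
    then show "\<forall>\<^sub>F j in sequentially. V j \<le> exp (- real (Suc j))" by simp
    show "\<forall>\<^sub>F j in sequentially. 0 \<le> V j" using Vpos by (intro always_eventually allI less_imp_le)
  qed
  \<comment> \<open>\<open>c1\<close> collects the Faber-Krahn constant and the ellipticity.
    \<open>c2\<close> is the level rise, in units of the norm, after which Chebyshev and Poincare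
    bring the level measure from at most that of \<open>\<Omega>\<close> down to \<open>V 0\<close>;
    the summand 1 keeps it positive.\<close>
  define c1 where "c1 = 4 * (2 * real ?n + 1) * K"
  define c2 where "c2 = 3 * \<rho> * K * measure ?M \<Omega> / V 0 + 1"
  define C where "C = c2 + c1 / \<kappa> * suminf \<delta>"
  have c1pos: "c1 > 0" using \<open>K \<ge> 1\<close> by (simp add: c1_def)
  have c2pos: "c2 \<ge> 1" using \<open>K \<ge> 1\<close> \<rho>(1) Vpos[of 0] by (simp add: c2_def)
  have "suminf \<delta> \<ge> 0" using sum\<delta> \<delta>pos by (intro suminf_nonneg) (auto intro: less_imp_le)
  then have Cpos: "C > 0" using c1pos c2pos \<kappa>pos
    by (auto simp: C_def intro!: add_pos_nonneg mult_nonneg_nonneg divide_nonneg_nonneg)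
  \<comment> \<open>Level increments are multiples of \<open>N\<close> and must be positive, so the
    norm is replaced by a strictly larger or equal positive bound.\<close>
  have key: "AE x in ?M. u x \<le> l + C * N"
    if comp: "comparable_with K \<Omega> \<A> (degeneracy_A i1 iN f)" and X: "X_norm i1 iN f \<Omega> \<phi> \<le> ennreal N"
      and sub: "weak_subsolution i1 iN f \<Omega> \<A> \<phi> u" and l: "weakly_bounded_on_boundary_by i1 iN f \<Omega> u l" and N: "N > 0"
    for \<A> \<phi> u l N
  proof -
    have "u \<in> W1p i1 iN f \<Omega> 2" using sub by (simp add: weak_subsolution_def)
    then have [measurable]: "u \<in> borel_measurable ?M" using W1p_2_iff[OF \<Omega>] H1_measurable(1) by blast
    have meas: "{x\<in>\<Omega>. u x > c} \<in> sets ?M" for c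
    proof -
      have "{x \<in> space ?M. u x > c} \<in> sets ?M" by measurable
      then show ?thesis by simp
    qed
    have fin: "emeasure ?M S \<noteq> \<infinity>" if "S \<subseteq> \<Omega>" for S
    proof -
      have "emeasure ?M S \<le> emeasure ?M \<Omega>" using that by (intro emeasure_mono) auto
      then show ?thesis using finite_emeasure_lebesgue_on(1)[OF \<Omega>] by (auto simp: top_unique)
    qed
    let ?a = "super_level \<Omega> u"
    have anti: "?a h \<le> ?a k" if "k \<le> h" for k h
      unfolding super_level_def using that meas fin[of "{x\<in>\<Omega>. u x > k}"]
      by (intro measure_mono_fmeasurable) (auto intro!: fmeasurableI simp: less_top)
    have a\<Omega>: "?a k \<le> measure ?M \<Omega>" for k
      unfolding super_level_def using meas fin[of \<Omega>]
      by (intro measure_mono_fmeasurable) (auto intro!: fmeasurableI simp: less_top)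
    have a0: "0 \<le> ?a k" for k by (simp add: super_level_def)
    have decay: "(h - k) * ?a h \<le> (c1 * N) * \<delta> j * ?a k" if "l \<le> k" "k < h" "?a k \<le> V j" for k h j
    proof -
      have "(h - k) * ?a h \<le> 4 * (2 * ?n + 1) * \<delta> j * (K * N * ?a k)"
        using super_level_decay(2)[OF \<Omega> \<open>K \<ge> 1\<close> less_imp_le[OF N] comp X sub l that(1,2) \<rho> \<delta>pos mpos m_le] that(3)
        by (simp add: V_def)
      then show ?thesis by (simp add: c1_def algebra_simps)
    qed
    have start: "?a (l + c2 * N) \<le> V 0"
    proof -
      have "l < l + c2 * N" using c2pos N by simp
      from super_level_decay(1)[OF \<Omega> \<open>K \<ge> 1\<close> less_imp_le[OF N] comp X sub l order_refl this \<rho>]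
      have "c2 * N * ?a (l + c2 * N) \<le> 3 * \<rho> * (K * N * ?a l)" by simp
      also have "\<dots> \<le> 3 * \<rho> * (K * N * measure ?M \<Omega>)"
        using \<rho>(1) \<open>K \<ge> 1\<close> N a\<Omega>[of l] by (intro mult_left_mono) auto
      also have "\<dots> \<le> c2 * N * V 0" using Vpos[of 0] N by (simp add: c2_def field_simps)
      finally show ?thesis using c2pos N by (subst (asm) mult_le_cancel_left_pos) auto
    qed
    have "?a ((l + c2 * N) + c1 * N / \<kappa> * suminf \<delta>) = 0"
      by (rule level_iteration[where a="?a" and l=l and V=V, OF anti a0 V0 V\<kappa> \<kappa>pos \<delta>pos sum\<delta> _ decay _ start])
         (use c1pos c2pos N in auto)
    moreover have "(l + c2 * N) + c1 * N / \<kappa> * suminf \<delta> = l + C * N" by (simp add: C_def algebra_simps)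
    ultimately have "measure ?M {x\<in>\<Omega>. u x > l + C * N} = 0" by (simp only: super_level_def)
    then have "emeasure ?M {x\<in>\<Omega>. u x > l + C * N} = 0"
      using fin[of "{x\<in>\<Omega>. u x > l + C * N}"] by (subst emeasure_eq_ennreal_measure) auto
    then have "{x\<in>\<Omega>. u x > l + C * N} \<in> null_sets ?M" using meas by (simp add: null_sets_def)
    from AE_not_in[OF this] have "AE x in ?M. x \<notin> {x\<in>\<Omega>. u x > l + C * N}" .
    moreover have "AE x in ?M. x \<in> \<Omega>" using \<Omega> by (simp add: AE_lebesgue_on_iff)
    ultimately show ?thesis by eventually_elim auto
  qed
  show ?thesis
  proof (rule exI[of _ C], intro conjI Cpos allI impI)
    fix \<A> \<phi> u
    assume comp: "comparable_with K \<Omega> \<A> (degeneracy_A i1 iN f)" and adm: "A_admissible i1 iN f \<Omega> \<phi>"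
      and sub: "weak_subsolution i1 iN f \<Omega> \<A> \<phi> u" and ex: "\<exists>l. weakly_bounded_on_boundary_by i1 iN f \<Omega> u l"
    have "u \<in> W1p i1 iN f \<Omega> 2" using sub by (simp add: weak_subsolution_def)
    then have [measurable]: "u \<in> borel_measurable ?M" using W1p_2_iff[OF \<Omega>] H1_measurable(1) by blast
    define N where "N = enn2real (X_norm i1 iN f \<Omega> \<phi>)"
    have N: "0 \<le> N" "X_norm i1 iN f \<Omega> \<phi> = ennreal N" using adm by (auto simp: N_def A_admissible_def)
    have bound: "AE x in ?M. u x \<le> l + C * N" if l: "weakly_bounded_on_boundary_by i1 iN f \<Omega> u l" for l
    proof -
      \<comment> \<open>Enlarging the norm by 1/(j + 1) covers the case of norm 0; countably many
        exceptional null sets permit the limit.\<close>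
      have "AE x in ?M. u x \<le> l + C * (N + inverse (real (Suc j)))" for j
        by (rule key[OF comp _ sub l]) (use N in \<open>auto intro!: ennreal_leI add_nonneg_pos\<close>)
      then have "AE x in ?M. \<forall>j. u x \<le> l + C * (N + inverse (real (Suc j)))" by (simp add: AE_all_countable)
      then show ?thesis
      proof eventually_elim
        case (elim x)
        have "(\<lambda>j. l + C * (N + inverse (real (Suc j)))) \<longlonglongrightarrow> l + C * (N + 0)"
          by (intro tendsto_intros LIMSEQ_inverse_real_of_nat)
        from LIMSEQ_le_const[OF this] elim show ?case by auto
      qed
    qed
    show "\<exists>M. AE x in ?M. u x \<le> M" using ex bound by blast
    \<comment> \<open>Moving the finite term \<open>C * N\<close> to the left lets the infimum over
      \<open>l\<close> be taken by \<open>Inf_greatest\<close>, whether or not it is finite.\<close>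
    have "esssup ?M (\<lambda>x. ereal (u x)) - ereal (C * N) \<le> ereal l"
      if l: "weakly_bounded_on_boundary_by i1 iN f \<Omega> u l" for l
    proof -
      have "esssup ?M (\<lambda>x. ereal (u x)) \<le> ereal (l + C * N)"
        using bound[OF l] by (intro esssup_I) auto
      then show ?thesis by (cases "esssup ?M (\<lambda>x. ereal (u x))") auto
    qed
    then have "esssup ?M (\<lambda>x. ereal (u x)) - ereal (C * N) \<le> boundary_sup i1 iN f \<Omega> u"
      unfolding boundary_sup_def by (intro Inf_greatest) auto
    then have "esssup ?M (\<lambda>x. ereal (u x)) \<le> boundary_sup i1 iN f \<Omega> u + ereal (C * N)"
      by (subst (asm) ereal_minus_le) auto
    then show "esssup ?M (\<lambda>x. ereal (u x)) \<le> boundary_sup i1 iN f \<Omega> u + ereal C * enn2ereal (X_norm i1 iN f \<Omega> \<phi>)"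
      using N by (simp add: enn2ereal_ennreal)
  qed
qed

end
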